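(* Let $(G,O)$ be an equipped finite group. Then $$b_0(G)\leq a_{(G,O)}\leq h_2(G).$$ In particular, $a_{(G,G\setminus\{1\})}=b_0(G)$.
   Context: An equipped finite group $(G,O)$ is a finite group $G$ together with a subset $O\subset G$ that is a union of conjugacy classes of $G$ and generates $G$. Ambiguity index: let $\widetilde G$ be the group generated by the letters $y_g$, $g\in O$, subject to the relations $y_{g_1}y_{g_2}=y_{g_2}y_{g_2^{-1}g_1g_2}=y_{g_1g_2g_1^{-1}}y_{g_1}$ for all $g_1,g_2\in O$, and let $\beta:\widetilde G\to G$ be the homomorphism with $\beta(y_g)=g$. The commutator subgroup $[\widetilde G,\widetilde G]$ is known to be finite, and $a_{(G,O)}$ is the order of $\ker\beta\cap[\widetilde G,\widetilde G]$. $h_2(G)$ denotes the order of $H_2(G,\mathbb Z)$. Bogomolov multiplier: $B_0(G)=\ker\bigl[H^2(G,\mathbb Q/\mathbb Z)\to\prod_{A\subset G}H^2(A,\mathbb Q/\mathbb Z)\bigr]$, where $A$ runs over all abelian subgroups of $G$, the map is restriction, and $\mathbb Q/\mathbb Z$ has trivial action. $b_0(G)$ is the order of $B_0(G)$. *)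

theory Defs
  imports "HOL-Algebra.Generated_Groups" "HOL-Algebra.Free_Abelian_Groups"
begin

section \<open>Equipped finite groups\<close>

definition conjugacy_class :: "('a, 'm) monoid_scheme \<Rightarrow> 'a \<Rightarrow> 'a set" where
  "conjugacy_class G x = {g \<otimes>\<^bsub>G\<^esub> x \<otimes>\<^bsub>G\<^esub> inv\<^bsub>G\<^esub> g | g. g \<in> carrier G}"

definition equipped_finite_group :: "('a, 'm) monoid_scheme \<Rightarrow> 'a set \<Rightarrow> bool" where
  "equipped_finite_group G S \<longleftrightarrow>
     group G \<and> finite (carrier G) \<and>
     (\<exists>D \<subseteq> carrier G. S = (\<Union>x\<in>D. conjugacy_class G x)) \<and>
     generate G S = carrier G"


section \<open>Groups given by generators and relations\<close>

text \<open>
  A word is a list of letters \<open>(b, x)\<close>, standing for the generator \<open>x\<close> if \<open>b\<close> is \<open>True\<close> and for its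
  formal inverse otherwise. A relation is a pair of words. The group with generators \<open>S\<close> and
  relations \<open>R\<close> consists of the words over \<open>S\<close> modulo the least congruence that contains \<open>R\<close> and
  free cancellation.
\<close>

type_synonym 'x letters = "(bool \<times> 'x) list"

definition words :: "'x set \<Rightarrow> 'x letters set" where
  "words S = lists (UNIV \<times> S)"

inductive pres_eq :: "'x set \<Rightarrow> ('x letters \<times> 'x letters) set \<Rightarrow> 'x letters \<Rightarrow> 'x letters \<Rightarrow> bool"
  for S R where
  refl: "u \<in> words S \<Longrightarrow> pres_eq S R u u"
| sym: "pres_eq S R u v \<Longrightarrow> pres_eq S R v u"
| trans: "pres_eq S R u v \<Longrightarrow> pres_eq S R v w \<Longrightarrow> pres_eq S R u w"
| cong: "pres_eq S R u u' \<Longrightarrow> pres_eq S R v v' \<Longrightarrow> pres_eq S R (u @ v) (u' @ v')"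
| cancel: "x \<in> S \<Longrightarrow> pres_eq S R [(b, x), (\<not> b, x)] []"
| relation: "(u, v) \<in> R \<Longrightarrow> u \<in> words S \<Longrightarrow> v \<in> words S \<Longrightarrow> pres_eq S R u v"

definition pres_class :: "'x set \<Rightarrow> ('x letters \<times> 'x letters) set \<Rightarrow> 'x letters \<Rightarrow> 'x letters set" where
  "pres_class S R u = {v. pres_eq S R u v}"

definition presented_group ::
    "'x set \<Rightarrow> ('x letters \<times> 'x letters) set \<Rightarrow> 'x letters set monoid" where
  "presented_group S R =
     \<lparr>carrier = pres_class S R ` words S,
      mult = (\<lambda>U V. \<Union>u\<in>U. \<Union>v\<in>V. pres_class S R (u @ v)),
      one = pres_class S R []\<rparr>"

fun word_eval :: "('a, 'm) monoid_scheme \<Rightarrow> ('x \<Rightarrow> 'a) \<Rightarrow> 'x letters \<Rightarrow> 'a" where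
  "word_eval G \<phi> [] = \<one>\<^bsub>G\<^esub>"
| "word_eval G \<phi> ((b, x) # w) = (if b then \<phi> x else inv\<^bsub>G\<^esub> (\<phi> x)) \<otimes>\<^bsub>G\<^esub> word_eval G \<phi> w"

text \<open>The map out of a presented group induced by an assignment \<open>\<phi>\<close> of the generators that
  respects the relations.\<close>

definition presented_map :: "('a, 'm) monoid_scheme \<Rightarrow> ('x \<Rightarrow> 'a) \<Rightarrow> 'x letters set \<Rightarrow> 'a" where
  "presented_map G \<phi> U = the_elem (word_eval G \<phi> ` U)"

lemma words_simps [simp]:
  "[] \<in> words S" "a # u \<in> words S \<longleftrightarrow> snd a \<in> S \<and> u \<in> words S"
  "u @ v \<in> words S \<longleftrightarrow> u \<in> words S \<and> v \<in> words S"
  by (cases a; auto simp: words_def)+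

lemma pres_eq_words: "pres_eq S R u v \<Longrightarrow> u \<in> words S \<and> v \<in> words S"
  by (induction rule: pres_eq.induct) auto

lemma pres_class_eq_iff:
  "u \<in> words S \<Longrightarrow> pres_class S R u = pres_class S R v \<longleftrightarrow> pres_eq S R u v"
  unfolding pres_class_def by (blast intro: pres_eq.refl pres_eq.sym pres_eq.trans)

lemma carrier_presented_group: "carrier (presented_group S R) = pres_class S R ` words S"
  by (simp add: presented_group_def)

lemma one_presented_group: "\<one>\<^bsub>presented_group S R\<^esub> = pres_class S R []"
  by (simp add: presented_group_def)

lemma presented_group_mult:
  assumes "u \<in> words S" "v \<in> words S"
  shows "pres_class S R u \<otimes>\<^bsub>presented_group S R\<^esub> pres_class S R v = pres_class S R (u @ v)"
  using assms unfolding presented_group_def pres_class_def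
  by (auto intro: pres_eq.intros)

lemma group_presented_group: "group (presented_group S R)"
proof (rule groupI)
  show "\<exists>y\<in>carrier (presented_group S R). y \<otimes>\<^bsub>presented_group S R\<^esub> x = \<one>\<^bsub>presented_group S R\<^esub>"
    if "x \<in> carrier (presented_group S R)" for x
  proof -
    obtain u where u: "u \<in> words S" "x = pres_class S R u"
      using \<open>x \<in> carrier _\<close> by (auto simp: carrier_presented_group)
    have "\<exists>v\<in>words S. pres_eq S R (v @ u) []"
      using u(1)
    proof (induction u)
      case Nil
      show ?case by (auto intro: pres_eq.refl bexI[of _ "[]"] simp: pres_eq.refl)
    next
      case (Cons a u)
      obtain b y where a: "a = (b, y)" by (cases a)
      from Cons obtain v where v: "v \<in> words S" "pres_eq S R (v @ u) []" by auto
      have "pres_eq S R (v @ ([(\<not> b, y), (b, y)] @ u)) (v @ ([] @ u))"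
        using Cons.prems v(1) a pres_eq.cancel[of y S R "\<not> b"]
        by (intro pres_eq.cong) (auto intro: pres_eq.refl)
      with v(2) have "pres_eq S R ((v @ [(\<not> b, y)]) @ (a # u)) []"
        by (auto simp: a intro: pres_eq.trans)
      then show ?case
        using v(1) Cons.prems a by (intro bexI[of _ "v @ [(\<not> b, y)]"]) auto
    qed
    then obtain v where v: "v \<in> words S" "pres_eq S R (v @ u) []" by blast
    have "pres_class S R v \<otimes>\<^bsub>presented_group S R\<^esub> x = pres_class S R []"
      using u v by (simp add: presented_group_mult pres_class_eq_iff)
    then show ?thesis
      using v by (intro bexI[of _ "pres_class S R v"]) (auto simp: carrier_presented_group one_presented_group)
  qed
qed (auto simp: carrier_presented_group one_presented_group presented_group_mult)

lemma presented_map_class: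
  assumes "group G" and \<phi>: "\<And>x. x \<in> S \<Longrightarrow> \<phi> x \<in> carrier G"
    and R: "\<And>u v. (u, v) \<in> R \<Longrightarrow> u \<in> words S \<Longrightarrow> v \<in> words S \<Longrightarrow>
              word_eval G \<phi> u = word_eval G \<phi> v"
    and u: "u \<in> words S"
  shows "presented_map G \<phi> (pres_class S R u) = word_eval G \<phi> u"
    and "presented_map G \<phi> \<in> hom (presented_group S R) G"
proof -
  interpret group G by fact
  have closed: "word_eval G \<phi> w \<in> carrier G" if "w \<in> words S" for w
    using that by (induction w) (auto simp: \<phi>)
  have append: "word_eval G \<phi> (v @ w) = word_eval G \<phi> v \<otimes>\<^bsub>G\<^esub> word_eval G \<phi> w"
    if "v \<in> words S" "w \<in> words S" for v w
    using that by (induction v) (auto simp: \<phi> closed m_assoc)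
  have eq: "word_eval G \<phi> v = word_eval G \<phi> w" if "pres_eq S R v w" for v w
    using that
  proof (induction rule: pres_eq.induct)
    case (cong u u' v v')
    then show ?case by (metis append pres_eq_words)
  qed (auto simp: \<phi> R)
  have *: "presented_map G \<phi> (pres_class S R w) = word_eval G \<phi> w" if "w \<in> words S" for w
  proof -
    have "word_eval G \<phi> ` pres_class S R w = {word_eval G \<phi> w}"
      using that eq unfolding pres_class_def by (fastforce intro: pres_eq.refl)
    then show ?thesis by (simp add: presented_map_def)
  qed
  show "presented_map G \<phi> (pres_class S R u) = word_eval G \<phi> u"
    using u by (rule *)
  show "presented_map G \<phi> \<in> hom (presented_group S R) G"
    by (rule homI) (auto simp: carrier_presented_group * closed presented_group_mult append)
qed


section \<open>The ambiguity index\<close>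

text \<open>
  \<open>C_group G S\<close> is the group with generators \<open>y\<^sub>g\<close> for \<open>g \<in> S\<close> and relations
  \<open>y\<^sub>g y\<^sub>h = y\<^sub>h y\<^sub>k\<close> for \<open>k = h\<^sup>-\<^sup>1 g h\<close> and \<open>y\<^sub>g y\<^sub>h = y\<^sub>k y\<^sub>g\<close> for \<open>k = g h g\<^sup>-\<^sup>1\<close>,
  \<open>C_generator G S g\<close> is its element \<open>y\<^sub>g\<close>, and \<open>C_map G\<close> is the homomorphism to \<open>G\<close> sending
  \<open>y\<^sub>g\<close> to \<open>g\<close> (lemmas \<open>C_map_hom\<close>, \<open>C_map_generator\<close>).
\<close>

definition gen :: "'x \<Rightarrow> 'x letters" where
  "gen x = [(True, x)]"

definition C_relations :: "('a, 'm) monoid_scheme \<Rightarrow> 'a set \<Rightarrow> ('a letters \<times> 'a letters) set" where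
  "C_relations G S =
     {(gen g @ gen h, gen h @ gen (inv\<^bsub>G\<^esub> h \<otimes>\<^bsub>G\<^esub> g \<otimes>\<^bsub>G\<^esub> h)) | g h. g \<in> S \<and> h \<in> S} \<union>
     {(gen g @ gen h, gen (g \<otimes>\<^bsub>G\<^esub> h \<otimes>\<^bsub>G\<^esub> inv\<^bsub>G\<^esub> g) @ gen g) | g h. g \<in> S \<and> h \<in> S}"

definition C_group :: "('a, 'm) monoid_scheme \<Rightarrow> 'a set \<Rightarrow> 'a letters set monoid" where
  "C_group G S = presented_group S (C_relations G S)"

definition C_generator :: "('a, 'm) monoid_scheme \<Rightarrow> 'a set \<Rightarrow> 'a \<Rightarrow> 'a letters set" where
  "C_generator G S g = pres_class S (C_relations G S) (gen g)"

definition C_map :: "('a, 'm) monoid_scheme \<Rightarrow> 'a letters set \<Rightarrow> 'a" where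
  "C_map G = presented_map G (\<lambda>g. g)"

definition ambiguity_index :: "('a, 'm) monoid_scheme \<Rightarrow> 'a set \<Rightarrow> nat" where
  "ambiguity_index G S =
     card (kernel (C_group G S) G (C_map G) \<inter> derived (C_group G S) (carrier (C_group G S)))"

lemma C_map:
  assumes "group G" "S \<subseteq> carrier G"
  shows C_map_hom: "C_map G \<in> hom (C_group G S) G"
    and C_map_generator: "g \<in> S \<Longrightarrow> C_map G (C_generator G S g) = g"
proof -
  interpret group G by fact
  have conj: "h \<otimes>\<^bsub>G\<^esub> (inv\<^bsub>G\<^esub> h \<otimes>\<^bsub>G\<^esub> k) = k" if "h \<in> carrier G" "k \<in> carrier G" for h k
    using that by (simp flip: m_assoc)
  have R: "word_eval G (\<lambda>g. g) u = word_eval G (\<lambda>g. g) v" if "(u, v) \<in> C_relations G S" for u v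
    using that assms(2)
    by (auto simp: C_relations_def gen_def subset_iff m_assoc conj)
  show "C_map G \<in> hom (C_group G S) G"
    unfolding C_map_def C_group_def
    using assms R by (intro presented_map_class(2)[where u = "[]"]) auto
  show "C_map G (C_generator G S g) = g" if "g \<in> S"
    unfolding C_map_def C_generator_def
    using assms R that by (subst presented_map_class(1)) (auto simp: gen_def)
qed


section \<open>The second integral homology group\<close>

text \<open>
  Homology of the inhomogeneous bar complex with trivial integer coefficients, whose group of
  \<open>n\<close>-chains is free abelian on \<open>G\<^sup>n\<close>.
\<close>

definition bar_boundary2 :: "('a, 'm) monoid_scheme \<Rightarrow> ('a \<times> 'a \<Rightarrow>\<^sub>0 int) \<Rightarrow> ('a \<Rightarrow>\<^sub>0 int)" where
  "bar_boundary2 G = frag_extend (\<lambda>(g, h). frag_of h - frag_of (g \<otimes>\<^bsub>G\<^esub> h) + frag_of g)"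

definition bar_boundary3 ::
    "('a, 'm) monoid_scheme \<Rightarrow> ('a \<times> 'a \<times> 'a \<Rightarrow>\<^sub>0 int) \<Rightarrow> ('a \<times> 'a \<Rightarrow>\<^sub>0 int)" where
  "bar_boundary3 G = frag_extend (\<lambda>(g, h, k).
     frag_of (h, k) - frag_of (g \<otimes>\<^bsub>G\<^esub> h, k) + frag_of (g, h \<otimes>\<^bsub>G\<^esub> k) - frag_of (g, h))"

definition cycles2 :: "('a, 'm) monoid_scheme \<Rightarrow> ('a \<times> 'a \<Rightarrow>\<^sub>0 int) set" where
  "cycles2 G = kernel (free_Abelian_group (carrier G \<times> carrier G))
                      (free_Abelian_group (carrier G)) (bar_boundary2 G)"

definition boundaries2 :: "('a, 'm) monoid_scheme \<Rightarrow> ('a \<times> 'a \<Rightarrow>\<^sub>0 int) set" where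
  "boundaries2 G =
     bar_boundary3 G ` carrier (free_Abelian_group (carrier G \<times> carrier G \<times> carrier G))"

definition homology2 :: "('a, 'm) monoid_scheme \<Rightarrow> ('a \<times> 'a \<Rightarrow>\<^sub>0 int) set monoid" where
  "homology2 G =
     free_Abelian_group (carrier G \<times> carrier G)\<lparr>carrier := cycles2 G\<rparr> Mod boundaries2 G"

definition h2 :: "('a, 'm) monoid_scheme \<Rightarrow> nat" where
  "h2 G = order (homology2 G)"

lemma boundaries2_subset_cycles2:
  assumes "group G"
  shows "boundaries2 G \<subseteq> cycles2 G"
proof
  interpret group G by fact
  fix z assume "z \<in> boundaries2 G"
  then obtain c where c: "Poly_Mapping.keys c \<subseteq> carrier G \<times> carrier G \<times> carrier G"
    "z = bar_boundary3 G c"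
    by (auto simp: boundaries2_def)
  from c(1) have "bar_boundary3 G c \<in> cycles2 G"
  proof (induction c rule: frag_induction)
    case zero
    show ?case by (simp add: bar_boundary3_def bar_boundary2_def cycles2_def kernel_def)
  next
    case (one x)
    obtain g h k where x: "x = (g, h, k)" by (cases x)
    then show ?case using one
      by (auto simp: bar_boundary3_def bar_boundary2_def cycles2_def kernel_def frag_extend_add
            frag_extend_diff m_assoc
            dest!: keys_diff[THEN subsetD] Poly_Mapping.keys_add[THEN subsetD])
  next
    case (diff a b)
    then show ?case
      by (auto simp: bar_boundary3_def bar_boundary2_def cycles2_def kernel_def frag_extend_diff
            dest!: keys_diff[THEN subsetD])
  qed
  then show "z \<in> cycles2 G" by (simp add: c)
qed


section \<open>Second cohomology with trivial coefficients\<close>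

text \<open>
  Inhomogeneous cochains with values in an abelian group \<open>M\<close>, written multiplicatively,
  on which \<open>G\<close> acts trivially.
\<close>

definition cochains1 ::
    "('a, 'm) monoid_scheme \<Rightarrow> ('b, 'n) monoid_scheme \<Rightarrow> ('a \<Rightarrow> 'b) monoid" where
  "cochains1 G M = product_group (carrier G) (\<lambda>_. M)"

definition cochains2 ::
    "('a, 'm) monoid_scheme \<Rightarrow> ('b, 'n) monoid_scheme \<Rightarrow> ('a \<times> 'a \<Rightarrow> 'b) monoid" where
  "cochains2 G M = product_group (carrier G \<times> carrier G) (\<lambda>_. M)"

definition cochains3 ::
    "('a, 'm) monoid_scheme \<Rightarrow> ('b, 'n) monoid_scheme \<Rightarrow> ('a \<times> 'a \<times> 'a \<Rightarrow> 'b) monoid" where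
  "cochains3 G M = product_group (carrier G \<times> carrier G \<times> carrier G) (\<lambda>_. M)"

definition coboundary1 ::
    "('a, 'm) monoid_scheme \<Rightarrow> ('b, 'n) monoid_scheme \<Rightarrow> ('a \<Rightarrow> 'b) \<Rightarrow> ('a \<times> 'a \<Rightarrow> 'b)" where
  "coboundary1 G M f = (\<lambda>(g, h) \<in> carrier G \<times> carrier G.
     f h \<otimes>\<^bsub>M\<^esub> inv\<^bsub>M\<^esub> f (g \<otimes>\<^bsub>G\<^esub> h) \<otimes>\<^bsub>M\<^esub> f g)"

definition coboundary2 ::
    "('a, 'm) monoid_scheme \<Rightarrow> ('b, 'n) monoid_scheme \<Rightarrow> ('a \<times> 'a \<Rightarrow> 'b) \<Rightarrow>
       ('a \<times> 'a \<times> 'a \<Rightarrow> 'b)" where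
  "coboundary2 G M f = (\<lambda>(g, h, k) \<in> carrier G \<times> carrier G \<times> carrier G.
     f (h, k) \<otimes>\<^bsub>M\<^esub> inv\<^bsub>M\<^esub> f (g \<otimes>\<^bsub>G\<^esub> h, k) \<otimes>\<^bsub>M\<^esub> f (g, h \<otimes>\<^bsub>G\<^esub> k) \<otimes>\<^bsub>M\<^esub> inv\<^bsub>M\<^esub> f (g, h))"

definition cocycles2 ::
    "('a, 'm) monoid_scheme \<Rightarrow> ('b, 'n) monoid_scheme \<Rightarrow> ('a \<times> 'a \<Rightarrow> 'b) set" where
  "cocycles2 G M = kernel (cochains2 G M) (cochains3 G M) (coboundary2 G M)"

definition coboundaries2 ::
    "('a, 'm) monoid_scheme \<Rightarrow> ('b, 'n) monoid_scheme \<Rightarrow> ('a \<times> 'a \<Rightarrow> 'b) set" where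
  "coboundaries2 G M = coboundary1 G M ` carrier (cochains1 G M)"

definition cohomology2 ::
    "('a, 'm) monoid_scheme \<Rightarrow> ('b, 'n) monoid_scheme \<Rightarrow> ('a \<times> 'a \<Rightarrow> 'b) set monoid" where
  "cohomology2 G M = cochains2 G M\<lparr>carrier := cocycles2 G M\<rparr> Mod coboundaries2 G M"

lemma subgroup_coboundaries2:
  assumes "group G" "comm_group M"
  shows "subgroup (coboundaries2 G M) (cochains2 G M)"
proof -
  interpret group G by fact
  interpret M: comm_group M by fact
  have mem: "f g \<in> carrier M" if "f \<in> carrier G \<rightarrow>\<^sub>E carrier M" "g \<in> carrier G" for f g
    using that by auto
  have "group_hom (cochains1 G M) (cochains2 G M) (coboundary1 G M)"
  proof (rule group_hom.intro)
    show "group_hom_axioms (cochains1 G M) (cochains2 G M) (coboundary1 G M)"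
      by unfold_locales
        (auto simp: hom_def cochains1_def cochains2_def coboundary1_def fun_eq_iff mem
           M.inv_mult M.m_ac)
  qed (simp_all add: cochains1_def cochains2_def)
  then show ?thesis
    unfolding coboundaries2_def by (rule group_hom.img_is_subgroup)
qed

lemma coboundaries2_subset_cocycles2:
  assumes "group G" "comm_group M"
  shows "coboundaries2 G M \<subseteq> cocycles2 G M"
proof
  interpret group G by fact
  interpret M: comm_group M by fact
  fix z assume "z \<in> coboundaries2 G M"
  then obtain f where f: "\<And>g. g \<in> carrier G \<Longrightarrow> f g \<in> carrier M" "z = coboundary1 G M f"
    by (auto simp: coboundaries2_def cochains1_def)
  have M_cancel: "(a \<otimes>\<^bsub>M\<^esub> inv\<^bsub>M\<^esub> b \<otimes>\<^bsub>M\<^esub> c) \<otimes>\<^bsub>M\<^esub> inv\<^bsub>M\<^esub> (a \<otimes>\<^bsub>M\<^esub> inv\<^bsub>M\<^esub> d \<otimes>\<^bsub>M\<^esub> e) \<otimes>\<^bsub>M\<^esub>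
      (b \<otimes>\<^bsub>M\<^esub> inv\<^bsub>M\<^esub> d \<otimes>\<^bsub>M\<^esub> q) \<otimes>\<^bsub>M\<^esub> inv\<^bsub>M\<^esub> (c \<otimes>\<^bsub>M\<^esub> inv\<^bsub>M\<^esub> e \<otimes>\<^bsub>M\<^esub> q) = \<one>\<^bsub>M\<^esub>"
    if [simp]: "a \<in> carrier M" "b \<in> carrier M" "c \<in> carrier M" "d \<in> carrier M" "e \<in> carrier M"
      "q \<in> carrier M" for a b c d e q
  proof -
    have "?thesis \<longleftrightarrow> (a \<otimes>\<^bsub>M\<^esub> inv\<^bsub>M\<^esub> d \<otimes>\<^bsub>M\<^esub> c \<otimes>\<^bsub>M\<^esub> q) \<otimes>\<^bsub>M\<^esub> (b \<otimes>\<^bsub>M\<^esub> inv\<^bsub>M\<^esub> b) \<otimes>\<^bsub>M\<^esub>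
        inv\<^bsub>M\<^esub> ((a \<otimes>\<^bsub>M\<^esub> inv\<^bsub>M\<^esub> d \<otimes>\<^bsub>M\<^esub> c \<otimes>\<^bsub>M\<^esub> q) \<otimes>\<^bsub>M\<^esub> (e \<otimes>\<^bsub>M\<^esub> inv\<^bsub>M\<^esub> e)) = \<one>\<^bsub>M\<^esub>"
      by (simp add: M.inv_mult M.m_ac del: M.r_inv M.l_inv M.Units_r_inv M.Units_l_inv)
    then show ?thesis by simp
  qed
  have "coboundary2 G M z (g, h, k) = \<one>\<^bsub>M\<^esub>"
    if "g \<in> carrier G" "h \<in> carrier G" "k \<in> carrier G" for g h k
    using that f M_cancel[of "f k" "f (h \<otimes>\<^bsub>G\<^esub> k)" "f h" "f (g \<otimes>\<^bsub>G\<^esub> h \<otimes>\<^bsub>G\<^esub> k)" "f (g \<otimes>\<^bsub>G\<^esub> h)" "f g"]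
    by (simp add: coboundary1_def coboundary2_def m_assoc)
  then have "coboundary2 G M z p = \<one>\<^bsub>cochains3 G M\<^esub> p" for p
    by (cases "p \<in> carrier G \<times> carrier G \<times> carrier G")
      (auto simp: cochains3_def, simp add: coboundary2_def)
  then have "coboundary2 G M z = \<one>\<^bsub>cochains3 G M\<^esub>"
    by (rule ext)
  moreover have "z \<in> carrier (cochains2 G M)"
    using f by (auto simp: cochains2_def coboundary1_def)
  ultimately show "z \<in> cocycles2 G M"
    by (simp add: cocycles2_def kernel_def)
qed

text \<open>The restriction to a subgroup \<open>A\<close>, which sends the class of a cocycle \<open>f\<close> to the class of
  \<open>f\<close> restricted to \<open>A \<times> A\<close>.\<close>

definition restriction2 ::
    "('a, 'm) monoid_scheme \<Rightarrow> ('b, 'n) monoid_scheme \<Rightarrow> 'a set \<Rightarrow>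
       ('a \<times> 'a \<Rightarrow> 'b) set \<Rightarrow> ('a \<times> 'a \<Rightarrow> 'b) set" where
  "restriction2 G M A c = the_elem ((\<lambda>f.
     coboundaries2 (G\<lparr>carrier := A\<rparr>) M #>\<^bsub>cochains2 (G\<lparr>carrier := A\<rparr>) M\<^esub> restrict f (A \<times> A)) ` c)"

lemma restriction2_class:
  assumes "group G" "comm_group M" "subgroup A G" "f \<in> cocycles2 G M"
  shows "restriction2 G M A (coboundaries2 G M #>\<^bsub>cochains2 G M\<^esub> f) =
    coboundaries2 (G\<lparr>carrier := A\<rparr>) M #>\<^bsub>cochains2 (G\<lparr>carrier := A\<rparr>) M\<^esub> restrict f (A \<times> A)"
proof -
  interpret group G by fact
  interpret M: comm_group M by fact
  let ?H = "G\<lparr>carrier := A\<rparr>"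
  have A: "A \<subseteq> carrier G" using assms(3) by (rule subgroup.subset)
  have mult_A: "g \<otimes>\<^bsub>G\<^esub> h \<in> A" if "g \<in> A" "h \<in> A" for g h
    using assms(3) that by (rule subgroup.m_closed)
  interpret H: group "cochains2 ?H M"
    by (simp add: cochains2_def)
  have B: "subgroup (coboundaries2 ?H M) (cochains2 ?H M)"
    using subgroup.subgroup_is_group[OF assms(3,1)] assms(2) by (rule subgroup_coboundaries2)
  have f: "f \<in> carrier (cochains2 G M)"
    using assms(4) by (simp add: cocycles2_def kernel_def)
  have res_f: "restrict f (A \<times> A) \<in> carrier (cochains2 ?H M)"
    using f A by (auto simp: cochains2_def)
  have *: "coboundaries2 ?H M #>\<^bsub>cochains2 ?H M\<^esub> restrict (coboundary1 G M e \<otimes>\<^bsub>cochains2 G M\<^esub> f) (A \<times> A) =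
      coboundaries2 ?H M #>\<^bsub>cochains2 ?H M\<^esub> restrict f (A \<times> A)"
    if e: "e \<in> carrier (cochains1 G M)" for e
  proof -
    have "restrict (coboundary1 G M e \<otimes>\<^bsub>cochains2 G M\<^esub> f) (A \<times> A) =
        coboundary1 ?H M (restrict e A) \<otimes>\<^bsub>cochains2 ?H M\<^esub> restrict f (A \<times> A)"
      using A mult_A by (auto simp: cochains2_def coboundary1_def fun_eq_iff restrict_def)
    moreover have e': "coboundary1 ?H M (restrict e A) \<in> coboundaries2 ?H M"
      using e A by (auto simp: coboundaries2_def cochains1_def intro!: imageI)
    moreover note H.coset_mult_assoc[OF subgroup.subset[OF B] subgroup.mem_carrier[OF B e'] res_f]
      H.coset_join2[OF subgroup.mem_carrier[OF B e'] B e']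
    ultimately show ?thesis by simp
  qed
  have "(\<lambda>f. coboundaries2 ?H M #>\<^bsub>cochains2 ?H M\<^esub> restrict f (A \<times> A)) `
      (coboundaries2 G M #>\<^bsub>cochains2 G M\<^esub> f) =
      {coboundaries2 ?H M #>\<^bsub>cochains2 ?H M\<^esub> restrict f (A \<times> A)}"
  proof -
    have "carrier (cochains1 G M) \<noteq> {}" by (auto simp: cochains1_def PiE_eq_empty_iff)
    then show ?thesis
      by (auto simp: coboundaries2_def[of G] r_coset_def[of _ _ f] image_UN image_image *)
  qed
  then show ?thesis by (simp add: restriction2_def)
qed


section \<open>The Bogomolov multiplier\<close>

definition rat_group :: "rat monoid" where
  "rat_group = \<lparr>carrier = UNIV, mult = (+), one = 0\<rparr>"

definition rat_mod_int :: "rat set monoid" where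
  "rat_mod_int = rat_group Mod \<int>"

lemma comm_group_rat_mod_int: "comm_group rat_mod_int"
proof -
  interpret rat: comm_group rat_group
    by (rule comm_groupI) (auto simp: rat_group_def intro: exI[of _ "- _"])
  have "inv\<^bsub>rat_group\<^esub> x = - x" for x
    by (rule rat.inv_equality) (auto simp: rat_group_def)
  then have "subgroup \<int> rat_group"
    by (intro rat.subgroupI) (auto simp: rat_group_def intro: Ints_minus Ints_add)
  then show ?thesis
    unfolding rat_mod_int_def by (rule rat.abelian_FactGroup)
qed

definition abelian_subgroups :: "('a, 'm) monoid_scheme \<Rightarrow> 'a set set" where
  "abelian_subgroups G = {A. subgroup A G \<and> comm_group (G\<lparr>carrier := A\<rparr>)}"

definition bogomolov_multiplier ::
    "('a, 'm) monoid_scheme \<Rightarrow> ('a \<times> 'a \<Rightarrow> rat set) set set" where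
  "bogomolov_multiplier G =
     kernel (cohomology2 G rat_mod_int)
       (product_group (abelian_subgroups G) (\<lambda>A. cohomology2 (G\<lparr>carrier := A\<rparr>) rat_mod_int))
       (\<lambda>c. \<lambda>A\<in>abelian_subgroups G. restriction2 G rat_mod_int A c)"

definition b0 :: "('a, 'm) monoid_scheme \<Rightarrow> nat" where
  "b0 G = card (bogomolov_multiplier G)"

end

theory Submission
  imports Defs "HOL-Algebra.Multiplicative_Group"
begin

text \<open>
  The three numbers are orders of quotients of one group, the group \<open>Z\<close> of 2-cycles of the bar
  complex of \<open>G\<close>. Let \<open>B\<close> be the group of boundaries, so that \<open>h\<^sub>2(G) = |Z/B|\<close>, and write \<open>[g|h]\<close>
  for the basic 2-chains. That \<open>Z/B\<close> is finite follows from \<open>|G| Z \<subseteq> B\<close>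
  (\<open>order_times_cycle_is_boundary\<close>).

  The relations of the group \<open>C\<close> with generators \<open>y\<^sub>g\<close> say that conjugation of a generator by a word
  depends only on the image of the word in \<open>G\<close>. Hence the kernel \<open>K\<close> of \<open>C \<rightarrow> G\<close> is central. For a
  section \<open>s\<close> of \<open>C \<rightarrow> G\<close>, the linear extension of \<open>[g|h] \<mapsto> s(g) s(h) s(gh)\<^sup>-\<^sup>1\<close> is the connecting map
  of the central extension. It kills \<open>B\<close> and maps \<open>Z\<close> onto \<open>K \<inter> [C,C]\<close>
  (\<open>connecting_boundaries2\<close>, \<open>connecting_image_cycles2\<close>). So the ambiguity index is \<open>|Z/P|\<close>, where \<open>P\<close>
  is the set of cycles killed by the connecting map, and \<open>B \<subseteq> P\<close> gives the upper bound.

  As \<open>\<rat>/\<int>\<close> is divisible, a 2-cochain is a coboundary exactly if its linear extension vanishes on \<open>Z\<close>,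
  and every character of \<open>Z\<close> is the restriction of such a linear extension. The same holds for every
  subgroup of \<open>G\<close>. Therefore \<open>B\<^sub>0(G)\<close> is the group of characters of \<open>Z/M\<close>, where \<open>M\<close> is generated by
  \<open>B\<close> and the 2-cycles of the abelian subgroups of \<open>G\<close> (\<open>b0_eq_card_characters\<close>). A finite abelian
  group has as many characters as elements, and so \<open>b\<^sub>0(G) = |Z/M|\<close>.

  It remains to compare \<open>P\<close> and \<open>M\<close>. Consider the central extension \<open>E\<close> of \<open>G\<close> by all 2-chains modulo
  \<open>M\<close> that is defined by the tautological cocycle \<open>[g|h]\<close>. If \<open>g\<close> and \<open>h\<close> commute, then \<open>[h|g] - [g|h]\<close>
  is a cycle of an abelian subgroup, so elements of \<open>E\<close> over \<open>g\<close> and \<open>h\<close> commute. Lifting one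
  representative of each conjugacy class and conjugating gives a section of \<open>E \<rightarrow> G\<close> that is compatible
  with conjugation (\<open>equivariant_section\<close>), hence a homomorphism \<open>C \<rightarrow> E\<close> over \<open>G\<close>. It carries the
  connecting map of \<open>C\<close> to that of \<open>E\<close> (\<open>connecting_natural\<close>), which on \<open>Z\<close> is the projection to \<open>Z/M\<close>.
  So \<open>P \<subseteq> M\<close>, which is the lower bound. Conversely, if every nontrivial element of \<open>G\<close> is a generator,
  then \<open>y\<^sub>g\<close> and \<open>y\<^sub>h\<close> commute whenever \<open>g\<close> and \<open>h\<close> do. The values of the connecting map on the cycles
  of an abelian subgroup can then be computed in an abelian group that contains the section, where the
  factor set is a coboundary. So \<open>M \<subseteq> P\<close> and both indices agree.
\<close>

section \<open>Images, cosets and commuting elements\<close>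

text \<open>
  The inequalities between orders reduce to this: two quotients of one group are given by maps \<open>f\<close> and
  \<open>g\<close> on it, and \<open>g\<close> factors through \<open>f\<close>.
\<close>

lemma image_if_factors:
  assumes "finite (f ` Z)" "\<And>x y. x \<in> Z \<Longrightarrow> y \<in> Z \<Longrightarrow> f x = f y \<Longrightarrow> g x = g y"
  shows finite_image_if_factors: "finite (g ` Z)"
    and card_image_le_if_factors: "card (g ` Z) \<le> card (f ` Z)"
proof -
  have "g x = g (inv_into Z f (f x))" if "x \<in> Z" for x
    using assms(2)[OF that, of "inv_into Z f (f x)"] that
    by (simp add: f_inv_into_f inv_into_into)
  then have *: "g ` Z = (\<lambda>y. g (inv_into Z f y)) ` f ` Z"
    by (force simp: image_image)
  show "finite (g ` Z)"
    unfolding * using assms(1) by (rule finite_imageI)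
  show "card (g ` Z) \<le> card (f ` Z)"
    unfolding * using assms(1) by (rule card_image_le)
qed

lemma card_image_eq_if_same_fibres:
  assumes "\<And>x y. x \<in> Z \<Longrightarrow> y \<in> Z \<Longrightarrow> f x = f y \<longleftrightarrow> g x = g y"
  shows "card (f ` Z) = card (g ` Z)"
proof (rule bij_betw_same_card)
  have *: "g (inv_into Z f (f x)) = g x" if "x \<in> Z" for x
    using assms[of "inv_into Z f (f x)" x] that
    by (simp add: f_inv_into_f inv_into_into)
  then show "bij_betw (\<lambda>y. g (inv_into Z f y)) (f ` Z) (g ` Z)"
    by (auto simp: bij_betw_def inj_on_def image_image assms)
qed

lemma (in group) mult_inv_eq_one_iff:
  "x \<in> carrier G \<Longrightarrow> y \<in> carrier G \<Longrightarrow> x \<otimes> inv y = \<one> \<longleftrightarrow> x = y"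
  by (metis inv_solve_right' l_one one_closed)

lemma (in group) r_coset_eq_iff:
  assumes "subgroup H G" "x \<in> carrier G" "y \<in> carrier G"
  shows "H #> x = H #> y \<longleftrightarrow> y \<otimes> inv x \<in> H"
  using assms
  by (metis repr_independence repr_independenceD subgroup.rcos_module is_group)

lemma (in group) subgroup_commuting:
  assumes "k \<in> carrier G"
  shows "subgroup {u \<in> carrier G. k \<otimes> u = u \<otimes> k} G"
proof (rule subgroupI)
  fix u assume u: "u \<in> {u \<in> carrier G. k \<otimes> u = u \<otimes> k}"
  have "inv u \<otimes> k = inv u \<otimes> (k \<otimes> u) \<otimes> inv u"
  proof -
    have "u \<in> carrier G" using u by blast
    then show ?thesis using assms by (simp add: m_assoc)
  qed
  also have "\<dots> = inv u \<otimes> (u \<otimes> k) \<otimes> inv u"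
    using u by simp
  also have "\<dots> = k \<otimes> inv u"
  proof -
    have "u \<in> carrier G" using u by blast
    then show ?thesis using assms by (simp flip: m_assoc)
  qed
  finally have "inv u \<otimes> k = k \<otimes> inv u" .
  with u show "inv u \<in> {u \<in> carrier G. k \<otimes> u = u \<otimes> k}" by simp
next
  fix u v assume "u \<in> {u \<in> carrier G. k \<otimes> u = u \<otimes> k}" "v \<in> {u \<in> carrier G. k \<otimes> u = u \<otimes> k}"
  then show "u \<otimes> v \<in> {u \<in> carrier G. k \<otimes> u = u \<otimes> k}"
    using assms by (simp add: m_assoc) (metis m_assoc)
qed (use assms in \<open>auto intro: exI[of _ \<one>]\<close>)

text \<open>
  The generators of \<open>\<langle>g, h\<rangle>\<close> centralise each other, so they centralise \<open>\<langle>g, h\<rangle>\<close>; then every element of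
  \<open>\<langle>g, h\<rangle>\<close> centralises the generators and hence all of \<open>\<langle>g, h\<rangle>\<close>.
\<close>

lemma (in group) commuting_pair_in_abelian_subgroup:
  assumes "g \<in> carrier G" "h \<in> carrier G" "g \<otimes> h = h \<otimes> g"
  obtains A where "A \<in> abelian_subgroups G" "g \<in> A" "h \<in> A"
proof -
  let ?A = "generate G {g, h}"
  have sub: "{g, h} \<subseteq> carrier G" using assms by simp
  have A: "subgroup ?A G" using sub by (rule generate_is_subgroup)
  have A_closed: "x \<in> carrier G" if "x \<in> ?A" for x using subgroup.mem_carrier[OF A that] .
  have 1: "x \<otimes> y = y \<otimes> x" if "y \<in> {g, h}" "x \<in> ?A" for x y
  proof -
    have "?A \<subseteq> {u \<in> carrier G. y \<otimes> u = u \<otimes> y}"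
      using that(1) assms by (intro generate_subgroup_incl subgroup_commuting) auto
    with that(2) show ?thesis by force
  qed
  have "x \<otimes> y = y \<otimes> x" if "x \<in> ?A" "y \<in> ?A" for x y
  proof -
    have "?A \<subseteq> {u \<in> carrier G. x \<otimes> u = u \<otimes> x}"
      using that(1) assms A_closed 1 by (intro generate_subgroup_incl subgroup_commuting) auto
    with that(2) show ?thesis by blast
  qed
  then have "?A \<in> abelian_subgroups G"
    using A unfolding abelian_subgroups_def
    by (intro CollectI conjI group.group_comm_groupI subgroup_imp_group) simp_all
  then show thesis
    by (rule that) (auto intro: generate.incl)
qed

lemma (in group) conjugate_in_conjugacy_class:
  assumes "g \<in> conjugacy_class G x" "x \<in> carrier G" "k \<in> carrier G"
  shows "k \<otimes> g \<otimes> inv k \<in> conjugacy_class G x"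
proof -
  obtain a where a: "a \<in> carrier G" "g = a \<otimes> x \<otimes> inv a"
    using assms(1) by (auto simp: conjugacy_class_def)
  then have "k \<otimes> g \<otimes> inv k = (k \<otimes> a) \<otimes> x \<otimes> inv (k \<otimes> a)"
    using assms by (simp add: inv_mult_group m_assoc)
  with a(1) assms(3) show ?thesis
    unfolding conjugacy_class_def by blast
qed

text \<open>
  Two conjugates of \<open>r\<close> agree exactly if the conjugating elements differ by an element that commutes
  with \<open>r\<close>.
\<close>

lemma (in group) conj_eq_iff_commute:
  assumes "r \<in> carrier G" "h \<in> carrier G" "k \<in> carrier G"
  shows "inv h \<otimes> r \<otimes> h = inv k \<otimes> r \<otimes> k \<longleftrightarrow> r \<otimes> (k \<otimes> inv h) = (k \<otimes> inv h) \<otimes> r"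
proof -
  have "inv h \<otimes> r \<otimes> h = inv k \<otimes> r \<otimes> k \<longleftrightarrow> k \<otimes> (inv h \<otimes> r \<otimes> h) \<otimes> inv h = k \<otimes> (inv k \<otimes> r \<otimes> k) \<otimes> inv h"
    using assms by simp
  also have "k \<otimes> (inv h \<otimes> r \<otimes> h) \<otimes> inv h = (k \<otimes> inv h) \<otimes> r"
    using assms by (simp add: m_assoc)
  also have "k \<otimes> (inv k \<otimes> r \<otimes> k) \<otimes> inv h = r \<otimes> (k \<otimes> inv h)"
    using assms by (simp flip: m_assoc)
  finally show ?thesis by auto
qed

lemma (in comm_group) comm_group_subgroup:
  assumes "subgroup H G"
  shows "comm_group (G\<lparr>carrier := H\<rparr>)"
  using subgroup.mem_carrier[OF assms]
  by (intro group.group_comm_groupI subgroup_imp_group assms) (auto simp: m_comm)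

section \<open>Extending homomorphisms of abelian groups\<close>

definition adjoin :: "('a, 'm) monoid_scheme \<Rightarrow> 'a set \<Rightarrow> 'a \<Rightarrow> 'a set" where
  "adjoin A H a = {h \<otimes>\<^bsub>A\<^esub> a [^]\<^bsub>A\<^esub> (k::int) | h k. h \<in> H}"

locale adjoin_element = comm_group A for A :: "('a, 'm) monoid_scheme" (structure) +
  fixes H a
  assumes subgroup: "subgroup H A" and a: "a \<in> carrier A"
begin

lemma subgroup_mem [simp]: "h \<in> H \<Longrightarrow> h \<in> carrier A"
  using subgroup by (rule subgroup.mem_carrier)

lemma adjoinI: "h \<in> H \<Longrightarrow> h \<otimes> a [^] (k::int) \<in> adjoin A H a"
  by (auto simp: adjoin_def)

lemma adjoinE:
  assumes "x \<in> adjoin A H a"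
  obtains h k where "h \<in> H" "x = h \<otimes> a [^] (k::int)"
  using assms by (auto simp: adjoin_def)

lemma mult_adjoin:
  assumes "h \<in> H" "h' \<in> H"
  shows "(h \<otimes> a [^] (k::int)) \<otimes> (h' \<otimes> a [^] (l::int)) = (h \<otimes> h') \<otimes> a [^] (k + l)"
  using assms a by (simp add: int_pow_mult m_ac)

lemma subgroup_adjoin: "subgroup (adjoin A H a) A"
proof (rule subgroupI)
  show "adjoin A H a \<subseteq> carrier A"
    using a by (auto simp: adjoin_def)
  show "adjoin A H a \<noteq> {}"
    using adjoinI subgroup.one_closed[OF subgroup] by blast
next
  fix x assume "x \<in> adjoin A H a"
  then obtain h k where h: "h \<in> H" "x = h \<otimes> a [^] (k::int)"
    by (rule adjoinE)
  then have "inv x = inv h \<otimes> a [^] (- k)"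
    using a by (simp add: inv_mult int_pow_neg)
  then show "inv x \<in> adjoin A H a"
    using h adjoinI subgroup.m_inv_closed[OF subgroup] by simp
next
  fix x y assume "x \<in> adjoin A H a" "y \<in> adjoin A H a"
  then show "x \<otimes> y \<in> adjoin A H a"
    using adjoinI subgroup.m_closed[OF subgroup] by (metis adjoinE mult_adjoin)
qed

lemma subset_adjoin: "H \<subseteq> adjoin A H a"
proof
  fix h assume "h \<in> H"
  then show "h \<in> adjoin A H a"
    using adjoinI[of h 0] by simp
qed

lemma a_in_adjoin: "a \<in> adjoin A H a"
  using adjoinI[OF subgroup.one_closed[OF subgroup], of 1] a by simp

lemma adjoin_eq_generate: "adjoin A H a = generate A (insert a H)"
proof
  have "h \<otimes> a [^] (k::int) \<in> generate A (insert a H)" if "h \<in> H" for h k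
  proof -
    have sg: "subgroup (generate A (insert a H)) A"
      using a by (intro generate_is_subgroup) auto
    have "a [^] k \<in> generate A (insert a H)"
      by (rule subgroup_int_pow_closed[OF sg]) (auto intro: generate.incl)
    then show ?thesis
      using that by (auto intro: generate.eng generate.incl)
  qed
  then show "adjoin A H a \<subseteq> generate A (insert a H)"
    by (auto simp: adjoin_def)
  show "generate A (insert a H) \<subseteq> adjoin A H a"
    using subset_adjoin a_in_adjoin by (intro generate_subgroup_incl subgroup_adjoin) auto
qed

text \<open>
  A homomorphism on \<open>H\<close> extends to \<open>\<langle>H, a\<rangle>\<close> with value \<open>c\<close> at \<open>a\<close> as soon as the two prescriptions agree
  on the powers of \<open>a\<close> that lie in \<open>H\<close>, because \<open>h a\<^sup>k = h' a\<^sup>l\<close> makes \<open>a\<^sup>l\<^sup>-\<^sup>k\<close> such a power.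
\<close>

lemma hom_adjoin:
  assumes "comm_group C" "\<chi> \<in> hom (A\<lparr>carrier := H\<rparr>) C" "c \<in> carrier C"
    and compat: "\<And>k::int. a [^] k \<in> H \<Longrightarrow> \<chi> (a [^] k) = c [^]\<^bsub>C\<^esub> k"
  obtains \<psi> where "\<psi> \<in> hom (A\<lparr>carrier := adjoin A H a\<rparr>) C" "\<And>h. h \<in> H \<Longrightarrow> \<psi> h = \<chi> h" "\<psi> a = c"
proof -
  interpret C: comm_group C by fact
  have \<chi>_mult: "\<chi> (x \<otimes> y) = \<chi> x \<otimes>\<^bsub>C\<^esub> \<chi> y" and \<chi>_closed: "\<chi> x \<in> carrier C"
    if "x \<in> H" "y \<in> H" for x y
    using assms(2) that by (auto simp: hom_def)
  have H1: "\<one> \<in> H" and Hm: "\<And>x y. x \<in> H \<Longrightarrow> y \<in> H \<Longrightarrow> x \<otimes> y \<in> H"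
    and Hi: "\<And>x. x \<in> H \<Longrightarrow> inv x \<in> H"
    using subgroup by (auto simp: subgroup.one_closed subgroup.m_closed subgroup.m_inv_closed)
  have well: "\<chi> h \<otimes>\<^bsub>C\<^esub> c [^]\<^bsub>C\<^esub> k = \<chi> h' \<otimes>\<^bsub>C\<^esub> c [^]\<^bsub>C\<^esub> k'"
    if "h \<in> H" "h' \<in> H" and eq: "h \<otimes> a [^] k = h' \<otimes> a [^] k'" for h h' and k k' :: int
  proof -
    have "inv h' \<otimes> h = inv h' \<otimes> (h \<otimes> a [^] k) \<otimes> inv (a [^] k)"
      using that(1,2) a by (simp add: m_assoc)
    also have "\<dots> = inv h' \<otimes> (h' \<otimes> a [^] k') \<otimes> inv (a [^] k)"
      by (simp add: eq)
    also have "\<dots> = a [^] (k' - k)"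
      using that(1,2) a by (simp add: int_pow_diff flip: m_assoc)
    finally have *: "inv h' \<otimes> h = a [^] (k' - k)" .
    moreover have "inv h' \<otimes> h \<in> H"
      using that Hm Hi by simp
    ultimately have "\<chi> (inv h' \<otimes> h) = c [^]\<^bsub>C\<^esub> (k' - k)"
      using compat by simp
    moreover have "\<chi> h = \<chi> h' \<otimes>\<^bsub>C\<^esub> \<chi> (inv h' \<otimes> h)"
      using that Hm Hi by (simp flip: \<chi>_mult m_assoc)
    ultimately show ?thesis
      using that \<chi>_closed assms(3) by (simp add: C.int_pow_diff C.m_assoc)
  qed
  \<comment> \<open>A choice of the decomposition \<open>x = h a\<^sup>k\<close>; by \<open>well\<close> it does not affect the value of \<open>\<psi>\<close>.\<close>
  define p where "p x = (SOME p. fst p \<in> H \<and> x = fst p \<otimes> a [^] (snd p :: int))" for x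
  define \<psi> where "\<psi> x = \<chi> (fst (p x)) \<otimes>\<^bsub>C\<^esub> c [^]\<^bsub>C\<^esub> snd (p x)" for x
  have \<psi>: "\<psi> (h \<otimes> a [^] k) = \<chi> h \<otimes>\<^bsub>C\<^esub> c [^]\<^bsub>C\<^esub> k" if "h \<in> H" for h and k :: int
  proof -
    have "\<exists>p. fst p \<in> H \<and> h \<otimes> a [^] k = fst p \<otimes> a [^] (snd p :: int)"
      using that by (intro exI[of _ "(h, k)"]) simp
    then have "fst (p (h \<otimes> a [^] k)) \<in> H \<and> h \<otimes> a [^] k = fst (p (h \<otimes> a [^] k)) \<otimes> a [^] snd (p (h \<otimes> a [^] k))"
      unfolding p_def by (rule someI_ex)
    then show ?thesis
      unfolding \<psi>_def using well[of "fst (p (h \<otimes> a [^] k))" h] that by simp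
  qed
  show thesis
  proof
    show "\<psi> \<in> hom (A\<lparr>carrier := adjoin A H a\<rparr>) C"
    proof (rule homI)
      fix x y assume "x \<in> carrier (A\<lparr>carrier := adjoin A H a\<rparr>)" "y \<in> carrier (A\<lparr>carrier := adjoin A H a\<rparr>)"
      then obtain h k h' k' where *: "h \<in> H" "x = h \<otimes> a [^] (k::int)" "h' \<in> H" "y = h' \<otimes> a [^] (k'::int)"
        by (auto elim!: adjoinE)
      then show "\<psi> (x \<otimes>\<^bsub>A\<lparr>carrier := adjoin A H a\<rparr>\<^esub> y) = \<psi> x \<otimes>\<^bsub>C\<^esub> \<psi> y"
        using assms(3) by (simp add: mult_adjoin \<psi> Hm \<chi>_mult \<chi>_closed C.int_pow_mult C.m_ac)
    qed (use assms(3) in \<open>auto elim!: adjoinE simp: \<psi> \<chi>_closed\<close>)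
    show "\<psi> h = \<chi> h" if "h \<in> H" for h
      using \<psi>[OF that, of 0] that \<chi>_closed by simp
    have "\<chi> \<one> = \<one>\<^bsub>C\<^esub>"
      using compat[of 0] H1 by simp
    then show "\<psi> a = c"
      using \<psi>[OF H1, of 1] a assms(3) by simp
  qed
qed

lemma least_power_in_subgroup:
  assumes "(k::int) \<noteq> 0" "a [^] k \<in> H"
  obtains m :: nat where "m > 0" "a [^] m \<in> H" "\<And>j. 0 < j \<Longrightarrow> j < m \<Longrightarrow> a [^] j \<notin> H"
proof -
  let ?P = "\<lambda>m::nat. m > 0 \<and> a [^] m \<in> H"
  have "a [^] \<bar>k\<bar> \<in> H"
    using assms a subgroup.m_inv_closed[OF subgroup assms(2)]
    by (cases "k \<ge> 0") (auto simp: int_pow_neg)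
  then have "?P (nat \<bar>k\<bar>)"
    using assms(1) int_pow_int[of A a "nat \<bar>k\<bar>"] by simp
  then have "?P (LEAST m. ?P m)"
    by (rule LeastI)
  moreover have "\<not> ?P j" if "j < (LEAST m. ?P m)" for j
    using that by (rule not_less_Least)
  ultimately show thesis
    using that by blast
qed

text \<open>
  The exponents \<open>k\<close> with \<open>a\<^sup>k \<in> H\<close> are the multiples of the least positive one \<open>m\<close>, so agreement needs
  to be checked for \<open>a\<^sup>m\<close> only.
\<close>

lemma hom_on_powers_if_root:
  fixes m :: nat
  assumes "comm_group C" "\<chi> \<in> hom (A\<lparr>carrier := H\<rparr>) C" "c \<in> carrier C"
    and m: "m > 0" "a [^] m \<in> H" "\<And>j. 0 < j \<Longrightarrow> j < m \<Longrightarrow> a [^] j \<notin> H"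
    and root: "c [^]\<^bsub>C\<^esub> m = \<chi> (a [^] m)"
    and k: "a [^] (k::int) \<in> H"
  shows "\<chi> (a [^] k) = c [^]\<^bsub>C\<^esub> k"
proof -
  interpret C: comm_group C by fact
  interpret \<chi>: group_hom "A\<lparr>carrier := H\<rparr>" C \<chi>
    using assms(2) subgroup by (simp add: group_hom_def group_hom_axioms_def subgroup_imp_group C.is_group)
  define q r where "q = k div int m" "r = nat (k mod int m)"
  have k_eq: "k = int m * q + int r"
    using m(1) by (simp add: q_r_def)
  have r: "r < m"
    using m(1) by (simp add: q_r_def nat_less_iff)
  have mq: "(a [^] m) [^] q \<in> H"
    using m(2) subgroup by (intro subgroup_int_pow_closed)
  have a_k: "a [^] k = (a [^] m) [^] q \<otimes> a [^] r"
    using a by (simp add: k_eq int_pow_mult int_pow_int flip: int_pow_pow[of a "int m" q])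
  then have "a [^] r = inv ((a [^] m) [^] q) \<otimes> a [^] k"
    using a by (simp flip: m_assoc)
  then have "a [^] r \<in> H"
    using k mq subgroup by (simp add: subgroup.m_closed subgroup.m_inv_closed)
  with r m(3)[of r] have "r = 0" by auto
  with a_k a have "a [^] k = (a [^] m) [^] q" by simp
  also have "\<chi> \<dots> = \<chi> (a [^] m) [^]\<^bsub>C\<^esub> q"
    using \<chi>.hom_int_pow[of "a [^] m" q] m(2) subgroup
    by (simp add: int_pow_consistent[OF subgroup, symmetric])
  also have "\<dots> = c [^]\<^bsub>C\<^esub> k"
    using assms(3) C.int_pow_pow[of c "int m" q]
    by (simp add: root[symmetric] k_eq \<open>r = 0\<close> int_pow_int)
  finally show ?thesis .
qed

end

definition divisible :: "('a, 'm) monoid_scheme \<Rightarrow> bool" where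
  "divisible C \<longleftrightarrow> (\<forall>y\<in>carrier C. \<forall>m>0. \<exists>x\<in>carrier C. x [^]\<^bsub>C\<^esub> (m::nat) = y)"

text \<open>
  Divisible groups are injective for finitely generated extensions: one generator \<open>a\<close> is adjoined at a
  time, and divisibility supplies an \<open>m\<close>-th root of the prescribed value at the least power \<open>a\<^sup>m\<close> in the
  subgroup. If no nontrivial power of \<open>a\<close> lies in the subgroup, any value will do.
\<close>

lemma (in comm_group) hom_extend_divisible:
  assumes C: "comm_group C" "divisible C" and H: "subgroup H G" and \<chi>: "\<chi> \<in> hom (G\<lparr>carrier := H\<rparr>) C"
    and T: "finite T" "T \<subseteq> carrier G"
  obtains \<psi> where "\<psi> \<in> hom (G\<lparr>carrier := generate G (H \<union> T)\<rparr>) C" "\<And>h. h \<in> H \<Longrightarrow> \<psi> h = \<chi> h"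
proof -
  interpret C: comm_group C by fact
  have "\<exists>\<psi>. \<psi> \<in> hom (G\<lparr>carrier := generate G (H \<union> T)\<rparr>) C \<and> (\<forall>h\<in>H. \<psi> h = \<chi> h)"
    using T
  proof (induction T rule: finite_induct)
    case empty
    have "generate G H = H"
      using H by (intro generateI[symmetric]) auto
    with \<chi> show ?case by auto
  next
    case (insert a T)
    let ?K = "generate G (H \<union> T)"
    from insert obtain \<psi> where \<psi>: "\<psi> \<in> hom (G\<lparr>carrier := ?K\<rparr>) C" "\<And>h. h \<in> H \<Longrightarrow> \<psi> h = \<chi> h"
      by auto
    have sub: "H \<union> T \<subseteq> carrier G"
      using insert.prems subgroup.subset[OF H] by auto
    interpret adjoin_element G ?K a
      using insert.prems generate_is_subgroup[OF sub]
      by (simp add: adjoin_element_def adjoin_element_axioms_def comm_group_axioms)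
    have "\<exists>c\<in>carrier C. \<forall>k::int. a [^] k \<in> ?K \<longrightarrow> \<psi> (a [^] k) = c [^]\<^bsub>C\<^esub> k"
    proof (cases "\<exists>k::int. k \<noteq> 0 \<and> a [^] k \<in> ?K")
      case True
      then obtain m :: nat where m: "m > 0" "a [^] m \<in> ?K" "\<And>j. 0 < j \<Longrightarrow> j < m \<Longrightarrow> a [^] j \<notin> ?K"
        using least_power_in_subgroup by metis
      moreover have "\<psi> (a [^] m) \<in> carrier C"
        using \<psi>(1) m(2) by (auto simp: hom_def)
      ultimately obtain c where c: "c \<in> carrier C" "c [^]\<^bsub>C\<^esub> m = \<psi> (a [^] m)"
        using C(2) unfolding divisible_def by blast
      then show ?thesis
        using hom_on_powers_if_root[OF C(1) \<psi>(1) c(1) m c(2)] by blast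
    next
      case False
      have "\<psi> \<one> = \<one>\<^bsub>C\<^esub>"
        using group_hom.hom_one[of "G\<lparr>carrier := ?K\<rparr>" C \<psi>] \<psi>(1) subgroup
        by (simp add: group_hom_def group_hom_axioms_def subgroup_imp_group C.is_group)
      with False show ?thesis
        by (intro bexI[of _ "\<one>\<^bsub>C\<^esub>"]) (metis int_pow_0 C.one_closed)+
    qed
    then obtain c where "c \<in> carrier C" "\<And>k::int. a [^] k \<in> ?K \<Longrightarrow> \<psi> (a [^] k) = c [^]\<^bsub>C\<^esub> k"
      by blast
    from hom_adjoin[OF C(1) \<psi>(1) this] obtain \<psi>' where
      \<psi>': "\<psi>' \<in> hom (G\<lparr>carrier := adjoin G ?K a\<rparr>) C" "\<And>h. h \<in> ?K \<Longrightarrow> \<psi>' h = \<psi> h"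
      by metis
    have "generate G (H \<union> insert a T) \<subseteq> adjoin G ?K a"
      using subset_adjoin a_in_adjoin generate.incl[of _ "H \<union> T" G]
      by (intro generate_subgroup_incl subgroup_adjoin) auto
    then have "\<psi>' \<in> hom (G\<lparr>carrier := generate G (H \<union> insert a T)\<rparr>) C"
      using \<psi>'(1) by (auto simp: hom_def)
    moreover have "\<psi>' h = \<chi> h" if "h \<in> H" for h
      using that \<psi>' \<psi> by (simp add: generate.incl)
    ultimately show ?case by blast
  qed
  with that show thesis by blast
qed

section \<open>Characters of finite abelian groups\<close>

definition rat_class :: "rat \<Rightarrow> rat set" where
  "rat_class r = \<int> #>\<^bsub>rat_group\<^esub> r"

lemma comm_group_rat_group: "comm_group rat_group"
  by (rule comm_groupI) (auto simp: rat_group_def intro: exI[of _ "- _"])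

lemma subgroup_Ints_rat_group: "subgroup \<int> rat_group"
proof -
  interpret rat: comm_group rat_group by (rule comm_group_rat_group)
  have "inv\<^bsub>rat_group\<^esub> x = - x" for x
    by (rule rat.inv_equality) (auto simp: rat_group_def)
  then show ?thesis
    by (intro rat.subgroupI) (auto simp: rat_group_def intro: Ints_minus Ints_add)
qed

interpretation rat_mod_int: comm_group rat_mod_int
  by (rule comm_group_rat_mod_int)

lemma carrier_rat_mod_int: "carrier rat_mod_int = range rat_class"
  by (auto simp: rat_mod_int_def carrier_FactGroup rat_class_def rat_group_def)

lemma rat_class_eq_iff: "rat_class r = rat_class s \<longleftrightarrow> r - s \<in> \<int>"
proof
  have rat_class: "rat_class r = {z + r | z. z \<in> \<int>}" for r
    by (auto simp: rat_class_def r_coset_def rat_group_def)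
  assume "rat_class r = rat_class s"
  then have "r \<in> {z + s | z. z \<in> \<int>}"
    using rat_class[of r] rat_class[of s] by force
  then show "r - s \<in> \<int>" by auto
next
  have rat_class: "rat_class r = {z + r | z. z \<in> \<int>}" for r
    by (auto simp: rat_class_def r_coset_def rat_group_def)
  have sub: "rat_class r \<subseteq> rat_class s" if "r - s \<in> \<int>" for r s
  proof
    fix x assume "x \<in> rat_class r"
    then obtain z where z: "z \<in> \<int>" "x = z + r" by (auto simp: rat_class)
    then have "x = (z + (r - s)) + s" "z + (r - s) \<in> \<int>"
      using that by (auto intro: Ints_add)
    then show "x \<in> rat_class s" unfolding rat_class by blast
  qed
  assume "r - s \<in> \<int>"
  moreover from Ints_minus[OF this] have "s - r \<in> \<int>" by simp
  ultimately show "rat_class r = rat_class s"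
    using sub by blast
qed

lemma rat_class_nat_pow: "rat_class r [^]\<^bsub>rat_mod_int\<^esub> (n::nat) = rat_class (of_nat n * r)"
proof -
  interpret rat: comm_group rat_group by (rule comm_group_rat_group)
  interpret normal \<int> rat_group
    using subgroup_Ints_rat_group by (rule rat.normal_iff_subgroup[THEN iffD2])
  have "r [^]\<^bsub>rat_group\<^esub> n = of_nat n * r"
    by (induction n) (auto simp: rat_group_def algebra_simps)
  then show ?thesis
    using FactGroup_pow[of r n] by (simp add: rat_class_def rat_mod_int_def) (simp add: rat_group_def)
qed

text \<open>
  The exact number of roots is what makes a finite abelian group have as many characters as elements.
  The \<open>m\<close>-th roots of the class of \<open>r\<close> are the classes of \<open>(r + i)/m\<close> for \<open>0 \<le> i < m\<close>.
\<close>

lemma rat_mod_int_roots: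
  assumes "y \<in> carrier rat_mod_int" "m > 0"
  shows "card {x \<in> carrier rat_mod_int. x [^]\<^bsub>rat_mod_int\<^esub> (m::nat) = y} = m"
proof -
  obtain r where r: "y = rat_class r"
    using assms(1) by (auto simp: carrier_rat_mod_int)
  let ?x = "\<lambda>i::nat. rat_class ((r + of_nat i) / of_nat m)"
  have "{x \<in> carrier rat_mod_int. x [^]\<^bsub>rat_mod_int\<^esub> m = y} = ?x ` {..<m}" (is "?L = ?R")
  proof
    show "?R \<subseteq> ?L"
    proof -
      have "rat_class (r + of_nat i) = rat_class r" for i
        by (simp add: rat_class_eq_iff)
      then show ?thesis
        using assms(2) by (auto simp: carrier_rat_mod_int rat_class_nat_pow r)
    qed
    show "?L \<subseteq> ?R"
    proof
      fix x assume "x \<in> ?L"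
      then obtain s where s: "x = rat_class s" "rat_class (of_nat m * s) = rat_class r"
        by (auto simp: carrier_rat_mod_int rat_class_nat_pow r)
      then have "of_nat m * s - r \<in> \<int>"
        by (simp add: rat_class_eq_iff)
      then obtain k where k: "of_nat m * s - r = of_int k" by (auto elim: Ints_cases)
      let ?i = "nat (k mod int m)"
      have "of_int k = (of_nat m * of_int (k div int m) + of_nat ?i :: rat)"
      proof -
        have "k = int m * (k div int m) + int ?i"
          using assms(2) by simp
        then have "of_int k = (of_int (int m * (k div int m) + int ?i) :: rat)"
          by (rule arg_cong)
        then show ?thesis
          by (simp only: of_int_add of_int_mult of_int_of_nat_eq)
      qed
      with k have "s - (r + of_nat ?i) / of_nat m = of_int (k div int m)"
        using assms(2) by (simp add: field_simps)
      then have "x = ?x ?i"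
        by (simp add: s rat_class_eq_iff)
      moreover have "?i < m"
        using assms(2) by (simp add: nat_less_iff)
      ultimately show "x \<in> ?R" by blast
    qed
  qed
  moreover have "inj_on ?x {..<m}"
  proof (rule inj_onI)
    fix i j assume ij: "i \<in> {..<m}" "j \<in> {..<m}" "?x i = ?x j"
    then have "(r + of_nat i) / of_nat m - (r + of_nat j) / of_nat m \<in> \<int>"
      by (simp add: rat_class_eq_iff)
    then obtain k where "(r + of_nat i) / of_nat m - (r + of_nat j) / of_nat m = (of_int k :: rat)"
      by (auto elim: Ints_cases)
    then have "(of_nat i - of_nat j) / of_nat m = (of_int k :: rat)"
      by (simp add: diff_divide_distrib add_divide_distrib)
    then have "(of_int (int i - int j) :: rat) = of_int (k * int m)"
      using assms(2) by (simp add: divide_eq_eq)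
    then have *: "int i - int j = k * int m"
      by (simp only: of_int_eq_iff)
    have "\<bar>k * int m\<bar> < int m"
      using ij unfolding *[symmetric] by auto
    then have "\<bar>k\<bar> * int m < 1 * int m"
      by (simp add: abs_mult)
    then have "k = 0"
      by (simp only: mult_less_cancel_right) auto
    with * show "i = j" by simp
  qed
  ultimately show ?thesis
    by (simp add: card_image)
qed

lemma divisible_rat_mod_int: "divisible rat_mod_int"
  unfolding divisible_def
proof (intro ballI allI impI)
  fix y and m :: nat assume "y \<in> carrier rat_mod_int" "m > 0"
  from rat_mod_int_roots[OF this] \<open>m > 0\<close>
  have "{x \<in> carrier rat_mod_int. x [^]\<^bsub>rat_mod_int\<^esub> m = y} \<noteq> {}"
    by (metis card.empty less_irrefl)
  then show "\<exists>x\<in>carrier rat_mod_int. x [^]\<^bsub>rat_mod_int\<^esub> m = y" by blast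
qed

text \<open>
  Characters are taken extensional, so that they are determined by their values on the group and can
  be counted.
\<close>

definition characters :: "('a, 'm) monoid_scheme \<Rightarrow> ('a \<Rightarrow> rat set) set" where
  "characters A = hom A rat_mod_int \<inter> extensional (carrier A)"

lemma characters_mult: "\<chi> \<in> characters A \<Longrightarrow> x \<in> carrier A \<Longrightarrow> y \<in> carrier A \<Longrightarrow>
    \<chi> (x \<otimes>\<^bsub>A\<^esub> y) = \<chi> x \<otimes>\<^bsub>rat_mod_int\<^esub> \<chi> y"
  by (auto simp: characters_def hom_def)

lemma characters_closed: "\<chi> \<in> characters A \<Longrightarrow> x \<in> carrier A \<Longrightarrow> \<chi> x \<in> carrier rat_mod_int"
  by (auto simp: characters_def hom_def)

lemma characters_eqI:
  "\<chi> \<in> characters A \<Longrightarrow> \<psi> \<in> characters A \<Longrightarrow> (\<And>x. x \<in> carrier A \<Longrightarrow> \<chi> x = \<psi> x) \<Longrightarrow> \<chi> = \<psi>"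
  by (auto simp: characters_def intro: extensionalityI)

lemma restrict_in_characters:
  "\<chi> \<in> hom A rat_mod_int \<Longrightarrow> group A \<Longrightarrow> restrict \<chi> (carrier A) \<in> characters A"
  by (auto simp: characters_def hom_def group.is_monoid monoid.m_closed)

context adjoin_element
begin

lemma character_adjoin:
  assumes "\<psi> \<in> characters (A\<lparr>carrier := adjoin A H a\<rparr>)" "h \<in> H"
  shows "\<psi> (h \<otimes> a [^] (k::int)) = \<psi> h \<otimes>\<^bsub>rat_mod_int\<^esub> \<psi> a [^]\<^bsub>rat_mod_int\<^esub> k"
proof -
  interpret \<psi>: group_hom "A\<lparr>carrier := adjoin A H a\<rparr>" rat_mod_int \<psi>
    using assms(1) subgroup_adjoin
    by (simp add: characters_def group_hom_def group_hom_axioms_def subgroup_imp_group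
        rat_mod_int.is_group)
  have "a [^] k \<in> adjoin A H a"
    using subgroup_int_pow_closed[OF subgroup_adjoin a_in_adjoin] .
  then have "\<psi> (h \<otimes> a [^] k) = \<psi> h \<otimes>\<^bsub>rat_mod_int\<^esub> \<psi> (a [^] k)"
    using \<psi>.hom_mult[of h "a [^] k"] assms(2) subset_adjoin by auto
  also have "\<psi> (a [^] k) = \<psi> a [^]\<^bsub>rat_mod_int\<^esub> k"
    using \<psi>.hom_int_pow[of a k] a_in_adjoin
    by (simp add: int_pow_consistent[OF subgroup_adjoin, symmetric])
  finally show ?thesis .
qed

text \<open>
  The elements \<open>a\<^sup>i\<close> with \<open>0 \<le> i < m\<close> represent the cosets of \<open>H\<close> in \<open>\<langle>H, a\<rangle>\<close>.
\<close>

lemma card_adjoin: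
  fixes m :: nat
  assumes m: "m > 0" "a [^] m \<in> H" "\<And>j. 0 < j \<Longrightarrow> j < m \<Longrightarrow> a [^] j \<notin> H"
  shows "card (adjoin A H a) = m * card H"
proof -
  have H: "x \<otimes> y \<in> H" "inv x \<in> H" if "x \<in> H" "y \<in> H" for x y
    using that subgroup by (auto simp: subgroup.m_closed subgroup.m_inv_closed)
  have "bij_betw (\<lambda>(h, i). h \<otimes> a [^] i) (H \<times> {..<m}) (adjoin A H a)"
    unfolding bij_betw_def
  proof
    show "inj_on (\<lambda>(h, i). h \<otimes> a [^] i) (H \<times> {..<m})"
    proof -
      have key: "i = j" if hh: "h \<in> H" "h' \<in> H" and "i \<le> j" "j < m" and eq: "h \<otimes> a [^] i = h' \<otimes> a [^] j"
        for h h' and i j :: nat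
      proof -
        have "a [^] j = a [^] (j - i) \<otimes> a [^] i"
          using a \<open>i \<le> j\<close> by (simp add: nat_pow_mult)
        with eq have "h \<otimes> a [^] i = (h' \<otimes> a [^] (j - i)) \<otimes> a [^] i"
          using hh a by (simp add: m_assoc)
        then have "h = h' \<otimes> a [^] (j - i)"
          using hh a by simp
        then have "a [^] (j - i) = inv h' \<otimes> h"
          using hh a by (simp flip: m_assoc)
        then have "a [^] (j - i) \<in> H"
          using H hh by simp
        then show "i = j"
          using m(3)[of "j - i"] that by fastforce
      qed
      show ?thesis
      proof (rule inj_onI, clarsimp)
        fix h h' i j assume *: "h \<in> H" "h' \<in> H" "i < m" "j < m" "h \<otimes> a [^] i = h' \<otimes> a [^] j"
        then have "i = j"
          using key[of h h' i j] key[of h' h j i] by (cases "i \<le> j") auto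
        with * a show "h = h' \<and> i = j" by simp
      qed
    qed
    show "(\<lambda>(h, i). h \<otimes> a [^] i) ` (H \<times> {..<m}) = adjoin A H a" (is "?L = _")
    proof
      show "?L \<subseteq> adjoin A H a"
        by (auto simp: int_pow_int[symmetric] intro: adjoinI)
      show "adjoin A H a \<subseteq> ?L"
      proof
        fix x assume "x \<in> adjoin A H a"
        then obtain h k where h: "h \<in> H" "x = h \<otimes> a [^] (k::int)"
          by (rule adjoinE)
        define q r where "q = k div int m" "r = nat (k mod int m)"
        have "k = int m * q + int r" and r: "r < m"
          using m(1) by (auto simp: q_r_def nat_less_iff)
        then have "a [^] k = (a [^] m) [^] q \<otimes> a [^] r"
          using a by (simp add: int_pow_mult int_pow_int flip: int_pow_pow[of a "int m" q])
        then have "x = (h \<otimes> (a [^] m) [^] q) \<otimes> a [^] r"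
          using h a by (simp add: m_assoc)
        moreover have "h \<otimes> (a [^] m) [^] q \<in> H"
          using h(1) m(2) subgroup_int_pow_closed[OF subgroup] by (simp add: H)
        ultimately show "x \<in> ?L"
          using r by force
      qed
    qed
  qed
  then show ?thesis
    by (simp add: card_cartesian_product flip: bij_betw_same_card)
qed

text \<open>
  A character of \<open>\<langle>H, a\<rangle>\<close> amounts to a character \<open>\<chi>\<close> of \<open>H\<close> and an \<open>m\<close>-th root of \<open>\<chi>(a\<^sup>m)\<close>, and there
  are \<open>m\<close> such roots in \<open>\<rat>/\<int>\<close>.
\<close>

lemma card_characters_adjoin:
  fixes m :: nat
  assumes m: "m > 0" "a [^] m \<in> H" "\<And>j. 0 < j \<Longrightarrow> j < m \<Longrightarrow> a [^] j \<notin> H"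
    and fin: "finite (characters (A\<lparr>carrier := H\<rparr>))"
  shows "card (characters (A\<lparr>carrier := adjoin A H a\<rparr>)) = m * card (characters (A\<lparr>carrier := H\<rparr>))"
    and "finite (characters (A\<lparr>carrier := adjoin A H a\<rparr>))"
proof -
  let ?Q = rat_mod_int and ?X = "characters (A\<lparr>carrier := H\<rparr>)"
    and ?Y = "characters (A\<lparr>carrier := adjoin A H a\<rparr>)"
  let ?roots = "\<lambda>\<chi>. {c \<in> carrier ?Q. c [^]\<^bsub>?Q\<^esub> m = \<chi> (a [^] m)}"
  have card_roots: "card (?roots \<chi>) = m" if "\<chi> \<in> ?X" for \<chi>
    using characters_closed[OF that, of "a [^] m"] m by (intro rat_mod_int_roots) auto
  have bij: "bij_betw (\<lambda>\<psi>. (restrict \<psi> H, \<psi> a)) ?Y (Sigma ?X ?roots)"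
    unfolding bij_betw_def
  proof
    show "inj_on (\<lambda>\<psi>. (restrict \<psi> H, \<psi> a)) ?Y"
    proof (rule inj_onI)
      fix \<psi> \<psi>' assume *: "\<psi> \<in> ?Y" "\<psi>' \<in> ?Y" "(restrict \<psi> H, \<psi> a) = (restrict \<psi>' H, \<psi>' a)"
      then have "\<psi> h = \<psi>' h" if "h \<in> H" for h
        using that by (metis Pair_inject restrict_apply')
      with * show "\<psi> = \<psi>'"
        by (intro characters_eqI[of _ "A\<lparr>carrier := adjoin A H a\<rparr>"])
          (auto elim!: adjoinE simp: character_adjoin)
    qed
    show "(\<lambda>\<psi>. (restrict \<psi> H, \<psi> a)) ` ?Y = Sigma ?X ?roots"
    proof (intro equalityI[OF image_subsetI subsetI] SigmaI CollectI conjI)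
      fix \<psi> assume \<psi>: "\<psi> \<in> ?Y"
      then have "\<psi> \<in> hom (A\<lparr>carrier := H\<rparr>) ?Q"
        using subset_adjoin characters_closed[OF \<psi>] characters_mult[OF \<psi>]
        by (intro homI) (simp_all add: subsetD[OF subset_adjoin])
      then show "restrict \<psi> H \<in> ?X"
        using restrict_in_characters[of \<psi> "A\<lparr>carrier := H\<rparr>"] subgroup subgroup_imp_group by simp
      show "\<psi> a \<in> carrier ?Q"
        using characters_closed[OF \<psi>, of a] a_in_adjoin by simp
      have "\<psi> (a [^] m) = \<psi> \<one> \<otimes>\<^bsub>?Q\<^esub> \<psi> a [^]\<^bsub>?Q\<^esub> m"
        using character_adjoin[OF \<psi> subgroup.one_closed[OF subgroup], of "int m"] a
        by (simp add: int_pow_int)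
      moreover have "\<psi> \<one> = \<one>\<^bsub>?Q\<^esub>"
        using character_adjoin[OF \<psi> subgroup.one_closed[OF subgroup], of 0]
          characters_closed[OF \<psi>, of \<one>] a subgroup.one_closed[OF subgroup_adjoin]
          characters_mult[OF \<psi>, of \<one> \<one>]
        by simp
      ultimately show "\<psi> a [^]\<^bsub>?Q\<^esub> m = restrict \<psi> H (a [^] m)"
        using m(2) \<open>\<psi> a \<in> carrier ?Q\<close> by simp
    next
      fix p assume "p \<in> Sigma ?X ?roots"
      then obtain \<chi> c where p: "p = (\<chi>, c)"
        and *: "\<chi> \<in> ?X" "c \<in> carrier ?Q" "c [^]\<^bsub>?Q\<^esub> m = \<chi> (a [^] m)"
        by blast
      then have \<chi>: "\<chi> \<in> hom (A\<lparr>carrier := H\<rparr>) ?Q" by (simp add: characters_def)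
      obtain \<psi> where \<psi>: "\<psi> \<in> hom (A\<lparr>carrier := adjoin A H a\<rparr>) ?Q" "\<And>h. h \<in> H \<Longrightarrow> \<psi> h = \<chi> h" "\<psi> a = c"
        using hom_adjoin[OF comm_group_rat_mod_int \<chi> *(2)]
          hom_on_powers_if_root[OF comm_group_rat_mod_int \<chi> *(2) m *(3)] by blast
      let ?\<psi> = "restrict \<psi> (adjoin A H a)"
      have "?\<psi> \<in> ?Y"
        using restrict_in_characters[OF \<psi>(1)] subgroup_adjoin by (simp add: subgroup_imp_group)
      moreover have "restrict ?\<psi> H = \<chi>"
        using *(1) \<psi>(2) subset_adjoin
        by (intro extensionalityI[of _ H]) (auto simp: characters_def)
      moreover have "?\<psi> a = c"
        using \<psi>(3) a_in_adjoin by simp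
      ultimately show "p \<in> (\<lambda>\<psi>. (restrict \<psi> H, \<psi> a)) ` ?Y"
        by (intro image_eqI[of _ _ ?\<psi>]) (simp_all add: p)
    qed
  qed
  have fin_roots: "finite (?roots \<chi>)" if "\<chi> \<in> ?X" for \<chi>
    using card_roots[OF that] m(1) by (intro card_ge_0_finite) simp
  from bij have "card ?Y = card (Sigma ?X ?roots)"
    by (rule bij_betw_same_card)
  also have "\<dots> = m * card ?X"
    using fin fin_roots by (simp add: card_SigmaI card_roots)
  finally show "card ?Y = m * card ?X" .
  show "finite ?Y"
    using bij_betw_finite[OF bij] fin fin_roots by simp
qed

end

text \<open>
  The number of characters and the order of the group grow by the same factor whenever a generator is
  adjoined.
\<close>

lemma card_characters:
  assumes "comm_group A" "finite (carrier A)"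
  shows "card (characters A) = card (carrier A)"
proof -
  interpret comm_group A by fact
  have *: "card (characters (A\<lparr>carrier := generate A T\<rparr>)) = card (generate A T) \<and>
      finite (characters (A\<lparr>carrier := generate A T\<rparr>))"
    if "finite T" "T \<subseteq> carrier A" for T
    using that
  proof (induction T rule: finite_induct)
    case empty
    have gen: "generate A {} = {\<one>\<^bsub>A\<^esub>}"
      by (rule generate_empty)
    have "characters (A\<lparr>carrier := {\<one>\<^bsub>A\<^esub>}\<rparr>) = {restrict (\<lambda>_. \<one>\<^bsub>rat_mod_int\<^esub>) {\<one>\<^bsub>A\<^esub>}}"
    proof safe
      fix \<chi> assume \<chi>: "\<chi> \<in> characters (A\<lparr>carrier := {\<one>\<^bsub>A\<^esub>}\<rparr>)"
      then have "\<chi> \<one>\<^bsub>A\<^esub> = \<one>\<^bsub>rat_mod_int\<^esub>"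
        using characters_mult[OF \<chi>, of "\<one>\<^bsub>A\<^esub>" "\<one>\<^bsub>A\<^esub>"] characters_closed[OF \<chi>, of "\<one>\<^bsub>A\<^esub>"] by simp
      with \<chi> show "\<chi> = restrict (\<lambda>_. \<one>\<^bsub>rat_mod_int\<^esub>) {\<one>\<^bsub>A\<^esub>}"
        by (intro extensionalityI[of _ "{\<one>\<^bsub>A\<^esub>}"]) (auto simp: characters_def)
    qed (auto simp: characters_def hom_def)
    then show ?case by (simp add: gen)
  next
    case (insert a T)
    interpret adjoin_element A "generate A T" a
      using insert.prems generate_is_subgroup[of T]
      by (simp add: adjoin_element_def adjoin_element_axioms_def comm_group_axioms)
    have T: "T \<subseteq> generate A T"
      by (auto intro: generate.incl)
    have adj: "adjoin A (generate A T) a = generate A (insert a T)"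
    proof
      show "adjoin A (generate A T) a \<subseteq> generate A (insert a T)"
        unfolding adjoin_eq_generate
        using insert.prems mono_generate[of T "insert a T"]
        by (intro generate_subgroup_incl generate_is_subgroup) (auto intro: generate.incl)
      show "generate A (insert a T) \<subseteq> adjoin A (generate A T) a"
        using T subset_adjoin a_in_adjoin by (intro generate_subgroup_incl subgroup_adjoin) auto
    qed
    have "order A > 0"
      using assms(2) by (simp add: order_gt_0_iff_finite)
    moreover have "a [^]\<^bsub>A\<^esub> int (order A) \<in> generate A T"
      using pow_order_eq_1[OF a] by (simp add: int_pow_int generate.one)
    ultimately obtain m :: nat where m: "m > 0" "a [^]\<^bsub>A\<^esub> m \<in> generate A T"
        "\<And>j. 0 < j \<Longrightarrow> j < m \<Longrightarrow> a [^]\<^bsub>A\<^esub> j \<notin> generate A T"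
      using least_power_in_subgroup[of "int (order A)"] by (metis less_irrefl of_nat_eq_0_iff)
    from card_characters_adjoin[OF m] card_adjoin[OF m] insert show ?case
      by (simp add: adj)
  qed
  have "generate A (carrier A) = carrier A"
    using generate_incl[of "carrier A"] generate.incl[of _ "carrier A" A] by auto
  with *[OF assms(2)] show ?thesis by (auto simp: characters_def hom_def)
qed

section \<open>Linear extension to free abelian groups and the bar complex\<close>

text \<open>
  The linear extension of \<open>f\<close> to formal integer combinations. For a cochain \<open>f\<close> it is the pairing of
  \<open>f\<close> with chains, for a factor set it induces the connecting map of the extension.
\<close>

definition frag_eval :: "('c, 'm) monoid_scheme \<Rightarrow> ('x \<Rightarrow> 'c) \<Rightarrow> ('x \<Rightarrow>\<^sub>0 int) \<Rightarrow> 'c" where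
  "frag_eval C f z = (\<Otimes>\<^bsub>C\<^esub>x\<in>Poly_Mapping.keys z. f x [^]\<^bsub>C\<^esub> poly_mapping.lookup z x)"

lemma group_hom_free_Abelian_group:
  "group C \<Longrightarrow> h \<in> hom (free_Abelian_group X) C \<Longrightarrow> group_hom (free_Abelian_group X) C h"
  by (simp add: group_hom_def group_hom_axioms_def)

text \<open>
  Almost all identities between linear extensions below are reduced to basis elements in this way.
\<close>

lemma hom_free_Abelian_group_eqI:
  assumes "group C" "h \<in> hom (free_Abelian_group X) C" "h' \<in> hom (free_Abelian_group X) C"
    and "\<And>x. x \<in> X \<Longrightarrow> h (frag_of x) = h' (frag_of x)" and "Poly_Mapping.keys z \<subseteq> X"
  shows "h z = h' z"
proof -
  interpret h: group_hom "free_Abelian_group X" C h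
    using assms by (intro group_hom_free_Abelian_group)
  interpret h': group_hom "free_Abelian_group X" C h'
    using assms by (intro group_hom_free_Abelian_group)
  have k_diff: "k (x - y) = k x \<otimes>\<^bsub>C\<^esub> inv\<^bsub>C\<^esub> k y"
    if "group_hom (free_Abelian_group X) C k" "Poly_Mapping.keys x \<subseteq> X" "Poly_Mapping.keys y \<subseteq> X" for k x y
    using that group_hom.hom_mult[OF that(1), of x "- y"] group_hom.hom_inv[OF that(1), of y] by simp
  show ?thesis
    using assms(5)
  proof (induction rule: free_Abelian_group_induct[consumes 1, case_names zero diff gen])
    case zero
    show ?case using h.hom_one h'.hom_one by simp
  next
    case (diff x y)
    then show ?case
      by (simp add: k_diff[OF h.group_hom_axioms] k_diff[OF h'.group_hom_axioms])
  qed (simp add: assms(4))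
qed

lemma frag_eval_cong:
  "(\<And>x. x \<in> Poly_Mapping.keys z \<Longrightarrow> f x = g x) \<Longrightarrow> comm_monoid C \<Longrightarrow>
    (\<And>x. x \<in> Poly_Mapping.keys z \<Longrightarrow> g x \<in> carrier C) \<Longrightarrow> group C \<Longrightarrow> frag_eval C f z = frag_eval C g z"
  unfolding frag_eval_def by (intro comm_monoid.finprod_cong') (auto simp: group.int_pow_closed)

context comm_group
begin

lemma frag_eval_superset:
  assumes "finite X" "Poly_Mapping.keys z \<subseteq> X" "f \<in> X \<rightarrow> carrier G"
  shows "frag_eval G f z = (\<Otimes>x\<in>X. f x [^] poly_mapping.lookup z x)"
  unfolding frag_eval_def using assms
  by (intro finprod_mono_neutral_cong_left) (auto simp: in_keys_iff Pi_iff)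

lemma frag_eval_hom:
  assumes "f \<in> X \<rightarrow> carrier G"
  shows "frag_eval G f \<in> hom (free_Abelian_group X) G"
proof (rule homI)
  fix z assume "z \<in> carrier (free_Abelian_group X)"
  then show "frag_eval G f z \<in> carrier G"
    using assms unfolding frag_eval_def by (intro finprod_closed) auto
next
  fix y z assume "y \<in> carrier (free_Abelian_group X)" "z \<in> carrier (free_Abelian_group X)"
  then have f: "f \<in> Poly_Mapping.keys y \<union> Poly_Mapping.keys z \<rightarrow> carrier G"
    using assms by auto
  then show "frag_eval G f (y \<otimes>\<^bsub>free_Abelian_group X\<^esub> z) = frag_eval G f y \<otimes> frag_eval G f z"
    using keys_add[of y z]
    by (simp add: frag_eval_superset[of "Poly_Mapping.keys y \<union> Poly_Mapping.keys z"] lookup_add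
        int_pow_mult Pi_iff flip: finprod_multf cong: finprod_cong)
qed

lemma frag_eval_frag_of [simp]: "f x \<in> carrier G \<Longrightarrow> frag_eval G f (frag_of x) = f x"
  by (simp add: frag_eval_def)

lemma frag_eval_closed:
  "f \<in> X \<rightarrow> carrier G \<Longrightarrow> Poly_Mapping.keys z \<subseteq> X \<Longrightarrow> frag_eval G f z \<in> carrier G"
  using hom_in_carrier[OF frag_eval_hom] by fastforce

lemma frag_eval_add:
  "f \<in> X \<rightarrow> carrier G \<Longrightarrow> Poly_Mapping.keys y \<subseteq> X \<Longrightarrow> Poly_Mapping.keys z \<subseteq> X \<Longrightarrow>
    frag_eval G f (y + z) = frag_eval G f y \<otimes> frag_eval G f z"
  using hom_mult[OF frag_eval_hom, of f X y z] by simp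

lemma frag_eval_minus:
  assumes "f \<in> X \<rightarrow> carrier G" "Poly_Mapping.keys z \<subseteq> X"
  shows "frag_eval G f (- z) = inv frag_eval G f z"
  using group_hom.hom_inv[OF group_hom_free_Abelian_group[OF group_axioms frag_eval_hom[OF assms(1)]], of z]
    assms(2)
  by simp

lemma frag_eval_diff:
  "f \<in> X \<rightarrow> carrier G \<Longrightarrow> Poly_Mapping.keys y \<subseteq> X \<Longrightarrow> Poly_Mapping.keys z \<subseteq> X \<Longrightarrow>
    frag_eval G f (y - z) = frag_eval G f y \<otimes> inv frag_eval G f z"
  using frag_eval_add[of f X y "- z"] by (simp add: frag_eval_minus)

lemma frag_eval_mult_left:
  assumes "f \<in> X \<rightarrow> carrier G" "g \<in> X \<rightarrow> carrier G" "Poly_Mapping.keys z \<subseteq> X"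
  shows "frag_eval G (\<lambda>x. f x \<otimes> g x) z = frag_eval G f z \<otimes> frag_eval G g z"
proof -
  have "f x \<in> carrier G" "g x \<in> carrier G" if "x \<in> Poly_Mapping.keys z" for x
    using assms that by auto
  then show ?thesis
    unfolding frag_eval_def by (simp add: int_pow_distrib flip: finprod_multf cong: finprod_cong)
qed

lemma frag_eval_one_left: "frag_eval G (\<lambda>_. \<one>) z = \<one>"
  unfolding frag_eval_def by simp

lemma frag_eval_inv_left:
  assumes "f \<in> X \<rightarrow> carrier G" "Poly_Mapping.keys z \<subseteq> X"
  shows "frag_eval G (\<lambda>x. inv f x) z = inv frag_eval G f z"
proof (rule inv_equality[symmetric])
  have inv_f: "(\<lambda>x. inv f x) \<in> X \<rightarrow> carrier G" using assms by auto
  have "frag_eval G (\<lambda>x. inv f x \<otimes> f x) z = frag_eval G (\<lambda>_. \<one>) z"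
    using assms by (intro frag_eval_cong) (auto simp: comm_monoid_axioms Pi_iff subset_iff)
  then show "frag_eval G (\<lambda>x. inv f x) z \<otimes> frag_eval G f z = \<one>"
    using assms inv_f by (simp add: frag_eval_one_left frag_eval_mult_left)
  show "frag_eval G f z \<in> carrier G" "frag_eval G (\<lambda>x. inv f x) z \<in> carrier G"
    using assms inv_f by (auto intro: frag_eval_closed)
qed

lemma hom_frag_eval:
  assumes "comm_group D" "k \<in> hom G D" "f \<in> X \<rightarrow> carrier G" "Poly_Mapping.keys z \<subseteq> X"
  shows "k (frag_eval G f z) = frag_eval D (\<lambda>x. k (f x)) z"
proof -
  interpret D: comm_group D by fact
  have kf: "(\<lambda>x. k (f x)) \<in> X \<rightarrow> carrier D"
    using assms by (auto simp: hom_def)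
  have "(k \<circ> frag_eval G f) z = frag_eval D (\<lambda>x. k (f x)) z"
    using assms(3) kf
    by (intro hom_free_Abelian_group_eqI[OF D.is_group Group.hom_compose[OF frag_eval_hom[OF assms(3)] assms(2)]
          D.frag_eval_hom[OF kf] _ assms(4)])
      (auto simp: Pi_iff)
  then show ?thesis by simp
qed

end

lemma frag_extend_hom:
  assumes "\<And>x. x \<in> X \<Longrightarrow> Poly_Mapping.keys (f x) \<subseteq> Y"
  shows "frag_extend f \<in> hom (free_Abelian_group X) (free_Abelian_group Y)"
proof (rule homI)
  fix z assume "z \<in> carrier (free_Abelian_group X)"
  then have "Poly_Mapping.keys z \<subseteq> X" by simp
  then show "frag_extend f z \<in> carrier (free_Abelian_group Y)"
  proof (induction rule: free_Abelian_group_induct[consumes 1, case_names zero diff gen])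
    case (diff x y)
    then show ?case
      using keys_diff[of "frag_extend f x" "frag_extend f y"]
      by (auto simp: frag_extend_diff)
  qed (use assms in auto)
qed (simp add: frag_extend_add)

lemma (in group) bar_boundary2_hom:
  "bar_boundary2 G \<in> hom (free_Abelian_group (carrier G \<times> carrier G)) (free_Abelian_group (carrier G))"
  unfolding bar_boundary2_def
  by (rule frag_extend_hom)
    (auto dest!: keys_diff[THEN subsetD] Poly_Mapping.keys_add[THEN subsetD])

lemma (in group) bar_boundary3_hom:
  "bar_boundary3 G \<in> hom (free_Abelian_group (carrier G \<times> carrier G \<times> carrier G))
     (free_Abelian_group (carrier G \<times> carrier G))"
  unfolding bar_boundary3_def
  by (rule frag_extend_hom)
    (auto dest!: keys_diff[THEN subsetD] Poly_Mapping.keys_add[THEN subsetD])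

lemma (in group) subgroup_cycles2:
  "subgroup (cycles2 G) (free_Abelian_group (carrier G \<times> carrier G))"
  unfolding cycles2_def
  by (intro group_hom.subgroup_kernel group_hom_free_Abelian_group bar_boundary2_hom) simp

lemma (in group) subgroup_boundaries2:
  "subgroup (boundaries2 G) (free_Abelian_group (carrier G \<times> carrier G))"
  unfolding boundaries2_def
  by (intro group_hom.img_is_subgroup group_hom_free_Abelian_group bar_boundary3_hom) simp

lemma cycles2_iff:
  "z \<in> cycles2 G \<longleftrightarrow> Poly_Mapping.keys z \<subseteq> carrier G \<times> carrier G \<and> bar_boundary2 G z = 0"
  by (simp add: cycles2_def kernel_def)

lemma bar_boundary2_minus: "bar_boundary2 G (- z) = - bar_boundary2 G z"
  by (simp add: bar_boundary2_def frag_extend_minus)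

lemma bar_boundary2_add: "bar_boundary2 G (y + z) = bar_boundary2 G y + bar_boundary2 G z"
  by (simp add: bar_boundary2_def frag_extend_add)

lemma bar_boundary2_diff: "bar_boundary2 G (y - z) = bar_boundary2 G y - bar_boundary2 G z"
  by (simp add: bar_boundary2_def frag_extend_diff)

lemma bar_boundary2_frag_of: "bar_boundary2 G (frag_of (g, h)) = frag_of h - frag_of (g \<otimes>\<^bsub>G\<^esub> h) + frag_of g"
  by (simp add: bar_boundary2_def)

lemma keys_add_diff_subset:
  assumes "Poly_Mapping.keys y \<subseteq> X" "Poly_Mapping.keys z \<subseteq> X"
  shows "Poly_Mapping.keys (y + z) \<subseteq> X" "Poly_Mapping.keys (y - z) \<subseteq> X"
  using assms keys_diff[of y z] Poly_Mapping.keys_add[of y z] by auto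

text \<open>
  Coboundary and boundary are adjoint under the pairing of cochains and chains. In particular the
  values of a coboundary on cycles are trivial.
\<close>

lemma (in group) frag_eval_coboundary1:
  assumes "comm_group C" "t \<in> carrier G \<rightarrow> carrier C" "Poly_Mapping.keys z \<subseteq> carrier G \<times> carrier G"
    and f: "\<And>g h. g \<in> carrier G \<Longrightarrow> h \<in> carrier G \<Longrightarrow>
      f (g, h) = t h \<otimes>\<^bsub>C\<^esub> inv\<^bsub>C\<^esub> t (g \<otimes> h) \<otimes>\<^bsub>C\<^esub> t g"
  shows "frag_eval C f z = frag_eval C t (bar_boundary2 G z)"
proof -
  interpret C: comm_group C by fact
  have t: "t g \<in> carrier C" if "g \<in> carrier G" for g
    using assms(2) that by auto
  have f_closed: "f \<in> carrier G \<times> carrier G \<rightarrow> carrier C"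
    using t f by auto
  have "frag_eval C f z = (frag_eval C t \<circ> bar_boundary2 G) z"
  proof (rule hom_free_Abelian_group_eqI[OF C.is_group C.frag_eval_hom[OF f_closed]
        Group.hom_compose[OF bar_boundary2_hom C.frag_eval_hom[OF assms(2)]] _ assms(3)])
    fix x assume "x \<in> carrier G \<times> carrier G"
    then obtain g h where x: "x = (g, h)" "g \<in> carrier G" "h \<in> carrier G" by auto
    have k: "Poly_Mapping.keys (frag_of h - frag_of (g \<otimes> h)) \<subseteq> carrier G"
      using x keys_diff[of "frag_of h" "frag_of (g \<otimes> h)"] by auto
    show "frag_eval C f (frag_of x) = (frag_eval C t \<circ> bar_boundary2 G) (frag_of x)"
      using x t f_closed k
      by (simp add: bar_boundary2_def C.frag_eval_add[OF assms(2)] C.frag_eval_diff[OF assms(2)] f)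
  qed
  then show ?thesis by simp
qed

lemma (in group) frag_eval_coboundary2:
  assumes "comm_group C" "f \<in> carrier G \<times> carrier G \<rightarrow> carrier C"
    "g \<in> carrier G" "h \<in> carrier G" "k \<in> carrier G"
  shows "frag_eval C f (bar_boundary3 G (frag_of (g, h, k))) = coboundary2 G C f (g, h, k)"
proof -
  interpret C: comm_group C by fact
  have k: "Poly_Mapping.keys (frag_of (h, k) - frag_of (g \<otimes> h, k)) \<subseteq> carrier G \<times> carrier G"
     "Poly_Mapping.keys (frag_of (h, k) - frag_of (g \<otimes> h, k) + frag_of (g, h \<otimes> k)) \<subseteq> carrier G \<times> carrier G"
    using assms by (auto dest!: keys_diff[THEN subsetD] Poly_Mapping.keys_add[THEN subsetD])
  have f: "f (a, b) \<in> carrier C" if "a \<in> carrier G" "b \<in> carrier G" for a b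
    using assms(2) that by auto
  show ?thesis
    using assms(3-5) k f
    by (simp add: bar_boundary3_def C.frag_eval_add[OF assms(2)] C.frag_eval_diff[OF assms(2)]
        coboundary2_def)
qed

text \<open>
  The cocycle condition on \<open>f\<close> is the vanishing of its linear extension on the boundaries of basic
  3-chains. It is stated without extensionality so that it also applies to factor sets.
\<close>

lemma (in group) cocycle_condition_iff:
  assumes "comm_group C" "f \<in> carrier G \<times> carrier G \<rightarrow> carrier C"
  shows "(\<forall>g\<in>carrier G. \<forall>h\<in>carrier G. \<forall>k\<in>carrier G. coboundary2 G C f (g, h, k) = \<one>\<^bsub>C\<^esub>) \<longleftrightarrow>
    (\<forall>z\<in>boundaries2 G. frag_eval C f z = \<one>\<^bsub>C\<^esub>)"
proof
  interpret C: comm_group C by fact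
  note f = assms(2)
  let ?G3 = "carrier G \<times> carrier G \<times> carrier G"
  assume *: "\<forall>g\<in>carrier G. \<forall>h\<in>carrier G. \<forall>k\<in>carrier G. coboundary2 G C f (g, h, k) = \<one>\<^bsub>C\<^esub>"
  have "(frag_eval C f \<circ> bar_boundary3 G) z = frag_eval C (\<lambda>_. \<one>\<^bsub>C\<^esub>) z" if "Poly_Mapping.keys z \<subseteq> ?G3" for z
  proof (rule hom_free_Abelian_group_eqI[OF C.is_group Group.hom_compose[OF bar_boundary3_hom C.frag_eval_hom[OF f]]
        C.frag_eval_hom _ that])
    fix x assume "x \<in> ?G3"
    then show "(frag_eval C f \<circ> bar_boundary3 G) (frag_of x) = frag_eval C (\<lambda>_. \<one>\<^bsub>C\<^esub>) (frag_of x)"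
      using * frag_eval_coboundary2[OF assms] by auto
  qed auto
  then show "\<forall>z\<in>boundaries2 G. frag_eval C f z = \<one>\<^bsub>C\<^esub>"
    by (auto simp: boundaries2_def C.frag_eval_one_left)
next
  assume "\<forall>z\<in>boundaries2 G. frag_eval C f z = \<one>\<^bsub>C\<^esub>"
  then show "\<forall>g\<in>carrier G. \<forall>h\<in>carrier G. \<forall>k\<in>carrier G. coboundary2 G C f (g, h, k) = \<one>\<^bsub>C\<^esub>"
    by (auto simp: boundaries2_def simp flip: frag_eval_coboundary2[OF assms])
qed

lemma (in group) cocycles2_iff:
  assumes "comm_group C"
  shows "f \<in> cocycles2 G C \<longleftrightarrow>
    f \<in> carrier (cochains2 G C) \<and> (\<forall>z\<in>boundaries2 G. frag_eval C f z = \<one>\<^bsub>C\<^esub>)"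
proof (cases "f \<in> carrier (cochains2 G C)")
  case True
  let ?G3 = "carrier G \<times> carrier G \<times> carrier G"
  have f: "f \<in> carrier G \<times> carrier G \<rightarrow> carrier C"
    using True by (auto simp: cochains2_def)
  have "coboundary2 G C f \<in> extensional ?G3"
    unfolding coboundary2_def by (rule restrict_extensional)
  then have "coboundary2 G C f = (\<lambda>_\<in>?G3. \<one>\<^bsub>C\<^esub>) \<longleftrightarrow> (\<forall>x\<in>?G3. coboundary2 G C f x = \<one>\<^bsub>C\<^esub>)"
    by (metis (no_types, lifting) extensionalityI restrict_apply' restrict_extensional)
  with True show ?thesis
    by (simp add: cocycles2_def kernel_def cochains3_def flip: cocycle_condition_iff[OF assms f])
qed (simp add: cocycles2_def kernel_def)

lemma generate_frag_of: "carrier (free_Abelian_group X) \<subseteq> generate (free_Abelian_group X) (frag_of ` X)"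
proof
  have sg: "subgroup (generate (free_Abelian_group X) (frag_of ` X)) (free_Abelian_group X)"
    by (intro group.generate_is_subgroup) auto
  fix z assume "z \<in> carrier (free_Abelian_group X)"
  then have "Poly_Mapping.keys z \<subseteq> X" by simp
  then show "z \<in> generate (free_Abelian_group X) (frag_of ` X)"
  proof (induction rule: free_Abelian_group_induct[consumes 1, case_names zero diff gen])
    case (diff x y)
    then show ?case
      using subgroup.m_closed[OF sg, of x "- y"] subgroup.m_inv_closed[OF sg, of y] by simp
  qed (use subgroup.one_closed[OF sg] in \<open>auto intro: generate.incl\<close>)
qed

lemma hom_extend_free_Abelian_group:
  assumes "finite X" "comm_group C" "divisible C" "subgroup H (free_Abelian_group X)"
    and "\<chi> \<in> hom (free_Abelian_group X\<lparr>carrier := H\<rparr>) C"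
  obtains \<psi> where "\<psi> \<in> hom (free_Abelian_group X) C" "\<And>z. z \<in> H \<Longrightarrow> \<psi> z = \<chi> z"
proof -
  interpret F: comm_group "free_Abelian_group X" by (rule abelian_free_Abelian_group)
  have fin: "finite (frag_of ` X)" and sub: "frag_of ` X \<subseteq> carrier (free_Abelian_group X)"
    using assms(1) by auto
  obtain \<psi> where \<psi>: "\<psi> \<in> hom (free_Abelian_group X\<lparr>carrier := generate (free_Abelian_group X) (H \<union> frag_of ` X)\<rparr>) C"
    "\<And>z. z \<in> H \<Longrightarrow> \<psi> z = \<chi> z"
    using F.hom_extend_divisible[OF assms(2-5) fin sub] by blast
  have "generate (free_Abelian_group X) (H \<union> frag_of ` X) = carrier (free_Abelian_group X)"
  proof
    show "generate (free_Abelian_group X) (H \<union> frag_of ` X) \<subseteq> carrier (free_Abelian_group X)"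
      using sub subgroup.subset[OF assms(4)] by (intro F.generate_incl) auto
    show "carrier (free_Abelian_group X) \<subseteq> generate (free_Abelian_group X) (H \<union> frag_of ` X)"
      using generate_frag_of F.mono_generate[of "frag_of ` X" "H \<union> frag_of ` X"] by blast
  qed
  with \<psi> that show thesis by simp
qed

text \<open>
  If \<open>f\<close> vanishes on cycles, its linear extension factors through the boundary map and so gives a
  homomorphism on the group of 1-boundaries. An extension of it to all 1-chains, which exists since \<open>C\<close>
  is divisible, is a 1-cochain with coboundary \<open>f\<close>.
\<close>

lemma (in group) trivial_on_cycles_imp_coboundary:
  assumes "finite (carrier G)" "comm_group C" "divisible C" "f \<in> carrier G \<times> carrier G \<rightarrow> carrier C"
    and triv: "\<And>z. z \<in> cycles2 G \<Longrightarrow> frag_eval C f z = \<one>\<^bsub>C\<^esub>"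
  obtains t where "t \<in> carrier G \<rightarrow> carrier C"
    "\<And>g h. g \<in> carrier G \<Longrightarrow> h \<in> carrier G \<Longrightarrow> f (g, h) = t h \<otimes>\<^bsub>C\<^esub> inv\<^bsub>C\<^esub> t (g \<otimes> h) \<otimes>\<^bsub>C\<^esub> t g"
proof -
  interpret C: comm_group C by fact
  let ?F1 = "free_Abelian_group (carrier G)" and ?F2 = "free_Abelian_group (carrier G \<times> carrier G)"
  let ?I = "bar_boundary2 G ` carrier ?F2"
  interpret d: group_hom ?F2 ?F1 "bar_boundary2 G"
    by (intro group_hom_free_Abelian_group bar_boundary2_hom) simp
  interpret e: group_hom ?F2 C "frag_eval C f"
    using assms(4) by (intro group_hom_free_Abelian_group C.frag_eval_hom C.is_group)
  have well: "frag_eval C f x = frag_eval C f y"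
    if "x \<in> carrier ?F2" "y \<in> carrier ?F2" "bar_boundary2 G x = bar_boundary2 G y" for x y
  proof -
    have "x - y \<in> cycles2 G"
      using that keys_diff[of x y] by (auto simp: cycles2_iff bar_boundary2_def frag_extend_diff)
    then have "frag_eval C f x \<otimes>\<^bsub>C\<^esub> inv\<^bsub>C\<^esub> frag_eval C f y = \<one>\<^bsub>C\<^esub>"
      using triv that C.frag_eval_diff[OF assms(4), of x y] by simp
    then show ?thesis
      using that e.hom_closed by (metis C.inv_solve_right' C.l_one C.one_closed)
  qed
  define \<chi> where "\<chi> y = frag_eval C f (inv_into (carrier ?F2) (bar_boundary2 G) y)" for y
  have \<chi>: "\<chi> (bar_boundary2 G z) = frag_eval C f z" if "z \<in> carrier ?F2" for z
  proof -
    have "bar_boundary2 G z \<in> ?I" using that by blast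
    then show ?thesis
      unfolding \<chi>_def using that by (intro well inv_into_into f_inv_into_f) 
  qed
  have "\<chi> \<in> hom (?F1\<lparr>carrier := ?I\<rparr>) C"
  proof (rule homI)
    fix x y assume "x \<in> carrier (?F1\<lparr>carrier := ?I\<rparr>)" "y \<in> carrier (?F1\<lparr>carrier := ?I\<rparr>)"
    then obtain a b where ab: "a \<in> carrier ?F2" "x = bar_boundary2 G a" "b \<in> carrier ?F2" "y = bar_boundary2 G b"
      by auto
    then have "x \<otimes>\<^bsub>?F1\<^esub> y = bar_boundary2 G (a \<otimes>\<^bsub>?F2\<^esub> b)"
      by (metis d.hom_mult)
    then have "\<chi> (x \<otimes>\<^bsub>?F1\<^esub> y) = frag_eval C f (a \<otimes>\<^bsub>?F2\<^esub> b)"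
      using ab \<chi>[of "a \<otimes>\<^bsub>?F2\<^esub> b"] d.G.m_closed by metis
    then show "\<chi> (x \<otimes>\<^bsub>?F1\<lparr>carrier := ?I\<rparr>\<^esub> y) = \<chi> x \<otimes>\<^bsub>C\<^esub> \<chi> y"
      using ab e.hom_mult \<chi> by (metis monoid.simps(1) partial_object.update_convs(1) monoid.surjective)
  qed (use \<chi> e.hom_closed in auto)
  then obtain \<psi> where \<psi>: "\<psi> \<in> hom ?F1 C" "\<And>y. y \<in> ?I \<Longrightarrow> \<psi> y = \<chi> y"
    using hom_extend_free_Abelian_group[OF assms(1-3) d.img_is_subgroup] by metis
  interpret \<psi>: group_hom ?F1 C \<psi>
    using \<psi>(1) by (intro group_hom_free_Abelian_group C.is_group)
  show thesis
  proof
    show "(\<lambda>g. \<psi> (frag_of g)) \<in> carrier G \<rightarrow> carrier C"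
      using \<psi>.hom_closed by auto
    fix g h assume gh: "g \<in> carrier G" "h \<in> carrier G"
    then have "f (g, h) = frag_eval C f (frag_of (g, h))"
      using assms(4) by (auto simp: Pi_iff)
    also have "\<dots> = \<psi> (bar_boundary2 G (frag_of (g, h)))"
      using \<psi>(2) \<chi>[of "frag_of (g, h)"] gh by auto
    also have "\<dots> = \<psi> ((frag_of h \<otimes>\<^bsub>?F1\<^esub> inv\<^bsub>?F1\<^esub> frag_of (g \<otimes> h)) \<otimes>\<^bsub>?F1\<^esub> frag_of g)"
      using gh by (simp add: bar_boundary2_def)
    also have "\<dots> = \<psi> (frag_of h) \<otimes>\<^bsub>C\<^esub> inv\<^bsub>C\<^esub> \<psi> (frag_of (g \<otimes> h)) \<otimes>\<^bsub>C\<^esub> \<psi> (frag_of g)"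
      using gh by (simp del: carrier_free_Abelian_group_iff mult_free_Abelian_group inv_free_Abelian_group)
    finally show "f (g, h) = \<psi> (frag_of h) \<otimes>\<^bsub>C\<^esub> inv\<^bsub>C\<^esub> \<psi> (frag_of (g \<otimes> h)) \<otimes>\<^bsub>C\<^esub> \<psi> (frag_of g)" .
  qed
qed

lemma (in group) coboundaries2_iff:
  assumes "finite (carrier G)" "comm_group C" "divisible C"
  shows "f \<in> coboundaries2 G C \<longleftrightarrow>
    f \<in> carrier (cochains2 G C) \<and> (\<forall>z\<in>cycles2 G. frag_eval C f z = \<one>\<^bsub>C\<^esub>)"
proof (intro iffI conjI ballI)
  interpret C: comm_group C by fact
  { assume "f \<in> coboundaries2 G C"
    then obtain t where t: "t \<in> carrier G \<rightarrow> carrier C" "f = coboundary1 G C t"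
      by (auto simp: coboundaries2_def cochains1_def)
    then have t': "t g \<in> carrier C" if "g \<in> carrier G" for g
      using that by auto
    show "f \<in> carrier (cochains2 G C)"
      using t' by (auto simp: t(2) cochains2_def coboundary1_def)
    show "frag_eval C f z = \<one>\<^bsub>C\<^esub>" if z: "z \<in> cycles2 G" for z
    proof -
      have "frag_eval C f z = frag_eval C t (bar_boundary2 G z)"
        using z t by (intro frag_eval_coboundary1[OF assms(2)]) (auto simp: cycles2_iff coboundary1_def)
      then show ?thesis
        using z by (simp add: cycles2_iff) (simp add: frag_eval_def)
    qed }
  assume *: "f \<in> carrier (cochains2 G C) \<and> (\<forall>z\<in>cycles2 G. frag_eval C f z = \<one>\<^bsub>C\<^esub>)"
  then have f: "f \<in> carrier G \<times> carrier G \<rightarrow> carrier C" "f \<in> extensional (carrier G \<times> carrier G)"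
    by (auto simp: cochains2_def PiE_iff)
  then obtain t where t: "t \<in> carrier G \<rightarrow> carrier C"
    "\<And>g h. g \<in> carrier G \<Longrightarrow> h \<in> carrier G \<Longrightarrow> f (g, h) = t h \<otimes>\<^bsub>C\<^esub> inv\<^bsub>C\<^esub> t (g \<otimes> h) \<otimes>\<^bsub>C\<^esub> t g"
    using trivial_on_cycles_imp_coboundary[OF assms f(1)] * by metis
  have "f = coboundary1 G C (restrict t (carrier G))"
    using f(2) t
    by (intro extensionalityI[of _ "carrier G \<times> carrier G"]) (auto simp: coboundary1_def)
  moreover have "restrict t (carrier G) \<in> carrier (cochains1 G C)"
    using t(1) by (auto simp: cochains1_def)
  ultimately show "f \<in> coboundaries2 G C"
    by (auto simp: coboundaries2_def)
qed

section \<open>The Bogomolov multiplier as a group of characters\<close>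

lemma card_characters_trivial_on:
  assumes "comm_group A" "subgroup N A"
  shows "card {\<chi> \<in> characters A. \<forall>x\<in>N. \<chi> x = \<one>\<^bsub>rat_mod_int\<^esub>} = card (characters (A Mod N))"
proof -
  interpret comm_group A by fact
  interpret normal N A
    using assms(2) by (simp add: normal_iff_subgroup)
  interpret quot: comm_group "A Mod N"
    using assms(2) by (rule abelian_FactGroup)
  let ?Q = rat_mod_int
  let ?f = "\<lambda>\<rho>. \<lambda>x\<in>carrier A. \<rho> (N #>\<^bsub>A\<^esub> x)"
  have coset: "N #>\<^bsub>A\<^esub> x \<in> carrier (A Mod N)" if "x \<in> carrier A" for x
    using that by (auto simp: carrier_FactGroup)
  have "bij_betw ?f (characters (A Mod N)) {\<chi> \<in> characters A. \<forall>x\<in>N. \<chi> x = \<one>\<^bsub>?Q\<^esub>}"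
    unfolding bij_betw_def
  proof
    show "inj_on ?f (characters (A Mod N))"
    proof (rule inj_onI)
      fix \<rho> \<rho>' assume *: "\<rho> \<in> characters (A Mod N)" "\<rho>' \<in> characters (A Mod N)" "?f \<rho> = ?f \<rho>'"
      then have "\<rho> (N #>\<^bsub>A\<^esub> x) = \<rho>' (N #>\<^bsub>A\<^esub> x)" if "x \<in> carrier A" for x
        using that by (metis (no_types, lifting) restrict_apply')
      with * show "\<rho> = \<rho>'"
        by (intro characters_eqI) (auto simp: carrier_FactGroup)
    qed
    show "?f ` characters (A Mod N) = {\<chi> \<in> characters A. \<forall>x\<in>N. \<chi> x = \<one>\<^bsub>?Q\<^esub>}"
    proof (intro equalityI[OF image_subsetI subsetI] CollectI conjI ballI)
      fix \<rho> assume \<rho>: "\<rho> \<in> characters (A Mod N)"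
      then have "\<rho> \<circ> (\<lambda>x. N #>\<^bsub>A\<^esub> x) \<in> hom A ?Q"
        by (intro Group.hom_compose[OF r_coset_hom_Mod]) (simp add: characters_def)
      from restrict_in_characters[OF this is_group] show "?f \<rho> \<in> characters A"
        by (simp add: comp_def)
      fix x assume "x \<in> N"
      then have "N #>\<^bsub>A\<^esub> x = \<one>\<^bsub>A Mod N\<^esub>" "x \<in> carrier A"
        by (simp_all add: coset_join2 assms(2) mem_carrier)
      moreover have "\<rho> \<one>\<^bsub>A Mod N\<^esub> = \<one>\<^bsub>?Q\<^esub>"
        using \<rho> by (intro hom_one[OF _ quot.is_group rat_mod_int.is_group]) (simp add: characters_def)
      ultimately show "?f \<rho> x = \<one>\<^bsub>?Q\<^esub>" by simp
    next
      fix \<chi> assume \<chi>: "\<chi> \<in> {\<chi> \<in> characters A. \<forall>x\<in>N. \<chi> x = \<one>\<^bsub>?Q\<^esub>}"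
      then interpret \<chi>: group_hom A ?Q \<chi>
        by unfold_locales (simp add: characters_def)
      have "N \<subseteq> kernel A ?Q \<chi>"
        using \<chi> by (auto simp: kernel_def mem_carrier)
      then obtain \<rho> where \<rho>: "\<rho> \<in> hom (A Mod N) ?Q" "\<And>x. x \<in> carrier A \<Longrightarrow> \<rho> (N #>\<^bsub>A\<^esub> x) = \<chi> x"
        using \<chi>.FactGroup_universal_kernel[OF normal_axioms] by metis
      have "?f (restrict \<rho> (carrier (A Mod N))) = \<chi>"
        using \<chi> \<rho>(2) coset by (intro extensionalityI[of _ "carrier A"]) (auto simp: characters_def)
      with restrict_in_characters[OF \<rho>(1) quot.is_group]
      show "\<chi> \<in> ?f ` characters (A Mod N)" by blast
    qed
  qed
  then show ?thesis by (simp add: bij_betw_same_card)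
qed

text \<open>
  The boundaries are included so that characters trivial on this subgroup come from cocycles. Modulo
  boundaries, it is the subgroup of \<open>H\<^sub>2(G)\<close> generated by the images of \<open>H\<^sub>2(A)\<close> for abelian subgroups
  \<open>A\<close>.
\<close>

definition abelian_cycles2 :: "('a, 'm) monoid_scheme \<Rightarrow> ('a \<times> 'a \<Rightarrow>\<^sub>0 int) set" where
  "abelian_cycles2 G = generate (free_Abelian_group (carrier G \<times> carrier G))
     (boundaries2 G \<union> (\<Union>A\<in>abelian_subgroups G. cycles2 (G\<lparr>carrier := A\<rparr>)))"

lemma bar_boundary2_subgroup [simp]: "bar_boundary2 (G\<lparr>carrier := A\<rparr>) = bar_boundary2 G"
  by (simp add: bar_boundary2_def)

lemma cycles2_subgroup_mono:
  "A \<subseteq> carrier G \<Longrightarrow> cycles2 (G\<lparr>carrier := A\<rparr>) \<subseteq> cycles2 G"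
  unfolding cycles2_iff subset_iff by fastforce

lemma (in group) abelian_cycles2_generators:
  "boundaries2 G \<union> (\<Union>A\<in>abelian_subgroups G. cycles2 (G\<lparr>carrier := A\<rparr>)) \<subseteq> cycles2 G"
  using boundaries2_subset_cycles2[OF is_group] cycles2_subgroup_mono[of _ G] subgroup.subset[of _ G]
  unfolding abelian_subgroups_def by blast

lemma (in group) abelian_cycles2_subset: "abelian_cycles2 G \<subseteq> cycles2 G"
  unfolding abelian_cycles2_def
  by (intro group.generate_subgroup_incl subgroup_cycles2 abelian_cycles2_generators) simp

lemma (in group) subgroup_abelian_cycles2:
  "subgroup (abelian_cycles2 G) (free_Abelian_group (carrier G \<times> carrier G))"
  unfolding abelian_cycles2_def using abelian_cycles2_generators subgroup.subset[OF subgroup_cycles2]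
  by (intro group.generate_is_subgroup) auto

lemma (in group) hom_trivial_on_abelian_cycles2_iff:
  assumes "group C" "\<chi> \<in> hom (free_Abelian_group (carrier G \<times> carrier G)\<lparr>carrier := cycles2 G\<rparr>) C"
  shows "(\<forall>z\<in>abelian_cycles2 G. \<chi> z = \<one>\<^bsub>C\<^esub>) \<longleftrightarrow>
    (\<forall>z\<in>boundaries2 G. \<chi> z = \<one>\<^bsub>C\<^esub>) \<and>
    (\<forall>A\<in>abelian_subgroups G. \<forall>z\<in>cycles2 (G\<lparr>carrier := A\<rparr>). \<chi> z = \<one>\<^bsub>C\<^esub>)"
proof -
  let ?F = "free_Abelian_group (carrier G \<times> carrier G)"
  let ?Z = "?F\<lparr>carrier := cycles2 G\<rparr>"
  let ?S = "boundaries2 G \<union> (\<Union>A\<in>abelian_subgroups G. cycles2 (G\<lparr>carrier := A\<rparr>))"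
  interpret F: group ?F by simp
  interpret \<chi>: group_hom ?Z C \<chi>
    using assms F.subgroup_imp_group[OF subgroup_cycles2] by (simp add: group_hom_def group_hom_axioms_def)
  have gen: "abelian_cycles2 G = generate ?Z ?S"
    unfolding abelian_cycles2_def
    by (rule F.generate_consistent[OF abelian_cycles2_generators subgroup_cycles2, symmetric])
  have "(\<forall>z\<in>abelian_cycles2 G. \<chi> z = \<one>\<^bsub>C\<^esub>) \<longleftrightarrow> abelian_cycles2 G \<subseteq> kernel ?Z C \<chi>"
    using abelian_cycles2_subset by (auto simp: kernel_def)
  also have "\<dots> \<longleftrightarrow> ?S \<subseteq> kernel ?Z C \<chi>"
    unfolding gen using \<chi>.G.generate_subgroup_incl[OF _ \<chi>.subgroup_kernel, of ?S] generate.incl[of _ ?S ?Z]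
    by blast
  also have "\<dots> \<longleftrightarrow> (\<forall>z\<in>?S. \<chi> z = \<one>\<^bsub>C\<^esub>)"
    using abelian_cycles2_generators by (auto simp: kernel_def)
  finally show ?thesis by blast
qed

lemma (in group) bogomolov_multiplier_eq:
  "bogomolov_multiplier G =
     (\<lambda>f. coboundaries2 G rat_mod_int #>\<^bsub>cochains2 G rat_mod_int\<^esub> f) `
       {f \<in> cocycles2 G rat_mod_int. \<forall>A\<in>abelian_subgroups G.
          restrict f (A \<times> A) \<in> coboundaries2 (G\<lparr>carrier := A\<rparr>) rat_mod_int}"
proof -
  let ?Q = rat_mod_int
  let ?cl = "\<lambda>f. coboundaries2 G ?Q #>\<^bsub>cochains2 G ?Q\<^esub> f"
  have carrier: "carrier (cohomology2 G ?Q) = ?cl ` cocycles2 G ?Q"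
    by (simp add: cohomology2_def carrier_FactGroup r_coset_def)
  have "(\<lambda>A\<in>abelian_subgroups G. restriction2 G ?Q A (?cl f)) =
      \<one>\<^bsub>product_group (abelian_subgroups G) (\<lambda>A. cohomology2 (G\<lparr>carrier := A\<rparr>) ?Q)\<^esub> \<longleftrightarrow>
      (\<forall>A\<in>abelian_subgroups G. restrict f (A \<times> A) \<in> coboundaries2 (G\<lparr>carrier := A\<rparr>) ?Q)"
    if f: "f \<in> cocycles2 G ?Q" for f
  proof -
    have "restriction2 G ?Q A (?cl f) = coboundaries2 (G\<lparr>carrier := A\<rparr>) ?Q \<longleftrightarrow>
        restrict f (A \<times> A) \<in> coboundaries2 (G\<lparr>carrier := A\<rparr>) ?Q"
      if A: "A \<in> abelian_subgroups G" for A
    proof -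
      let ?H = "G\<lparr>carrier := A\<rparr>"
      have A': "subgroup A G" using A by (simp add: abelian_subgroups_def)
      then have H: "group ?H" by (rule subgroup_imp_group)
      interpret H: group "cochains2 ?H ?Q"
        by (simp add: cochains2_def)
      have "restrict f (A \<times> A) \<in> carrier (cochains2 ?H ?Q)"
        using f subgroup.subset[OF A'] by (auto simp: cocycles2_def kernel_def cochains2_def)
      then show ?thesis
        unfolding restriction2_class[OF is_group comm_group_rat_mod_int A' f]
        using H.coset_join1 H.coset_join2 subgroup_coboundaries2[OF H comm_group_rat_mod_int] by metis
    qed
    then show ?thesis
      by (auto simp: restrict_def fun_eq_iff cohomology2_def FactGroup_def)
  qed
  then show ?thesis
    unfolding bogomolov_multiplier_def kernel_def carrier by blast
qed

text \<open>
  A cochain is sent to the restriction of its linear extension to \<open>Z\<close>. Two cocycles have the same image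
  exactly if they are cohomologous. The image of a cochain is trivial on boundaries exactly if the cochain
  is a cocycle, and on the cycles of an abelian subgroup exactly if the restriction to the subgroup is a
  coboundary. Every character is reached, since it extends from \<open>Z\<close> to all 2-chains.
\<close>

lemma (in group) b0_eq_card_characters:
  assumes "finite (carrier G)"
  shows "b0 G = card {\<chi> \<in> characters (free_Abelian_group (carrier G \<times> carrier G)\<lparr>carrier := cycles2 G\<rparr>).
    \<forall>z\<in>abelian_cycles2 G. \<chi> z = \<one>\<^bsub>rat_mod_int\<^esub>}"
proof -
  let ?Q = rat_mod_int and ?GG = "carrier G \<times> carrier G"
  let ?F = "free_Abelian_group ?GG"
  let ?Z = "?F\<lparr>carrier := cycles2 G\<rparr>"
  let ?B = "{f \<in> cocycles2 G ?Q. \<forall>A\<in>abelian_subgroups G.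
          restrict f (A \<times> A) \<in> coboundaries2 (G\<lparr>carrier := A\<rparr>) ?Q}"
  let ?X = "\<lambda>f. restrict (frag_eval ?Q f) (cycles2 G)"
  interpret F: group ?F by simp
  interpret Z: group ?Z
    by (rule F.subgroup_imp_group[OF subgroup_cycles2])
  interpret coch: group "cochains2 G ?Q"
    by (simp add: cochains2_def)
  have Z_sub: "Poly_Mapping.keys z \<subseteq> ?GG" if "z \<in> cycles2 G" for z
    using that by (simp add: cycles2_iff)
  have fun_if: "f \<in> ?GG \<rightarrow> carrier ?Q" if "f \<in> carrier (cochains2 G ?Q)" for f
    using that by (auto simp: cochains2_def)
  have cochain_if: "f \<in> carrier (cochains2 G ?Q)" if "f \<in> ?B" for f
    using that by (simp add: cocycles2_def kernel_def)
  have "b0 G = card ((\<lambda>f. coboundaries2 G ?Q #>\<^bsub>cochains2 G ?Q\<^esub> f) ` ?B)"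
    by (simp add: b0_def bogomolov_multiplier_eq)
  also have "\<dots> = card (?X ` ?B)"
  proof (rule card_image_eq_if_same_fibres)
    fix f g assume "f \<in> ?B" "g \<in> ?B"
    then have fg: "f \<in> carrier (cochains2 G ?Q)" "g \<in> carrier (cochains2 G ?Q)"
      by (simp_all only: cochain_if)
    let ?d = "g \<otimes>\<^bsub>cochains2 G ?Q\<^esub> inv\<^bsub>cochains2 G ?Q\<^esub> f"
    have eval: "frag_eval ?Q ?d z = frag_eval ?Q g z \<otimes>\<^bsub>?Q\<^esub> inv\<^bsub>?Q\<^esub> frag_eval ?Q f z" if "z \<in> cycles2 G" for z
    proof -
      have "frag_eval ?Q ?d z = frag_eval ?Q (\<lambda>x. g x \<otimes>\<^bsub>?Q\<^esub> inv\<^bsub>?Q\<^esub> f x) z"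
        using Z_sub[OF that] fg fun_if[OF fg(1)] fun_if[OF fg(2)]
        by (intro frag_eval_cong)
          (auto simp: cochains2_def subset_iff Pi_iff inv_product_group rat_mod_int.is_group
             rat_mod_int.comm_monoid_axioms)
      also have "\<dots> = frag_eval ?Q g z \<otimes>\<^bsub>?Q\<^esub> inv\<^bsub>?Q\<^esub> frag_eval ?Q f z"
        using Z_sub[OF that] fun_if[OF fg(1)] fun_if[OF fg(2)]
        by (subst rat_mod_int.frag_eval_mult_left[of _ ?GG]) (auto simp: rat_mod_int.frag_eval_inv_left[of _ ?GG] Pi_iff)
      finally show ?thesis .
    qed
    have "coboundaries2 G ?Q #>\<^bsub>cochains2 G ?Q\<^esub> f = coboundaries2 G ?Q #>\<^bsub>cochains2 G ?Q\<^esub> g \<longleftrightarrow>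
        ?d \<in> coboundaries2 G ?Q"
      using coch.r_coset_eq_iff[OF subgroup_coboundaries2[OF is_group comm_group_rat_mod_int] fg] .
    also have "\<dots> \<longleftrightarrow> (\<forall>z\<in>cycles2 G. frag_eval ?Q g z \<otimes>\<^bsub>?Q\<^esub> inv\<^bsub>?Q\<^esub> frag_eval ?Q f z = \<one>\<^bsub>?Q\<^esub>)"
      using fg coch.m_closed coch.inv_closed
      by (simp add: coboundaries2_iff[OF assms comm_group_rat_mod_int divisible_rat_mod_int] eval)
    also have "\<dots> \<longleftrightarrow> (\<forall>z\<in>cycles2 G. frag_eval ?Q f z = frag_eval ?Q g z)"
    proof (rule ball_cong[OF HOL.refl])
      fix z assume "z \<in> cycles2 G"
      then have "frag_eval ?Q f z \<in> carrier ?Q" "frag_eval ?Q g z \<in> carrier ?Q"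
        using Z_sub fg fun_if by (auto intro!: rat_mod_int.frag_eval_closed[of _ ?GG])
      then show "frag_eval ?Q g z \<otimes>\<^bsub>?Q\<^esub> inv\<^bsub>?Q\<^esub> frag_eval ?Q f z = \<one>\<^bsub>?Q\<^esub> \<longleftrightarrow> frag_eval ?Q f z = frag_eval ?Q g z"
        by (metis rat_mod_int.inv_solve_right' rat_mod_int.l_one rat_mod_int.one_closed)
    qed
    also have "\<dots> \<longleftrightarrow> ?X f = ?X g"
      by (auto simp: restrict_def fun_eq_iff)
    finally show "coboundaries2 G ?Q #>\<^bsub>cochains2 G ?Q\<^esub> f = coboundaries2 G ?Q #>\<^bsub>cochains2 G ?Q\<^esub> g \<longleftrightarrow> ?X f = ?X g" .
  qed
  also have "?X ` ?B = {\<chi> \<in> characters ?Z. \<forall>z\<in>abelian_cycles2 G. \<chi> z = \<one>\<^bsub>?Q\<^esub>}"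
  proof -
    have eval_hom: "frag_eval ?Q f \<in> hom ?Z ?Q" if "f \<in> carrier (cochains2 G ?Q)" for f
    proof -
      have "frag_eval ?Q f \<in> hom ?F ?Q"
        by (rule rat_mod_int.frag_eval_hom[OF fun_if[OF that]])
      then show ?thesis
        using Z_sub by (auto simp: hom_def Pi_iff)
    qed
    have B_iff: "f \<in> ?B \<longleftrightarrow> (\<forall>z\<in>abelian_cycles2 G. frag_eval ?Q f z = \<one>\<^bsub>?Q\<^esub>)"
      if f: "f \<in> carrier (cochains2 G ?Q)" for f
    proof -
      have "restrict f (A \<times> A) \<in> coboundaries2 (G\<lparr>carrier := A\<rparr>) ?Q \<longleftrightarrow>
          (\<forall>z\<in>cycles2 (G\<lparr>carrier := A\<rparr>). frag_eval ?Q f z = \<one>\<^bsub>?Q\<^esub>)"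
        if A: "A \<in> abelian_subgroups G" for A
      proof -
        let ?H = "G\<lparr>carrier := A\<rparr>"
        have A': "subgroup A G" using A by (simp add: abelian_subgroups_def)
        interpret H: group ?H by (rule subgroup_imp_group[OF A'])
        have sub: "A \<subseteq> carrier G" using A' by (rule subgroup.subset)
        have fin: "finite (carrier ?H)" using sub assms finite_subset by auto
        have res: "restrict f (A \<times> A) \<in> carrier (cochains2 ?H ?Q)"
          using f sub by (auto simp: cochains2_def)
        have "frag_eval ?Q (restrict f (A \<times> A)) z = frag_eval ?Q f z" if "z \<in> cycles2 ?H" for z
          using that sub fun_if[OF f]
          by (intro frag_eval_cong)
            (auto simp: cycles2_iff rat_mod_int.is_group rat_mod_int.comm_monoid_axioms Pi_iff)
        then show ?thesis
          using H.coboundaries2_iff[OF fin comm_group_rat_mod_int divisible_rat_mod_int] res by auto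
      qed
      then show ?thesis
        using f cocycles2_iff[OF comm_group_rat_mod_int, of f]
          hom_trivial_on_abelian_cycles2_iff[OF rat_mod_int.is_group eval_hom[OF f]]
        by auto
    qed
    show ?thesis
    proof (intro equalityI[OF image_subsetI subsetI] CollectI conjI)
      fix f assume f: "f \<in> ?B"
      show "?X f \<in> characters ?Z"
        using restrict_in_characters[OF eval_hom[OF cochain_if[OF f]] Z.is_group] by simp
      show "\<forall>z\<in>abelian_cycles2 G. ?X f z = \<one>\<^bsub>?Q\<^esub>"
        using f B_iff[OF cochain_if[OF f]] abelian_cycles2_subset by auto
    next
      fix \<chi> assume \<chi>: "\<chi> \<in> {\<chi> \<in> characters ?Z. \<forall>z\<in>abelian_cycles2 G. \<chi> z = \<one>\<^bsub>?Q\<^esub>}"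
      then have "\<chi> \<in> hom ?Z ?Q" by (simp add: characters_def)
      then obtain \<psi> where \<psi>: "\<psi> \<in> hom ?F ?Q" "\<And>z. z \<in> cycles2 G \<Longrightarrow> \<psi> z = \<chi> z"
        using hom_extend_free_Abelian_group[OF _ comm_group_rat_mod_int divisible_rat_mod_int subgroup_cycles2]
          assms by (metis finite_cartesian_product)
      let ?f = "\<lambda>x\<in>?GG. \<psi> (frag_of x)"
      have f: "?f \<in> carrier (cochains2 G ?Q)"
        using hom_in_carrier[OF \<psi>(1)] by (auto simp: cochains2_def)
      have eval: "frag_eval ?Q ?f z = \<psi> z" if "Poly_Mapping.keys z \<subseteq> ?GG" for z
        using fun_if[OF f]
        by (intro hom_free_Abelian_group_eqI[OF rat_mod_int.is_group rat_mod_int.frag_eval_hom[OF fun_if[OF f]] \<psi>(1) _ that])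
          (auto simp: Pi_iff)
      have "?X ?f = \<chi>"
        using \<chi> \<psi>(2) eval Z_sub
        by (intro extensionalityI[of _ "cycles2 G"]) (auto simp: characters_def)
      moreover have "?f \<in> ?B"
        unfolding B_iff[OF f] using \<chi> \<psi>(2) eval Z_sub abelian_cycles2_subset by auto
      ultimately show "\<chi> \<in> ?X ` ?B" by blast
    qed
  qed
  finally show ?thesis .
qed

section \<open>Finiteness of the second homology group\<close>

text \<open>
  Summing \<open>\<partial>[x|h|k] = [h|k] - [xh|k] + [x|hk] - [x|h]\<close> over \<open>x \<in> G\<close>, where \<open>xh\<close> also runs through \<open>G\<close>,
  gives \<open>|G| [h|k]\<close> minus the sum over \<open>x\<close> of \<open>[x|k] - [x|hk] + [x|h]\<close>. The second term is a linear
  function of \<open>\<partial>[h|k]\<close>, so it disappears for cycles.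
\<close>

lemma (in group) order_times_cycle_is_boundary:
  assumes fin: "finite (carrier G)" and z: "z \<in> cycles2 G"
  shows "frag_cmul (int (order G)) z \<in> boundaries2 G"
proof -
  let ?N = "int (order G)"
  let ?F = "\<lambda>X. free_Abelian_group X"
  \<comment> \<open>\<open>T\<close> sends \<open>[h|k]\<close> to the sum of all \<open>[x|h|k]\<close>, and \<open>r\<close> sends \<open>[k]\<close> to the sum of all \<open>[x|k]\<close>.\<close>
  define T where "T = frag_extend (\<lambda>(h :: 'a, k :: 'a). \<Sum>x\<in>carrier G. frag_of (x, h, k))"
  define r where "r = frag_extend (\<lambda>k. \<Sum>x\<in>carrier G. frag_of (x, k :: 'a))"
  have r_eq: "r (frag_of k) = (\<Sum>x\<in>carrier G. frag_of (x, k))" for k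
    by (simp add: r_def)
  have keys: "Poly_Mapping.keys z \<subseteq> carrier G \<times> carrier G" using z by (simp add: cycles2_iff)
  have bd3_sum: "bar_boundary3 G (\<Sum>x\<in>A. frag_of (f x)) = (\<Sum>x\<in>A. bar_boundary3 G (frag_of (f x)))"
    if "finite A" for A and f :: "'a \<Rightarrow> 'a \<times> 'a \<times> 'a"
    using that by (induction A rule: finite_induct) (simp_all add: bar_boundary3_def frag_extend_add)
  have "bar_boundary3 G (T z) = frag_cmul ?N z - r (bar_boundary2 G z)"
    using keys
  proof (induction rule: free_Abelian_group_induct[consumes 1, case_names zero diff gen])
    case zero
    show ?case by (simp add: T_def r_def bar_boundary3_def bar_boundary2_def)
  next
    case (diff x y)
    have "frag_cmul ?N (x - y) = frag_cmul ?N x - frag_cmul ?N y"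
      by (rule poly_mapping_eqI) (simp add: lookup_minus right_diff_distrib)
    with diff show ?case
      by (simp add: T_def r_def bar_boundary3_def bar_boundary2_def frag_extend_diff)
  next
    case (gen a)
    then obtain h k where a: "a = (h, k)" "h \<in> carrier G" "k \<in> carrier G" by auto
    have "(\<Sum>x\<in>carrier G. frag_of (x \<otimes> h, k)) = (\<Sum>x\<in>carrier G. frag_of (x, k))"
    proof (rule sum.reindex_bij_betw)
      show "bij_betw (\<lambda>x. x \<otimes> h) (carrier G) (carrier G)"
        using a(2) by (intro bij_betwI[where g = "\<lambda>x. x \<otimes> inv h"]) (auto simp: m_assoc)
    qed
    moreover have "bar_boundary3 G (T (frag_of a)) = (\<Sum>x\<in>carrier G. frag_of (h, k)) - (\<Sum>x\<in>carrier G. frag_of (x \<otimes> h, k))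
        + (\<Sum>x\<in>carrier G. frag_of (x, h \<otimes> k)) - (\<Sum>x\<in>carrier G. frag_of (x, h))"
      by (simp add: T_def a bd3_sum[OF fin])
        (simp add: bar_boundary3_def sum_subtractf sum.distrib)
    moreover have "(\<Sum>x\<in>A. frag_of (h, k)) = frag_cmul (int (card A)) (frag_of (h, k))"
      if "finite A" for A :: "'a set"
      using that by (induction A rule: finite_induct) (simp_all add: frag_cmul_distrib)
    from this[OF fin] have "(\<Sum>x\<in>carrier G. frag_of (h, k)) = frag_cmul ?N (frag_of (h, k))"
      by (simp add: order_def)
    ultimately show ?case
      by (simp add: a bar_boundary2_def r_def frag_extend_add frag_extend_diff)
  qed
  moreover have "bar_boundary2 G z = 0" "r 0 = 0"
    using z by (simp_all add: cycles2_iff r_def)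
  moreover have "Poly_Mapping.keys (T z) \<subseteq> carrier G \<times> carrier G \<times> carrier G"
  proof -
    have "Poly_Mapping.keys (\<Sum>x\<in>carrier G. frag_of (x, h, k)) \<subseteq> carrier G \<times> carrier G \<times> carrier G"
      if "h \<in> carrier G" "k \<in> carrier G" for h k
      using that keys_sum[of "\<lambda>x. frag_of (x, h, k)" "carrier G"] by auto
    then have "T \<in> hom (?F (carrier G \<times> carrier G)) (?F (carrier G \<times> carrier G \<times> carrier G))"
      unfolding T_def by (intro frag_extend_hom) auto
    from hom_in_carrier[OF this, of z] keys show ?thesis by simp
  qed
  ultimately show ?thesis
    unfolding boundaries2_def by force
qed

text \<open>
  The class of a cycle is determined by its coefficients modulo \<open>|G|\<close>: a difference of cycles that is
  divisible by \<open>|G|\<close> as a chain is \<open>|G|\<close> times a cycle, because the chain groups are torsion-free.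
\<close>

lemma (in group) finite_homology2:
  assumes "finite (carrier G)"
  shows "finite (carrier (homology2 G))"
proof -
  let ?GG = "carrier G \<times> carrier G" and ?N = "int (order G)"
  let ?F = "free_Abelian_group ?GG"
  let ?cl = "\<lambda>z. boundaries2 G #>\<^bsub>?F\<^esub> z"
  let ?m = "\<lambda>z. \<lambda>x\<in>?GG. poly_mapping.lookup z x mod ?N"
  interpret F: group ?F by simp
  have N: "?N > 0" using assms by (simp add: order_gt_0_iff_finite)
  have "?m ` cycles2 G \<subseteq> ?GG \<rightarrow>\<^sub>E {0..<?N}"
    using N by (intro image_subsetI PiE_I) (simp_all del: mem_Sigma_iff)
  then have fin: "finite (?m ` cycles2 G)"
    by (rule finite_subset) (use assms in \<open>simp add: finite_PiE\<close>)
  have "?cl y = ?cl z" if yz: "y \<in> cycles2 G" "z \<in> cycles2 G" and m: "?m y = ?m z" for y z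
  proof -
    have keys: "Poly_Mapping.keys y \<subseteq> ?GG" "Poly_Mapping.keys z \<subseteq> ?GG"
      using yz by (simp_all add: cycles2_iff)
    \<comment> \<open>The chain \<open>(z - y) / |G|\<close>.\<close>
    define w where "w = Poly_Mapping.map (\<lambda>c. c div ?N) (z - y)"
    have lookup: "poly_mapping.lookup z x - poly_mapping.lookup y x = ?N * poly_mapping.lookup w x" for x
    proof (cases "x \<in> ?GG")
      case True
      then have "?N dvd poly_mapping.lookup z x - poly_mapping.lookup y x"
        using fun_cong[OF m, of x] by (simp add: mod_eq_dvd_iff[symmetric])
      then show ?thesis
        by (simp add: w_def Poly_Mapping.map.rep_eq lookup_minus when_def)
    next
      case False
      then have "poly_mapping.lookup z x = 0" "poly_mapping.lookup y x = 0"
        using keys by (auto simp: in_keys_iff)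
      then show ?thesis
        by (simp add: w_def Poly_Mapping.map.rep_eq lookup_minus)
    qed
    then have zy: "z - y = frag_cmul ?N w"
      by (intro poly_mapping_eqI) (simp add: lookup_minus)
    have "Poly_Mapping.keys (frag_cmul ?N w) \<subseteq> ?GG"
      using keys keys_diff[of z y] by (auto simp flip: zy)
    then have keys_w: "Poly_Mapping.keys w \<subseteq> ?GG"
      using N by auto
    have "frag_cmul ?N (bar_boundary2 G w) = bar_boundary2 G (z - y)"
      by (simp add: zy bar_boundary2_def frag_extend_cmul)
    also have "\<dots> = 0"
      using yz by (simp add: cycles2_iff) (simp add: bar_boundary2_def frag_extend_diff)
    finally have "w \<in> cycles2 G"
      using N keys_w by (simp add: cycles2_iff)
    then have "z - y \<in> boundaries2 G"
      unfolding zy by (rule order_times_cycle_is_boundary[OF assms])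
    then show ?thesis
      using F.r_coset_eq_iff[OF subgroup_boundaries2, of y z] keys by simp
  qed
  from finite_image_if_factors[of ?m, OF fin this] have "finite (?cl ` cycles2 G)" .
  then show ?thesis
    by (simp add: homology2_def carrier_FactGroup r_coset_def)
qed

text \<open>
  Finiteness is inherited from \<open>H\<^sub>2(G)\<close>, which has \<open>Z/M\<close> as a quotient.
\<close>

lemma (in group) classes_mod_abelian_cycles2:
  assumes "finite (carrier G)"
  shows finite_classes:
      "finite ((\<lambda>z. abelian_cycles2 G #>\<^bsub>free_Abelian_group (carrier G \<times> carrier G)\<^esub> z) ` cycles2 G)"
    and b0_eq_card_classes: "b0 G = card ((\<lambda>z. abelian_cycles2 G #>\<^bsub>free_Abelian_group (carrier G \<times> carrier G)\<^esub> z) ` cycles2 G)"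
proof -
  let ?F = "free_Abelian_group (carrier G \<times> carrier G)"
  let ?Z = "?F\<lparr>carrier := cycles2 G\<rparr>"
  let ?clB = "\<lambda>z. boundaries2 G #>\<^bsub>?F\<^esub> z" and ?clM = "\<lambda>z. abelian_cycles2 G #>\<^bsub>?F\<^esub> z"
  interpret F: comm_group ?F by (rule abelian_free_Abelian_group)
  interpret Z: comm_group ?Z by (rule F.comm_group_subgroup[OF subgroup_cycles2])
  have M: "subgroup (abelian_cycles2 G) ?Z"
    using F.subgroup_incl[OF subgroup_abelian_cycles2 subgroup_cycles2 abelian_cycles2_subset] .
  have carrier: "carrier (?Z Mod abelian_cycles2 G) = ?clM ` cycles2 G"
    by (simp add: carrier_FactGroup r_coset_def)
  have fin: "finite (?clB ` cycles2 G)"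
    using finite_homology2[OF assms] by (simp add: homology2_def carrier_FactGroup r_coset_def)
  have B_M: "boundaries2 G \<subseteq> abelian_cycles2 G"
    unfolding abelian_cycles2_def by (auto intro: generate.incl)
  have "?clM y = ?clM z" if "y \<in> cycles2 G" "z \<in> cycles2 G" "?clB y = ?clB z" for y z
  proof -
    have "y \<in> carrier ?F" "z \<in> carrier ?F"
      using that subgroup.subset[OF subgroup_cycles2] by blast+
    then show ?thesis
      using that(3) B_M F.r_coset_eq_iff[OF subgroup_boundaries2, of y z]
        F.r_coset_eq_iff[OF subgroup_abelian_cycles2, of y z] by blast
  qed
  then show fin_M: "finite (?clM ` cycles2 G)"
    by (rule finite_image_if_factors[OF fin])
  then have "card (characters (?Z Mod abelian_cycles2 G)) = card (?clM ` cycles2 G)"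
    using card_characters[OF Z.abelian_FactGroup[OF M]] carrier by simp
  then show "b0 G = card (?clM ` cycles2 G)"
    using b0_eq_card_characters[OF assms] card_characters_trivial_on[OF Z.comm_group_axioms M] by simp
qed

section \<open>Central extensions and their connecting maps\<close>

lemma (in comm_group) coboundary_rearrange:
  "x \<in> carrier G \<Longrightarrow> y \<in> carrier G \<Longrightarrow> z \<in> carrier G \<Longrightarrow> (y \<otimes> inv z \<otimes> x) \<otimes> \<one> = x \<otimes> y \<otimes> inv z"
  by (simp add: m_ac)

lemma (in comm_group) cocycle_rearrange:
  "a \<in> carrier G \<Longrightarrow> b \<in> carrier G \<Longrightarrow> c \<in> carrier G \<Longrightarrow> d \<in> carrier G \<Longrightarrow>
    a \<otimes> inv b \<otimes> c \<otimes> inv d = (a \<otimes> c) \<otimes> inv (d \<otimes> b)"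
  by (simp add: inv_mult m_ac)

lemma (in comm_group) solve_coboundary:
  assumes "x \<in> carrier G" "a \<in> carrier G" "b \<in> carrier G" "c \<in> carrier G" "f \<in> carrier G"
    and eq: "x \<otimes> c = a \<otimes> b \<otimes> f"
  shows "x = (b \<otimes> inv c \<otimes> a) \<otimes> f"
proof -
  have "x = (x \<otimes> c) \<otimes> inv c"
    using assms(1-5) by (simp add: m_assoc)
  also have "\<dots> = (b \<otimes> inv c \<otimes> a) \<otimes> f"
    unfolding eq using assms(1-5) by (simp add: m_ac)
  finally show ?thesis .
qed

text \<open>
  This is the bookkeeping of factor set values in the computation of a commutator in a central extension.
\<close>

lemma (in comm_group) commutator_factors_cancel:
  assumes "a \<in> carrier G" "b \<in> carrier G" "d \<in> carrier G" "k \<in> carrier G" "l \<in> carrier G"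
  shows "(a \<otimes> inv b \<otimes> inv d) \<otimes> (k \<otimes> l \<otimes> b) \<otimes> d = k \<otimes> l \<otimes> a"
proof -
  have "(a \<otimes> inv b \<otimes> inv d) \<otimes> (k \<otimes> l \<otimes> b) \<otimes> d = (k \<otimes> l \<otimes> a) \<otimes> (b \<otimes> inv b) \<otimes> (d \<otimes> inv d)"
    using assms by (simp add: m_ac del: r_inv l_inv Units_r_inv Units_l_inv)
  with assms show ?thesis by simp
qed

text \<open>
  The section \<open>s\<close> is a parameter because the connecting map on chains depends on it; on cycles it does
  not, by naturality.
\<close>

locale central_extension = E: group E + G: group G for E (structure) and G +
  fixes \<beta> s
  assumes hom: "\<beta> \<in> hom E G"
    and central: "k \<in> kernel E G \<beta> \<Longrightarrow> x \<in> carrier E \<Longrightarrow> k \<otimes> x = x \<otimes> k"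
    and s_closed: "g \<in> carrier G \<Longrightarrow> s g \<in> carrier E"
    and s_section: "g \<in> carrier G \<Longrightarrow> \<beta> (s g) = g"
begin

sublocale hom: group_hom E G \<beta>
  using hom by unfold_locales

abbreviation "K \<equiv> kernel E G \<beta>"
abbreviation "KK \<equiv> E\<lparr>carrier := K\<rparr>"

lemma K_iff: "x \<in> K \<longleftrightarrow> x \<in> carrier E \<and> \<beta> x = \<one>\<^bsub>G\<^esub>"
  by (simp add: kernel_def)

lemma K_closed [simp]: "x \<in> K \<Longrightarrow> x \<in> carrier E"
  by (simp add: K_iff)

declare s_closed [simp] s_section [simp]

lemma comm_group_K: "comm_group KK"
  by (intro group.group_comm_groupI E.subgroup_imp_group hom.subgroup_kernel) (simp add: central)

sublocale K: comm_group KK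
  by (rule comm_group_K)

lemma inv_K [simp]: "x \<in> K \<Longrightarrow> inv\<^bsub>KK\<^esub> x = inv x"
  by (intro E.m_inv_consistent hom.subgroup_kernel)

fun factor where
  "factor (g, h) = s g \<otimes> s h \<otimes> inv s (g \<otimes>\<^bsub>G\<^esub> h)"

lemma factor_in_K: "g \<in> carrier G \<Longrightarrow> h \<in> carrier G \<Longrightarrow> factor (g, h) \<in> K"
  by (simp add: K_iff del: K_closed)

declare factor.simps [simp del]

lemma factor_closed [simp]: "g \<in> carrier G \<Longrightarrow> h \<in> carrier G \<Longrightarrow> factor (g, h) \<in> carrier E"
  by (simp add: factor_in_K)

lemma factor_fun: "factor \<in> carrier G \<times> carrier G \<rightarrow> carrier KK"
  using factor_in_K by auto

lemma s_mult: "g \<in> carrier G \<Longrightarrow> h \<in> carrier G \<Longrightarrow> s g \<otimes> s h = factor (g, h) \<otimes> s (g \<otimes>\<^bsub>G\<^esub> h)"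
  by (simp add: factor.simps E.m_assoc)

definition connecting where "connecting z = frag_eval KK factor z"

lemma connecting_closed: "Poly_Mapping.keys z \<subseteq> carrier G \<times> carrier G \<Longrightarrow> connecting z \<in> K"
  unfolding connecting_def using K.frag_eval_closed[OF factor_fun] by simp

lemma connecting_frag_of: "g \<in> carrier G \<Longrightarrow> h \<in> carrier G \<Longrightarrow> connecting (frag_of (g, h)) = factor (g, h)"
  unfolding connecting_def using factor_in_K by simp

lemma connecting_add: "Poly_Mapping.keys y \<subseteq> carrier G \<times> carrier G \<Longrightarrow>
    Poly_Mapping.keys z \<subseteq> carrier G \<times> carrier G \<Longrightarrow> connecting (y + z) = connecting y \<otimes> connecting z"
  unfolding connecting_def using K.frag_eval_add[OF factor_fun] by simp

lemma connecting_minus: "Poly_Mapping.keys z \<subseteq> carrier G \<times> carrier G \<Longrightarrow> connecting (- z) = inv connecting z"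
  using K.frag_eval_minus[OF factor_fun, of z] connecting_closed[of z] by (simp add: connecting_def)

lemma connecting_diff: "Poly_Mapping.keys y \<subseteq> carrier G \<times> carrier G \<Longrightarrow>
    Poly_Mapping.keys z \<subseteq> carrier G \<times> carrier G \<Longrightarrow> connecting (y - z) = connecting y \<otimes> inv connecting z"
  using connecting_add[of y "- z"] by (simp add: connecting_minus)

text \<open>
  Comparing the two ways to multiply \<open>s(g) s(h) s(k)\<close> shows that the factor set is a cocycle.
\<close>

lemma connecting_boundaries2:
  assumes "z \<in> boundaries2 G"
  shows "connecting z = \<one>"
proof -
  have "coboundary2 G KK factor (g, h, k) = \<one>\<^bsub>KK\<^esub>"
    if gk: "g \<in> carrier G" "h \<in> carrier G" "k \<in> carrier G" for g h k
  proof -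
    let ?f = "\<lambda>g h. factor (g, h)"
    have f: "?f a b \<in> K" "?f a b \<in> carrier E" if "a \<in> carrier G" "b \<in> carrier G" for a b
      using factor_in_K[OF that] by simp_all
    have "(?f g h \<otimes> ?f (g \<otimes>\<^bsub>G\<^esub> h) k) \<otimes> s (g \<otimes>\<^bsub>G\<^esub> h \<otimes>\<^bsub>G\<^esub> k) = ?f g h \<otimes> (?f (g \<otimes>\<^bsub>G\<^esub> h) k \<otimes> s (g \<otimes>\<^bsub>G\<^esub> h \<otimes>\<^bsub>G\<^esub> k))"
      using gk by (simp add: E.m_assoc)
    also have "\<dots> = ?f g h \<otimes> (s (g \<otimes>\<^bsub>G\<^esub> h) \<otimes> s k)"
      using gk by (simp add: s_mult)
    also have "\<dots> = (?f g h \<otimes> s (g \<otimes>\<^bsub>G\<^esub> h)) \<otimes> s k"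
      using gk by (simp add: E.m_assoc)
    also have "\<dots> = (s g \<otimes> s h) \<otimes> s k"
      using gk by (simp add: s_mult)
    also have "\<dots> = s g \<otimes> (s h \<otimes> s k)"
      using gk by (simp add: E.m_assoc)
    also have "\<dots> = (s g \<otimes> ?f h k) \<otimes> s (h \<otimes>\<^bsub>G\<^esub> k)"
      using gk by (simp add: s_mult E.m_assoc)
    also have "\<dots> = (?f h k \<otimes> s g) \<otimes> s (h \<otimes>\<^bsub>G\<^esub> k)"
      using gk central[OF f(1), of h k "s g"] by simp
    also have "\<dots> = ?f h k \<otimes> (s g \<otimes> s (h \<otimes>\<^bsub>G\<^esub> k))"
      using gk by (simp add: E.m_assoc)
    also have "\<dots> = (?f h k \<otimes> ?f g (h \<otimes>\<^bsub>G\<^esub> k)) \<otimes> s (g \<otimes>\<^bsub>G\<^esub> h \<otimes>\<^bsub>G\<^esub> k)"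
      using gk by (simp add: s_mult E.m_assoc G.m_assoc)
    finally have *: "?f g h \<otimes> ?f (g \<otimes>\<^bsub>G\<^esub> h) k = ?f h k \<otimes> ?f g (h \<otimes>\<^bsub>G\<^esub> k)"
      using gk f by simp
    have "coboundary2 G KK factor (g, h, k) =
        (?f h k \<otimes>\<^bsub>KK\<^esub> ?f g (h \<otimes>\<^bsub>G\<^esub> k)) \<otimes>\<^bsub>KK\<^esub> inv\<^bsub>KK\<^esub> (?f g h \<otimes>\<^bsub>KK\<^esub> ?f (g \<otimes>\<^bsub>G\<^esub> h) k)"
      unfolding coboundary2_def using gk f by (simp add: K.cocycle_rearrange[simplified] del: inv_K)
    also have "\<dots> = \<one>\<^bsub>KK\<^esub>"
      using gk f * K.r_inv[of "?f h k \<otimes> ?f g (h \<otimes>\<^bsub>G\<^esub> k)"] K.m_closed[of "?f h k" "?f g (h \<otimes>\<^bsub>G\<^esub> k)"]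
      by (simp del: inv_K)
    finally show ?thesis .
  qed
  then show ?thesis
    using G.cocycle_condition_iff[OF comm_group_K factor_fun] assms by (simp add: connecting_def)
qed

text \<open>
  Coboundaries vanish on cycles, so the factor set may be replaced by any \<open>c\<close> that differs from it by
  the coboundary of some \<open>t\<close> with values in an abelian group. This carries three arguments: with \<open>c\<close> trivial, the image of the connecting
  map lies in the commutator subgroup, and the connecting map kills the cycles of an abelian subgroup
  with commuting lifts; with \<open>c\<close> the factor set of another extension, it gives naturality.
\<close>

lemma hom_connecting_eq_frag_eval:
  assumes D: "comm_group D" and \<theta>: "\<theta> \<in> hom KK D" and A: "subgroup A G"
    and t: "t \<in> A \<rightarrow> carrier D" and c: "c \<in> A \<times> A \<rightarrow> carrier D"
    and eq: "\<And>g h. g \<in> A \<Longrightarrow> h \<in> A \<Longrightarrow>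
      \<theta> (factor (g, h)) = (t h \<otimes>\<^bsub>D\<^esub> inv\<^bsub>D\<^esub> t (g \<otimes>\<^bsub>G\<^esub> h) \<otimes>\<^bsub>D\<^esub> t g) \<otimes>\<^bsub>D\<^esub> c (g, h)"
    and z: "z \<in> cycles2 (G\<lparr>carrier := A\<rparr>)"
  shows "\<theta> (connecting z) = frag_eval D c z"
proof -
  interpret D: comm_group D by fact
  interpret A: group "G\<lparr>carrier := A\<rparr>"
    using A by (rule G.subgroup_imp_group)
  have sub: "A \<subseteq> carrier G" using A by (rule subgroup.subset)
  have keys: "Poly_Mapping.keys z \<subseteq> A \<times> A" using z by (simp add: cycles2_iff)
  have factor_A: "factor \<in> A \<times> A \<rightarrow> carrier KK"
    using factor_fun sub by auto
  let ?d = "\<lambda>(g, h). t h \<otimes>\<^bsub>D\<^esub> inv\<^bsub>D\<^esub> t (g \<otimes>\<^bsub>G\<^esub> h) \<otimes>\<^bsub>D\<^esub> t g"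
  have t': "t g \<in> carrier D" if "g \<in> A" for g using t that by auto
  have d: "?d \<in> A \<times> A \<rightarrow> carrier D"
    using t' subgroup.m_closed[OF A] by auto
  have "\<theta> (connecting z) = frag_eval D (\<lambda>x. \<theta> (factor x)) z"
    unfolding connecting_def by (rule K.hom_frag_eval[OF D \<theta> factor_A keys])
  also have "\<dots> = frag_eval D (\<lambda>x. ?d x \<otimes>\<^bsub>D\<^esub> c x) z"
  proof (rule frag_eval_cong)
    fix x assume x: "x \<in> Poly_Mapping.keys z"
    then obtain g h where "x = (g, h)" "g \<in> A" "h \<in> A" using keys by auto
    then show "\<theta> (factor x) = ?d x \<otimes>\<^bsub>D\<^esub> c x" using eq by simp
    show "?d x \<otimes>\<^bsub>D\<^esub> c x \<in> carrier D" using d c x keys by blast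
  qed (simp_all add: D.comm_monoid_axioms D.is_group)
  also have "\<dots> = frag_eval D ?d z \<otimes>\<^bsub>D\<^esub> frag_eval D c z"
    by (rule D.frag_eval_mult_left[OF d c keys])
  also have "frag_eval D ?d z = frag_eval D t (bar_boundary2 (G\<lparr>carrier := A\<rparr>) z)"
    using t keys by (intro A.frag_eval_coboundary1[OF D]) auto
  also have "\<dots> = \<one>\<^bsub>D\<^esub>"
    using z by (simp add: cycles2_iff) (simp add: frag_eval_def)
  finally show ?thesis
    using D.frag_eval_closed[OF c keys] by simp
qed

text \<open>
  Modulo commutators, the factor set \<open>s(g) s(h) s(gh)\<^sup>-\<^sup>1\<close> is the coboundary of \<open>s\<close>.
\<close>

lemma connecting_cycles2_in_derived:
  assumes "z \<in> cycles2 G"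
  shows "connecting z \<in> derived E (carrier E)"
proof -
  let ?N = "derived E (carrier E)"
  interpret N: normal ?N E by (rule E.derived_self_is_normal)
  interpret D: comm_group "E Mod ?N" by (rule E.derived_quot_is_comm_group)
  interpret cl: group_hom E "E Mod ?N" "\<lambda>x. ?N #> x"
    using N.r_coset_hom_Mod D.is_group by unfold_locales
  have "(\<lambda>x. ?N #> x) \<in> hom KK (E Mod ?N)"
    using cl.hom_closed cl.hom_mult by (intro homI) (simp_all del: mult_FactGroup)
  moreover have "?N #> factor (g, h) = ((?N #> s h) \<otimes>\<^bsub>E Mod ?N\<^esub> inv\<^bsub>E Mod ?N\<^esub> (?N #> s (g \<otimes>\<^bsub>G\<^esub> h)) \<otimes>\<^bsub>E Mod ?N\<^esub> (?N #> s g))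
      \<otimes>\<^bsub>E Mod ?N\<^esub> \<one>\<^bsub>E Mod ?N\<^esub>" if "g \<in> carrier G" "h \<in> carrier G" for g h
    using that D.m_ac cl.hom_closed D.inv_closed by (simp add: factor.simps del: mult_FactGroup one_FactGroup)
  ultimately have "?N #> connecting z = frag_eval (E Mod ?N) (\<lambda>_. \<one>\<^bsub>E Mod ?N\<^esub>) z"
    using assms cl.hom_closed D.one_closed
    by (intro hom_connecting_eq_frag_eval[OF D.comm_group_axioms, where A = "carrier G" and t = "\<lambda>g. ?N #> s g"])
      (auto simp: G.subgroup_self)
  also have "\<dots> = \<one>\<^bsub>E Mod ?N\<^esub>"
    by (rule D.frag_eval_one_left)
  also have "\<dots> = ?N"
    by (rule one_FactGroup)
  finally show ?thesis
    by (rule E.coset_join1) (use connecting_closed[of z] assms in \<open>simp_all add: cycles2_iff N.subgroup_axioms\<close>)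
qed

text \<open>
  The preimage of \<open>A\<close> is generated by central elements and commuting lifts, so it is abelian. It contains
  \<open>s\<close> on \<open>A\<close>, which makes the factor set a coboundary there.
\<close>

lemma connecting_abelian_cycles2:
  assumes A: "A \<in> abelian_subgroups G"
    and comm: "\<And>g h. g \<in> A \<Longrightarrow> h \<in> A \<Longrightarrow> s g \<otimes> s h = s h \<otimes> s g"
    and z: "z \<in> cycles2 (G\<lparr>carrier := A\<rparr>)"
  shows "connecting z = \<one>"
proof -
  have A': "subgroup A G" using A by (simp add: abelian_subgroups_def)
  have sub: "g \<in> carrier G" if "g \<in> A" for g using subgroup.subset[OF A'] that by blast
  \<comment> \<open>The preimage of \<open>A\<close>.\<close>
  let ?P = "{x \<in> carrier E. \<beta> x \<in> A}"
  have P: "subgroup ?P E"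
    using A' by (intro E.subgroupI) (auto intro: subgroup.m_closed subgroup.m_inv_closed simp: exI[of _ "\<one>"] subgroup.one_closed)
  have "comm_group (E\<lparr>carrier := ?P\<rparr>)"
  proof (rule group.group_comm_groupI[OF E.subgroup_imp_group[OF P]], clarsimp)
    fix x y assume xy: "x \<in> carrier E" "\<beta> x \<in> A" "y \<in> carrier E" "\<beta> y \<in> A"
    define k l where "k = x \<otimes> inv s (\<beta> x)" and "l = y \<otimes> inv s (\<beta> y)"
    have kl: "k \<in> K" "l \<in> K" "x = k \<otimes> s (\<beta> x)" "y = l \<otimes> s (\<beta> y)"
      using xy sub by (simp_all add: k_def l_def K_iff E.m_assoc del: K_closed)
    have "(k \<otimes> s (\<beta> x)) \<otimes> (l \<otimes> s (\<beta> y)) = (k \<otimes> l) \<otimes> (s (\<beta> x) \<otimes> s (\<beta> y))"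
      using kl(1,2) xy central[OF kl(2), of "s (\<beta> x)"] sub by (metis E.m_assoc E.m_closed K_closed s_closed)
    also have "\<dots> = (l \<otimes> k) \<otimes> (s (\<beta> y) \<otimes> s (\<beta> x))"
      using kl(1,2) xy comm central[OF kl(1), of l] by simp
    also have "\<dots> = (l \<otimes> s (\<beta> y)) \<otimes> (k \<otimes> s (\<beta> x))"
      using kl(1,2) xy central[OF kl(1), of "s (\<beta> y)"] sub by (metis E.m_assoc E.m_closed K_closed s_closed)
    finally show "x \<otimes> y = y \<otimes> x"
      using kl(3,4) by metis
  qed
  then interpret P: comm_group "E\<lparr>carrier := ?P\<rparr>" .
  have sP: "s g \<in> ?P" if "g \<in> A" for g using that sub by simp
  have inv_P: "inv\<^bsub>E\<lparr>carrier := ?P\<rparr>\<^esub> x = inv x" if "x \<in> ?P" for x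
    using E.m_inv_consistent[OF P that] .
  have "(\<lambda>x. x) \<in> hom KK (E\<lparr>carrier := ?P\<rparr>)"
    using subgroup.one_closed[OF A'] by (auto simp: hom_def K_iff simp del: K_closed)
  moreover have "factor (g, h) = (s h \<otimes>\<^bsub>E\<lparr>carrier := ?P\<rparr>\<^esub> inv\<^bsub>E\<lparr>carrier := ?P\<rparr>\<^esub> s (g \<otimes>\<^bsub>G\<^esub> h)
      \<otimes>\<^bsub>E\<lparr>carrier := ?P\<rparr>\<^esub> s g) \<otimes>\<^bsub>E\<lparr>carrier := ?P\<rparr>\<^esub> \<one>\<^bsub>E\<lparr>carrier := ?P\<rparr>\<^esub>" if "g \<in> A" "h \<in> A" for g h
  proof -
    have "s g \<in> ?P" "s h \<in> ?P" "s (g \<otimes>\<^bsub>G\<^esub> h) \<in> ?P"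
      using that sP subgroup.m_closed[OF A'] by blast+
    then have "(s h \<otimes>\<^bsub>E\<lparr>carrier := ?P\<rparr>\<^esub> inv\<^bsub>E\<lparr>carrier := ?P\<rparr>\<^esub> s (g \<otimes>\<^bsub>G\<^esub> h)
      \<otimes>\<^bsub>E\<lparr>carrier := ?P\<rparr>\<^esub> s g) \<otimes>\<^bsub>E\<lparr>carrier := ?P\<rparr>\<^esub> \<one>\<^bsub>E\<lparr>carrier := ?P\<rparr>\<^esub> =
      s g \<otimes>\<^bsub>E\<lparr>carrier := ?P\<rparr>\<^esub> s h \<otimes>\<^bsub>E\<lparr>carrier := ?P\<rparr>\<^esub> inv\<^bsub>E\<lparr>carrier := ?P\<rparr>\<^esub> s (g \<otimes>\<^bsub>G\<^esub> h)"
      by (intro P.coboundary_rearrange) simp_all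
    then show ?thesis
      using \<open>s (g \<otimes>\<^bsub>G\<^esub> h) \<in> ?P\<close> by (simp add: inv_P factor.simps)
  qed
  ultimately have "connecting z = frag_eval (E\<lparr>carrier := ?P\<rparr>) (\<lambda>_. \<one>\<^bsub>E\<lparr>carrier := ?P\<rparr>\<^esub>) z"
    using sP P.one_closed
    by (intro hom_connecting_eq_frag_eval[OF P.comm_group_axioms, where A = A and t = s and \<theta> = "\<lambda>x. x", OF _ A' _ _ _ z]) auto
  also have "\<dots> = \<one>"
    by (simp only: P.frag_eval_one_left) simp
  finally show ?thesis .
qed

text \<open>
  A chain \<open>z\<close> that expresses \<open>u\<close> as \<open>connecting z\<close> times the standard lift of its image. If the image of \<open>u\<close> is
  trivial, the boundary condition makes \<open>z\<close> a cycle up to the correction \<open>[1|1]\<close> that accounts for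
  \<open>s(1)\<close>. Unlike the elements of \<open>K \<inter> [E,E]\<close>, the elements with this property are closed under
  products and inverses and include the commutators, which allows an induction over \<open>[E,E]\<close>.
\<close>

definition cycle_lift where
  "cycle_lift u z \<longleftrightarrow> u \<in> carrier E \<and> Poly_Mapping.keys z \<subseteq> carrier G \<times> carrier G \<and>
     u = connecting z \<otimes> s (\<beta> u) \<and> bar_boundary2 G z = - frag_of (\<beta> u)"

lemma s_one: "s \<one>\<^bsub>G\<^esub> = factor (\<one>\<^bsub>G\<^esub>, \<one>\<^bsub>G\<^esub>)"
  by (simp add: factor.simps E.m_assoc)

lemma cycle_lift_one: "cycle_lift \<one> (- frag_of (\<one>\<^bsub>G\<^esub>, \<one>\<^bsub>G\<^esub>))"
  by (simp add: cycle_lift_def connecting_minus connecting_frag_of s_one bar_boundary2_minus bar_boundary2_frag_of)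

lemma cycle_lift_mult:
  assumes "cycle_lift u y" "cycle_lift v z"
  shows "cycle_lift (u \<otimes> v) (y + z + frag_of (\<beta> u, \<beta> v))"
proof -
  note u = assms(1)[unfolded cycle_lift_def] and v = assms(2)[unfolded cycle_lift_def]
  have yz: "connecting y \<in> K" "connecting z \<in> K" and b: "\<beta> u \<in> carrier G" "\<beta> v \<in> carrier G"
    using u v connecting_closed by auto
  have "u \<otimes> v = (connecting y \<otimes> s (\<beta> u)) \<otimes> (connecting z \<otimes> s (\<beta> v))"
    using u v by metis
  also have "\<dots> = connecting y \<otimes> (s (\<beta> u) \<otimes> connecting z) \<otimes> s (\<beta> v)"
    using yz b by (simp add: E.m_assoc)
  also have "\<dots> = connecting y \<otimes> (connecting z \<otimes> s (\<beta> u)) \<otimes> s (\<beta> v)"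
    using yz b central[OF yz(2), of "s (\<beta> u)"] by simp
  also have "\<dots> = (connecting y \<otimes> connecting z) \<otimes> (s (\<beta> u) \<otimes> s (\<beta> v))"
    using yz b by (simp add: E.m_assoc)
  also have "\<dots> = (connecting y \<otimes> connecting z \<otimes> factor (\<beta> u, \<beta> v)) \<otimes> s (\<beta> (u \<otimes> v))"
    using yz b u v by (simp add: s_mult E.m_assoc)
  also have "connecting y \<otimes> connecting z \<otimes> factor (\<beta> u, \<beta> v) = connecting (y + z + frag_of (\<beta> u, \<beta> v))"
    using u v b by (simp add: connecting_add connecting_frag_of keys_add_diff_subset)
  finally have "u \<otimes> v = connecting (y + z + frag_of (\<beta> u, \<beta> v)) \<otimes> s (\<beta> (u \<otimes> v))" .
  moreover have "u \<otimes> v \<in> carrier E" "\<beta> (u \<otimes> v) = \<beta> u \<otimes>\<^bsub>G\<^esub> \<beta> v"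
    using u v by simp_all
  moreover have "bar_boundary2 G (y + z + frag_of (\<beta> u, \<beta> v)) = - frag_of (\<beta> u \<otimes>\<^bsub>G\<^esub> \<beta> v)"
    using u v by (simp add: bar_boundary2_add bar_boundary2_frag_of)
  moreover have "Poly_Mapping.keys (y + z + frag_of (\<beta> u, \<beta> v)) \<subseteq> carrier G \<times> carrier G"
    using u v b by (simp add: keys_add_diff_subset)
  ultimately show ?thesis
    unfolding cycle_lift_def by metis
qed

lemma cycle_lift_inv:
  assumes "cycle_lift u z"
  shows "cycle_lift (inv u)
    (- z - frag_of (\<beta> u, inv\<^bsub>G\<^esub> \<beta> u) - frag_of (\<one>\<^bsub>G\<^esub>, \<one>\<^bsub>G\<^esub>))"
proof -
  note u = assms[unfolded cycle_lift_def]
  let ?b = "\<beta> u"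
  have z: "connecting z \<in> K" and b: "?b \<in> carrier G" using u connecting_closed by auto
  let ?f = "factor (?b, inv\<^bsub>G\<^esub> ?b)" and ?e = "factor (\<one>\<^bsub>G\<^esub>, \<one>\<^bsub>G\<^esub>)"
  have "u \<otimes> (inv connecting z \<otimes> inv ?f \<otimes> inv ?e \<otimes> s (inv\<^bsub>G\<^esub> ?b)) =
      (connecting z \<otimes> s ?b) \<otimes> (inv connecting z \<otimes> inv ?f \<otimes> inv ?e \<otimes> s (inv\<^bsub>G\<^esub> ?b))"
    using u by metis
  also have "\<dots> = connecting z \<otimes> (s ?b \<otimes> (inv connecting z \<otimes> inv ?f \<otimes> inv ?e)) \<otimes> s (inv\<^bsub>G\<^esub> ?b)"
    using z b by (simp add: E.m_assoc)
  also have "s ?b \<otimes> (inv connecting z \<otimes> inv ?f \<otimes> inv ?e) = (inv connecting z \<otimes> inv ?f \<otimes> inv ?e) \<otimes> s ?b"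
    using z b factor_in_K subgroup.m_closed[OF hom.subgroup_kernel] subgroup.m_inv_closed[OF hom.subgroup_kernel]
    by (intro central[symmetric]) simp_all
  also have "connecting z \<otimes> ((inv connecting z \<otimes> inv ?f \<otimes> inv ?e) \<otimes> s ?b) \<otimes> s (inv\<^bsub>G\<^esub> ?b) =
      (connecting z \<otimes> inv connecting z) \<otimes> inv ?f \<otimes> inv ?e \<otimes> (s ?b \<otimes> s (inv\<^bsub>G\<^esub> ?b))"
    using z b by (simp flip: E.m_assoc)
  also have "\<dots> = inv ?f \<otimes> inv ?e \<otimes> (?f \<otimes> ?e)"
    using z b by (simp add: s_mult s_one)
  also have "\<dots> = \<one>"
    using b central[OF factor_in_K, of ?b "inv\<^bsub>G\<^esub> ?b" ?e]
    by (simp add: E.inv_mult_group[symmetric])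
  finally have "inv u = inv connecting z \<otimes> inv ?f \<otimes> inv ?e \<otimes> s (inv\<^bsub>G\<^esub> ?b)"
    using u z b by (intro E.inv_equality[OF E.inv_comm]) simp_all
  also have "inv connecting z \<otimes> inv ?f \<otimes> inv ?e = connecting (- z - frag_of (?b, inv\<^bsub>G\<^esub> ?b) - frag_of (\<one>\<^bsub>G\<^esub>, \<one>\<^bsub>G\<^esub>))"
    using u b by (simp add: connecting_diff connecting_minus connecting_frag_of keys_add_diff_subset)
  finally have "inv u = connecting (- z - frag_of (?b, inv\<^bsub>G\<^esub> ?b) - frag_of (\<one>\<^bsub>G\<^esub>, \<one>\<^bsub>G\<^esub>)) \<otimes> s (inv\<^bsub>G\<^esub> ?b)" .
  moreover have "inv u \<in> carrier E" "\<beta> (inv u) = inv\<^bsub>G\<^esub> ?b"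
    using u by simp_all
  moreover have "bar_boundary2 G (- z - frag_of (?b, inv\<^bsub>G\<^esub> ?b) - frag_of (\<one>\<^bsub>G\<^esub>, \<one>\<^bsub>G\<^esub>)) = - frag_of (inv\<^bsub>G\<^esub> ?b)"
    using u b by (simp add: bar_boundary2_diff bar_boundary2_minus bar_boundary2_frag_of)
  moreover have "Poly_Mapping.keys (- z - frag_of (?b, inv\<^bsub>G\<^esub> ?b) - frag_of (\<one>\<^bsub>G\<^esub>, \<one>\<^bsub>G\<^esub>)) \<subseteq> carrier G \<times> carrier G"
    using u b by (simp add: keys_add_diff_subset)
  ultimately show ?thesis
    unfolding cycle_lift_def by metis
qed

text \<open>
  Both \<open>x y\<close> and \<open>y x\<close> are the same central element times \<open>s(g) s(h)\<close> and \<open>s(h) s(g)\<close>, respectively, so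
  the commutator only involves the factor set at \<open>(g, h)\<close>, \<open>(h, g)\<close> and \<open>(c, h g)\<close>, where
  \<open>c = g h g\<^sup>-\<^sup>1 h\<^sup>-\<^sup>1\<close> and \<open>c (h g) = g h\<close>.
\<close>

lemma cycle_lift_commutator:
  assumes "x \<in> carrier E" "y \<in> carrier E"
  obtains z where "cycle_lift (x \<otimes> y \<otimes> inv x \<otimes> inv y) z"
proof -
  define g h where "g = \<beta> x" and "h = \<beta> y"
  define c where "c = g \<otimes>\<^bsub>G\<^esub> h \<otimes>\<^bsub>G\<^esub> inv\<^bsub>G\<^esub> g \<otimes>\<^bsub>G\<^esub> inv\<^bsub>G\<^esub> h"
  define k l where "k = x \<otimes> inv s g" and "l = y \<otimes> inv s h"
  have gh: "g \<in> carrier G" "h \<in> carrier G" "c \<in> carrier G"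
    using assms by (simp_all add: g_def h_def c_def)
  have chg: "c \<otimes>\<^bsub>G\<^esub> (h \<otimes>\<^bsub>G\<^esub> g) = g \<otimes>\<^bsub>G\<^esub> h"
    using gh by (simp add: c_def G.m_assoc) (simp add: G.m_assoc flip: G.m_assoc[of "inv\<^bsub>G\<^esub> h"] G.m_assoc[of "inv\<^bsub>G\<^esub> g"])
  have kl: "k \<in> K" "l \<in> K" "x = k \<otimes> s g" "y = l \<otimes> s h"
    using assms gh by (simp_all add: k_def l_def K_iff E.m_assoc g_def h_def del: K_closed)
  have xy: "x \<otimes> y = (k \<otimes> l) \<otimes> (factor (g, h) \<otimes> s (g \<otimes>\<^bsub>G\<^esub> h))"
    using kl(1,2) gh central[OF kl(2), of "s g"]
    by (simp add: kl(3,4) E.m_assoc s_mult[symmetric]) (simp flip: E.m_assoc)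
  have yx: "y \<otimes> x = (k \<otimes> l) \<otimes> (factor (h, g) \<otimes> s (h \<otimes>\<^bsub>G\<^esub> g))"
    using kl(1,2) gh central[OF kl(1), of "s h"] central[OF kl(1), of l]
    by (simp add: kl(3,4) E.m_assoc s_mult[symmetric]) (simp flip: E.m_assoc)
  let ?z = "frag_of (g, h) - frag_of (h, g) - frag_of (c, h \<otimes>\<^bsub>G\<^esub> g)"
  let ?a = "factor (g, h)" and ?b = "factor (h, g)" and ?d = "factor (c, h \<otimes>\<^bsub>G\<^esub> g)"
  have ab: "?a \<in> K" "?b \<in> K" "?d \<in> K" "inv ?b \<in> K" "inv ?d \<in> K" "?a \<otimes> inv ?b \<otimes> inv ?d \<in> K"
    using gh factor_in_K subgroup.m_closed[OF hom.subgroup_kernel] subgroup.m_inv_closed[OF hom.subgroup_kernel]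
    by simp_all
  have connecting_z: "connecting ?z = ?a \<otimes> inv ?b \<otimes> inv ?d"
    using gh by (simp add: connecting_diff connecting_frag_of keys_add_diff_subset)
  have "(?a \<otimes> inv ?b \<otimes> inv ?d \<otimes> s c) \<otimes> (y \<otimes> x) = x \<otimes> y"
  proof -
    have "(?a \<otimes> inv ?b \<otimes> inv ?d \<otimes> s c) \<otimes> (y \<otimes> x) =
        (?a \<otimes> inv ?b \<otimes> inv ?d) \<otimes> (s c \<otimes> (k \<otimes> l \<otimes> ?b)) \<otimes> s (h \<otimes>\<^bsub>G\<^esub> g)"
      using gh kl(1,2) by (simp add: yx E.m_assoc)
    also have "s c \<otimes> (k \<otimes> l \<otimes> ?b) = (k \<otimes> l \<otimes> ?b) \<otimes> s c"
      using gh kl(1,2) ab subgroup.m_closed[OF hom.subgroup_kernel] by (intro central[symmetric]) simp_all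
    also have "(?a \<otimes> inv ?b \<otimes> inv ?d) \<otimes> ((k \<otimes> l \<otimes> ?b) \<otimes> s c) \<otimes> s (h \<otimes>\<^bsub>G\<^esub> g) =
        ((?a \<otimes> inv ?b \<otimes> inv ?d) \<otimes> (k \<otimes> l \<otimes> ?b)) \<otimes> (?d \<otimes> s (g \<otimes>\<^bsub>G\<^esub> h))"
      using gh kl(1,2) by (simp add: E.m_assoc s_mult chg)
    also have "\<dots> = ((?a \<otimes> inv ?b \<otimes> inv ?d) \<otimes> (k \<otimes> l \<otimes> ?b) \<otimes> ?d) \<otimes> s (g \<otimes>\<^bsub>G\<^esub> h)"
      using gh kl(1,2) by (simp add: E.m_assoc)
    also have "(?a \<otimes> inv ?b \<otimes> inv ?d) \<otimes> (k \<otimes> l \<otimes> ?b) \<otimes> ?d = k \<otimes> l \<otimes> ?a"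
      using K.commutator_factors_cancel[of ?a ?b ?d k l] ab kl(1,2) by simp
    finally show ?thesis
      using gh kl(1,2) by (simp add: xy E.m_assoc)
  qed
  then have "x \<otimes> y \<otimes> inv (y \<otimes> x) = connecting ?z \<otimes> s c"
    using assms gh ab by (simp add: connecting_z E.inv_solve_right')
  then have "x \<otimes> y \<otimes> inv x \<otimes> inv y = connecting ?z \<otimes> s c"
    using assms by (simp add: E.inv_mult_group E.m_assoc)
  moreover have "x \<otimes> y \<otimes> inv x \<otimes> inv y \<in> carrier E" "\<beta> (x \<otimes> y \<otimes> inv x \<otimes> inv y) = c"
    using assms by (simp_all add: c_def g_def h_def)
  moreover have "bar_boundary2 G ?z = - frag_of c"
    by (simp add: bar_boundary2_diff bar_boundary2_frag_of chg)
  moreover have "Poly_Mapping.keys ?z \<subseteq> carrier G \<times> carrier G"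
    using gh by (simp add: keys_add_diff_subset)
  ultimately have "cycle_lift (x \<otimes> y \<otimes> inv x \<otimes> inv y) ?z"
    unfolding cycle_lift_def by metis
  then show thesis by (rule that)
qed

lemma cycle_lift_derived:
  assumes "u \<in> derived E (carrier E)"
  obtains z where "cycle_lift u z"
proof -
  have "\<exists>z. cycle_lift u z"
    using assms unfolding derived_def
  proof (induction rule: generate.induct)
    case one
    show ?case using cycle_lift_one by blast
  next
    case (incl h)
    then show ?case
      using cycle_lift_commutator by blast
  next
    case (inv h)
    then have "\<exists>z. cycle_lift h z"
      using cycle_lift_commutator by blast
    then show ?case using cycle_lift_inv by blast
  next
    case (eng h1 h2)
    then show ?case using cycle_lift_mult by blast
  qed
  with that show thesis by blast
qed

text \<open>
  This is the exactness at \<open>K\<close> of \<open>H\<^sub>2(G) \<rightarrow> K \<rightarrow> E/[E,E]\<close>, a part of the five-term exact sequence.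
\<close>

lemma connecting_image_cycles2: "connecting ` cycles2 G = K \<inter> derived E (carrier E)"
proof
  show "connecting ` cycles2 G \<subseteq> K \<inter> derived E (carrier E)"
    using connecting_cycles2_in_derived connecting_closed by (auto simp: cycles2_iff simp del: K_closed)
  show "K \<inter> derived E (carrier E) \<subseteq> connecting ` cycles2 G"
  proof
    fix u assume u: "u \<in> K \<inter> derived E (carrier E)"
    then obtain z where z: "cycle_lift u z"
      using cycle_lift_derived by blast
    have \<beta>u: "\<beta> u = \<one>\<^bsub>G\<^esub>" using u by (simp add: K_iff del: K_closed)
    \<comment> \<open>The added chain contributes \<open>s(1)\<close> and has boundary \<open>[1]\<close>, which cancels \<open>\<partial>z = -[1]\<close>.\<close>
    let ?z = "z + frag_of (\<one>\<^bsub>G\<^esub>, \<one>\<^bsub>G\<^esub>)"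
    have "u = connecting ?z" "?z \<in> cycles2 G"
      using z \<beta>u by (simp_all add: cycle_lift_def connecting_add connecting_frag_of s_one cycles2_iff keys_add_diff_subset bar_boundary2_add bar_boundary2_frag_of)
    then show "u \<in> connecting ` cycles2 G" by blast
  qed
qed

text \<open>
  Each \<open>g\<close> is conjugate to the representative \<open>r\<close> of its class by some \<open>c(g)\<close>, and \<open>e(g)\<close> is the
  conjugate of \<open>s(r)\<close> by a lift of \<open>c(g)\<close>. Another conjugating element differs from \<open>c(g)\<close> by an element
  commuting with \<open>r\<close>, whose lifts commute with \<open>s(r)\<close> by assumption, so the choice does not matter.
\<close>

lemma equivariant_section:
  assumes comm: "\<And>x y. x \<in> carrier E \<Longrightarrow> y \<in> carrier E \<Longrightarrow> \<beta> x \<otimes>\<^bsub>G\<^esub> \<beta> y = \<beta> y \<otimes>\<^bsub>G\<^esub> \<beta> x \<Longrightarrow> x \<otimes> y = y \<otimes> x"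
  obtains e where "\<And>g. g \<in> carrier G \<Longrightarrow> e g \<in> carrier E" "\<And>g. g \<in> carrier G \<Longrightarrow> \<beta> (e g) = g"
    "\<And>x g. x \<in> carrier E \<Longrightarrow> g \<in> carrier G \<Longrightarrow>
      e (inv\<^bsub>G\<^esub> \<beta> x \<otimes>\<^bsub>G\<^esub> g \<otimes>\<^bsub>G\<^esub> \<beta> x) = inv x \<otimes> e g \<otimes> x"
proof -
  define cl where "cl g = {inv\<^bsub>G\<^esub> h \<otimes>\<^bsub>G\<^esub> g \<otimes>\<^bsub>G\<^esub> h | h. h \<in> carrier G}" for g
  have cl_refl: "g \<in> cl g" if "g \<in> carrier G" for g
    using that by (auto simp: cl_def intro!: exI[of _ "\<one>\<^bsub>G\<^esub>"])
  have cl_conj: "cl (inv\<^bsub>G\<^esub> k \<otimes>\<^bsub>G\<^esub> g \<otimes>\<^bsub>G\<^esub> k) = cl g" if gk: "g \<in> carrier G" "k \<in> carrier G" for g k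
  proof
    show "cl (inv\<^bsub>G\<^esub> k \<otimes>\<^bsub>G\<^esub> g \<otimes>\<^bsub>G\<^esub> k) \<subseteq> cl g"
    proof (clarsimp simp: cl_def)
      fix h assume "h \<in> carrier G"
      then show "\<exists>h'. inv\<^bsub>G\<^esub> h \<otimes>\<^bsub>G\<^esub> (inv\<^bsub>G\<^esub> k \<otimes>\<^bsub>G\<^esub> g \<otimes>\<^bsub>G\<^esub> k) \<otimes>\<^bsub>G\<^esub> h = inv\<^bsub>G\<^esub> h' \<otimes>\<^bsub>G\<^esub> g \<otimes>\<^bsub>G\<^esub> h' \<and> h' \<in> carrier G"
        using gk by (intro exI[of _ "k \<otimes>\<^bsub>G\<^esub> h"]) (simp add: G.inv_mult_group G.m_assoc)
    qed
    show "cl g \<subseteq> cl (inv\<^bsub>G\<^esub> k \<otimes>\<^bsub>G\<^esub> g \<otimes>\<^bsub>G\<^esub> k)"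
    proof (clarsimp simp: cl_def)
      fix h assume h: "h \<in> carrier G"
      have cancel: "k \<otimes>\<^bsub>G\<^esub> (inv\<^bsub>G\<^esub> k \<otimes>\<^bsub>G\<^esub> y) = y" if "y \<in> carrier G" for y
        using gk that by (simp flip: G.m_assoc)
      show "\<exists>h'. inv\<^bsub>G\<^esub> h \<otimes>\<^bsub>G\<^esub> g \<otimes>\<^bsub>G\<^esub> h = inv\<^bsub>G\<^esub> h' \<otimes>\<^bsub>G\<^esub> (inv\<^bsub>G\<^esub> k \<otimes>\<^bsub>G\<^esub> g \<otimes>\<^bsub>G\<^esub> k) \<otimes>\<^bsub>G\<^esub> h' \<and> h' \<in> carrier G"
        using gk h by (intro exI[of _ "inv\<^bsub>G\<^esub> k \<otimes>\<^bsub>G\<^esub> h"]) (simp add: G.inv_mult_group G.m_assoc cancel)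
    qed
  qed
  define rep where "rep g = (SOME r. r \<in> cl g)" for g
  have rep_conj: "rep (inv\<^bsub>G\<^esub> k \<otimes>\<^bsub>G\<^esub> g \<otimes>\<^bsub>G\<^esub> k) = rep g" if "g \<in> carrier G" "k \<in> carrier G" for g k
    using cl_conj[OF that] by (simp add: rep_def)
  have "\<exists>h\<in>carrier G. rep g \<in> carrier G \<and> inv\<^bsub>G\<^esub> h \<otimes>\<^bsub>G\<^esub> rep g \<otimes>\<^bsub>G\<^esub> h = g" if g: "g \<in> carrier G" for g
  proof -
    have "rep g \<in> cl g"
      unfolding rep_def using cl_refl[OF g] by (rule someI)
    then obtain h where h: "h \<in> carrier G" "rep g = inv\<^bsub>G\<^esub> h \<otimes>\<^bsub>G\<^esub> g \<otimes>\<^bsub>G\<^esub> h"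
      by (auto simp: cl_def)
    have cancel: "h \<otimes>\<^bsub>G\<^esub> (inv\<^bsub>G\<^esub> h \<otimes>\<^bsub>G\<^esub> y) = y" if "y \<in> carrier G" for y
      using h that by (simp flip: G.m_assoc)
    show ?thesis
      using g h by (intro bexI[of _ "inv\<^bsub>G\<^esub> h"]) (simp_all add: G.m_assoc cancel)
  qed
  then obtain c where c: "\<And>g. g \<in> carrier G \<Longrightarrow> c g \<in> carrier G"
      and rep: "\<And>g. g \<in> carrier G \<Longrightarrow> rep g \<in> carrier G"
      and c_conj: "\<And>g. g \<in> carrier G \<Longrightarrow> inv\<^bsub>G\<^esub> c g \<otimes>\<^bsub>G\<^esub> rep g \<otimes>\<^bsub>G\<^esub> c g = g"
    by metis
  define e where "e g = inv s (c g) \<otimes> s (rep g) \<otimes> s (c g)" for g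
  show thesis
  proof
    fix g assume g: "g \<in> carrier G"
    show "e g \<in> carrier E" using g c rep by (simp add: e_def)
    show "\<beta> (e g) = g" using g c rep c_conj by (simp add: e_def)
    fix x assume x: "x \<in> carrier E"
    let ?g' = "inv\<^bsub>G\<^esub> \<beta> x \<otimes>\<^bsub>G\<^esub> g \<otimes>\<^bsub>G\<^esub> \<beta> x"
    have g': "?g' \<in> carrier G" using g x by simp
    let ?r = "rep g" and ?h = "c g" and ?h' = "c ?g'"
    have mem: "?r \<in> carrier G" "?h \<in> carrier G" "?h' \<in> carrier G" "\<beta> x \<in> carrier G"
      using g g' c rep x by simp_all
    have r': "rep ?g' = ?r" using rep_conj[OF g, of "\<beta> x"] x by simp
    have "inv\<^bsub>G\<^esub> ?h' \<otimes>\<^bsub>G\<^esub> ?r \<otimes>\<^bsub>G\<^esub> ?h' = inv\<^bsub>G\<^esub> \<beta> x \<otimes>\<^bsub>G\<^esub> (inv\<^bsub>G\<^esub> ?h \<otimes>\<^bsub>G\<^esub> ?r \<otimes>\<^bsub>G\<^esub> ?h) \<otimes>\<^bsub>G\<^esub> \<beta> x"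
      using c_conj[OF g'] c_conj[OF g] r' by simp
    then have "?r \<otimes>\<^bsub>G\<^esub> (?h \<otimes>\<^bsub>G\<^esub> \<beta> x \<otimes>\<^bsub>G\<^esub> inv\<^bsub>G\<^esub> ?h') = (?h \<otimes>\<^bsub>G\<^esub> \<beta> x \<otimes>\<^bsub>G\<^esub> inv\<^bsub>G\<^esub> ?h') \<otimes>\<^bsub>G\<^esub> ?r"
      using G.conj_eq_iff_commute[OF mem(1,3) G.m_closed[OF mem(2,4)]] mem
      by (simp add: G.inv_mult_group G.m_assoc)
    then have "s ?r \<otimes> (s ?h \<otimes> x \<otimes> inv s ?h') = (s ?h \<otimes> x \<otimes> inv s ?h') \<otimes> s ?r"
      using mem x by (intro comm) simp_all
    then have "inv s ?h' \<otimes> s ?r \<otimes> s ?h' = inv (s ?h \<otimes> x) \<otimes> s ?r \<otimes> (s ?h \<otimes> x)"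
      using E.conj_eq_iff_commute[of "s ?r" "s ?h'" "s ?h \<otimes> x"] mem x by simp
    then show "e ?g' = inv x \<otimes> e g \<otimes> x"
      using mem x by (simp add: e_def r' E.inv_mult_group E.m_assoc)
  qed
qed

end

text \<open>
  The lifts \<open>\<psi>(s(g))\<close> and \<open>s'(g)\<close> of \<open>g\<close> differ by central elements \<open>t(g)\<close>, so the image of one factor set
  and the other factor set differ by the coboundary of \<open>t\<close>.
\<close>

lemma (in central_extension) connecting_natural:
  assumes E': "central_extension E' G \<beta>' s'" and \<psi>: "\<psi> \<in> hom E E'"
    and over: "\<And>x. x \<in> carrier E \<Longrightarrow> \<beta>' (\<psi> x) = \<beta> x" and z: "z \<in> cycles2 G"
  shows "\<psi> (connecting z) = central_extension.connecting E' G \<beta>' s' z"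
proof -
  interpret E': central_extension E' G \<beta>' s' by fact
  interpret \<psi>: group_hom E E' \<psi>
    using \<psi> by unfold_locales
  define t where "t g = \<psi> (s g) \<otimes>\<^bsub>E'\<^esub> inv\<^bsub>E'\<^esub> s' g" for g
  have t: "t g \<in> E'.K" if "g \<in> carrier G" for g
    using that by (simp add: t_def E'.K_iff over del: E'.K_closed)
  have t_s': "\<psi> (s g) = t g \<otimes>\<^bsub>E'\<^esub> s' g" if "g \<in> carrier G" for g
    using that by (simp add: t_def E'.E.m_assoc)
  have \<psi>_K: "\<psi> k \<in> E'.K" if "k \<in> K" for k
    using that by (simp add: E'.K_iff over) (simp add: K_iff del: K_closed)
  have "\<psi> \<in> hom KK E'.KK"
    using \<psi>_K by (intro homI) simp_all
  moreover have "\<psi> (factor (g, h)) =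
      (t h \<otimes>\<^bsub>E'.KK\<^esub> inv\<^bsub>E'.KK\<^esub> t (g \<otimes>\<^bsub>G\<^esub> h) \<otimes>\<^bsub>E'.KK\<^esub> t g) \<otimes>\<^bsub>E'.KK\<^esub> E'.factor (g, h)"
    if gh: "g \<in> carrier G" "h \<in> carrier G" for g h
  proof -
    let ?m = "g \<otimes>\<^bsub>G\<^esub> h"
    have tK: "t g \<in> E'.K" "t h \<in> E'.K" "t ?m \<in> E'.K" and f'K: "E'.factor (g, h) \<in> E'.K"
      using gh t E'.factor_in_K by simp_all
    have "\<psi> (factor (g, h)) \<otimes>\<^bsub>E'\<^esub> t ?m \<otimes>\<^bsub>E'\<^esub> s' ?m = \<psi> (factor (g, h) \<otimes> s ?m)"
      using gh tK by (simp add: t_s' E'.E.m_assoc)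
    also have "\<dots> = \<psi> (s g) \<otimes>\<^bsub>E'\<^esub> \<psi> (s h)"
      using gh by (simp flip: s_mult)
    also have "\<dots> = t g \<otimes>\<^bsub>E'\<^esub> (s' g \<otimes>\<^bsub>E'\<^esub> t h) \<otimes>\<^bsub>E'\<^esub> s' h"
      using gh tK by (simp add: t_s' E'.E.m_assoc)
    also have "s' g \<otimes>\<^bsub>E'\<^esub> t h = t h \<otimes>\<^bsub>E'\<^esub> s' g"
      using gh E'.central[OF tK(2), of "s' g"] by simp
    also have "t g \<otimes>\<^bsub>E'\<^esub> (t h \<otimes>\<^bsub>E'\<^esub> s' g) \<otimes>\<^bsub>E'\<^esub> s' h = t g \<otimes>\<^bsub>E'\<^esub> t h \<otimes>\<^bsub>E'\<^esub> (s' g \<otimes>\<^bsub>E'\<^esub> s' h)"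
      using gh tK by (simp add: E'.E.m_assoc)
    also have "\<dots> = t g \<otimes>\<^bsub>E'\<^esub> t h \<otimes>\<^bsub>E'\<^esub> E'.factor (g, h) \<otimes>\<^bsub>E'\<^esub> s' ?m"
      using gh tK by (simp add: E'.s_mult E'.E.m_assoc)
    finally have "\<psi> (factor (g, h)) \<otimes>\<^bsub>E'\<^esub> t ?m = t g \<otimes>\<^bsub>E'\<^esub> t h \<otimes>\<^bsub>E'\<^esub> E'.factor (g, h)"
      using gh tK by simp
    then show ?thesis
      using tK f'K \<psi>_K[OF factor_in_K[OF gh]]
      by (intro E'.K.solve_coboundary) simp_all
  qed
  ultimately have "\<psi> (connecting z) = frag_eval E'.KK E'.factor z"
    using t z E'.factor_fun
    by (intro hom_connecting_eq_frag_eval[OF E'.comm_group_K, where A = "carrier G" and t = t])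
      (auto simp: G.subgroup_self)
  then show ?thesis by (simp add: E'.connecting_def)
qed

section \<open>The extension defined by a cocycle\<close>

definition cocycle_extension ::
  "('a, 'm) monoid_scheme \<Rightarrow> ('q, 'n) monoid_scheme \<Rightarrow> ('a \<times> 'a \<Rightarrow> 'q) \<Rightarrow> ('a \<times> 'q) monoid" where
  "cocycle_extension G Q c =
     \<lparr>carrier = carrier G \<times> carrier Q,
      mult = (\<lambda>(g, x) (h, y). (g \<otimes>\<^bsub>G\<^esub> h, x \<otimes>\<^bsub>Q\<^esub> y \<otimes>\<^bsub>Q\<^esub> c (g, h))),
      one = (\<one>\<^bsub>G\<^esub>, \<one>\<^bsub>Q\<^esub>)\<rparr>"

text \<open>
  Normalisation makes \<open>(1, 1)\<close> the neutral element of the extension and \<open>x \<mapsto> (1, x)\<close> a homomorphism.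
\<close>

locale normalised_cocycle = G: group G + Q: comm_group Q for G and Q +
  fixes c
  assumes c_fun: "c \<in> carrier G \<times> carrier G \<rightarrow> carrier Q"
    and c_boundary: "z \<in> boundaries2 G \<Longrightarrow> frag_eval Q c z = \<one>\<^bsub>Q\<^esub>"
    and c_one_left: "g \<in> carrier G \<Longrightarrow> c (\<one>\<^bsub>G\<^esub>, g) = \<one>\<^bsub>Q\<^esub>"
begin

abbreviation "E \<equiv> cocycle_extension G Q c"

lemma c_closed [simp]: "g \<in> carrier G \<Longrightarrow> h \<in> carrier G \<Longrightarrow> c (g, h) \<in> carrier Q"
  using c_fun by auto

lemma c_cocycle:
  assumes gk: "g \<in> carrier G" "h \<in> carrier G" "k \<in> carrier G"
  shows "c (h, k) \<otimes>\<^bsub>Q\<^esub> c (g, h \<otimes>\<^bsub>G\<^esub> k) = c (g, h) \<otimes>\<^bsub>Q\<^esub> c (g \<otimes>\<^bsub>G\<^esub> h, k)"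
proof -
  have "coboundary2 G Q c (g, h, k) = \<one>\<^bsub>Q\<^esub>"
    using G.cocycle_condition_iff[OF Q.comm_group_axioms c_fun] c_boundary gk by blast
  then have "(c (h, k) \<otimes>\<^bsub>Q\<^esub> c (g, h \<otimes>\<^bsub>G\<^esub> k)) \<otimes>\<^bsub>Q\<^esub> inv\<^bsub>Q\<^esub> (c (g, h) \<otimes>\<^bsub>Q\<^esub> c (g \<otimes>\<^bsub>G\<^esub> h, k)) = \<one>\<^bsub>Q\<^esub>"
    using gk by (simp add: coboundary2_def Q.cocycle_rearrange)
  then show ?thesis
    using gk by (subst (asm) Q.mult_inv_eq_one_iff) simp_all
qed

lemma c_one_right: "g \<in> carrier G \<Longrightarrow> c (g, \<one>\<^bsub>G\<^esub>) = \<one>\<^bsub>Q\<^esub>"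
  using c_cocycle[of g "\<one>\<^bsub>G\<^esub>" "\<one>\<^bsub>G\<^esub>"] by (simp add: c_one_left)

lemma extension_simps [simp]:
  "carrier E = carrier G \<times> carrier Q"
  "(g, x) \<otimes>\<^bsub>E\<^esub> (h, y) = (g \<otimes>\<^bsub>G\<^esub> h, x \<otimes>\<^bsub>Q\<^esub> y \<otimes>\<^bsub>Q\<^esub> c (g, h))"
  "\<one>\<^bsub>E\<^esub> = (\<one>\<^bsub>G\<^esub>, \<one>\<^bsub>Q\<^esub>)"
  by (simp_all add: cocycle_extension_def)

lemma group_extension: "group E"
proof (rule groupI)
  fix p q r assume "p \<in> carrier E" "q \<in> carrier E" "r \<in> carrier E"
  then obtain g x h y k w where pqr: "p = (g, x)" "q = (h, y)" "r = (k, w)"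
    and [simp]: "g \<in> carrier G" "h \<in> carrier G" "k \<in> carrier G"
      "x \<in> carrier Q" "y \<in> carrier Q" "w \<in> carrier Q"
    by auto
  have "(x \<otimes>\<^bsub>Q\<^esub> y \<otimes>\<^bsub>Q\<^esub> c (g, h)) \<otimes>\<^bsub>Q\<^esub> w \<otimes>\<^bsub>Q\<^esub> c (g \<otimes>\<^bsub>G\<^esub> h, k) =
      (x \<otimes>\<^bsub>Q\<^esub> y \<otimes>\<^bsub>Q\<^esub> w) \<otimes>\<^bsub>Q\<^esub> (c (g, h) \<otimes>\<^bsub>Q\<^esub> c (g \<otimes>\<^bsub>G\<^esub> h, k))"
    by (simp add: Q.m_ac)
  also have "\<dots> = (x \<otimes>\<^bsub>Q\<^esub> y \<otimes>\<^bsub>Q\<^esub> w) \<otimes>\<^bsub>Q\<^esub> (c (h, k) \<otimes>\<^bsub>Q\<^esub> c (g, h \<otimes>\<^bsub>G\<^esub> k))"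
    by (simp add: c_cocycle)
  also have "\<dots> = x \<otimes>\<^bsub>Q\<^esub> (y \<otimes>\<^bsub>Q\<^esub> w \<otimes>\<^bsub>Q\<^esub> c (h, k)) \<otimes>\<^bsub>Q\<^esub> c (g, h \<otimes>\<^bsub>G\<^esub> k)"
    by (simp add: Q.m_ac)
  finally show "p \<otimes>\<^bsub>E\<^esub> q \<otimes>\<^bsub>E\<^esub> r = p \<otimes>\<^bsub>E\<^esub> (q \<otimes>\<^bsub>E\<^esub> r)"
    by (simp add: pqr G.m_assoc)
next
  fix p assume "p \<in> carrier E"
  then obtain g x where p: "p = (g, x)" "g \<in> carrier G" "x \<in> carrier Q" by auto
  have "inv\<^bsub>Q\<^esub> x \<otimes>\<^bsub>Q\<^esub> inv\<^bsub>Q\<^esub> c (inv\<^bsub>G\<^esub> g, g) \<otimes>\<^bsub>Q\<^esub> x \<otimes>\<^bsub>Q\<^esub> c (inv\<^bsub>G\<^esub> g, g) =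
      (inv\<^bsub>Q\<^esub> x \<otimes>\<^bsub>Q\<^esub> x) \<otimes>\<^bsub>Q\<^esub> (inv\<^bsub>Q\<^esub> c (inv\<^bsub>G\<^esub> g, g) \<otimes>\<^bsub>Q\<^esub> c (inv\<^bsub>G\<^esub> g, g))"
    using p by (simp add: Q.m_ac del: Q.l_inv Q.r_inv Q.Units_l_inv Q.Units_r_inv)
  then show "\<exists>q\<in>carrier E. q \<otimes>\<^bsub>E\<^esub> p = \<one>\<^bsub>E\<^esub>"
    using p by (intro bexI[of _ "(inv\<^bsub>G\<^esub> g, inv\<^bsub>Q\<^esub> x \<otimes>\<^bsub>Q\<^esub> inv\<^bsub>Q\<^esub> c (inv\<^bsub>G\<^esub> g, g))"]) simp_all
qed (auto simp: c_one_left)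

lemma kernel_iff: "p \<in> kernel E G fst \<longleftrightarrow> (\<exists>x\<in>carrier Q. p = (\<one>\<^bsub>G\<^esub>, x))"
  by (auto simp: kernel_def)

sublocale E: central_extension E G fst "\<lambda>g. (g, \<one>\<^bsub>Q\<^esub>)"
proof (intro central_extension.intro central_extension_axioms.intro group_extension G.group_axioms)
  fix k p assume "k \<in> kernel E G fst" "p \<in> carrier E"
  then show "k \<otimes>\<^bsub>E\<^esub> p = p \<otimes>\<^bsub>E\<^esub> k"
    by (auto simp: kernel_iff c_one_left c_one_right Q.m_comm)
qed (auto simp: hom_def)

lemma connecting_eq_frag_eval:
  assumes "Poly_Mapping.keys z \<subseteq> carrier G \<times> carrier G"
  shows "E.connecting z = (\<one>\<^bsub>G\<^esub>, frag_eval Q c z)"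
proof -
  have factor: "E.factor (g, h) = (\<one>\<^bsub>G\<^esub>, c (g, h))" if "g \<in> carrier G" "h \<in> carrier G" for g h
  proof -
    have "(\<one>\<^bsub>G\<^esub>, c (g, h)) \<otimes>\<^bsub>E\<^esub> (g \<otimes>\<^bsub>G\<^esub> h, \<one>\<^bsub>Q\<^esub>) = (g, \<one>\<^bsub>Q\<^esub>) \<otimes>\<^bsub>E\<^esub> (h, \<one>\<^bsub>Q\<^esub>)"
      using that by (simp add: c_one_left)
    then show ?thesis
      unfolding E.factor.simps using that by (intro E.E.inv_solve_right[THEN iffD2, symmetric] ; simp?)
  qed
  have hom: "(\<lambda>x. (\<one>\<^bsub>G\<^esub>, x)) \<in> hom Q E.KK"
    by (rule homI) (auto simp: kernel_iff c_one_left)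
  have "(\<one>\<^bsub>G\<^esub>, frag_eval Q c z) = frag_eval E.KK (\<lambda>p. (\<one>\<^bsub>G\<^esub>, c p)) z"
    by (rule Q.hom_frag_eval[OF E.comm_group_K hom c_fun assms])
  also have "\<dots> = E.connecting z"
    unfolding E.connecting_def
  proof (rule frag_eval_cong)
    fix p assume "p \<in> Poly_Mapping.keys z"
    then obtain g h where "p = (g, h)" "g \<in> carrier G" "h \<in> carrier G" using assms by auto
    then show "(\<one>\<^bsub>G\<^esub>, c p) = E.factor p" "E.factor p \<in> carrier E.KK"
      using factor E.factor_in_K by simp_all
  qed (simp_all add: E.K.comm_monoid_axioms E.K.is_group)
  finally show ?thesis ..
qed

end

section \<open>The central extension of an equipped group\<close>

locale conjugation_closed_generators = group G for G (structure) +
  fixes S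
  assumes S_sub: "S \<subseteq> carrier G"
    and S_conj: "g \<in> S \<Longrightarrow> k \<in> carrier G \<Longrightarrow> k \<otimes> g \<otimes> inv k \<in> S"
    and S_gen: "generate G S = carrier G"
begin

abbreviation "C \<equiv> C_group G S"
abbreviation "Y \<equiv> C_generator G S"
abbreviation "\<beta> \<equiv> C_map G"

sublocale C: group C
  unfolding C_group_def by (rule group_presented_group)

sublocale C_map: group_hom C G \<beta>
  using C_map_hom[OF is_group S_sub] by unfold_locales

lemma S_closed [simp]: "g \<in> S \<Longrightarrow> g \<in> carrier G"
  using S_sub by blast

lemma S_conj': "g \<in> S \<Longrightarrow> k \<in> carrier G \<Longrightarrow> inv k \<otimes> g \<otimes> k \<in> S"
  using S_conj[of g "inv k"] by simp

lemma Y_closed [simp]: "g \<in> S \<Longrightarrow> Y g \<in> carrier C"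
  by (simp add: C_generator_def C_group_def carrier_presented_group gen_def)

lemma C_map_Y [simp]: "g \<in> S \<Longrightarrow> \<beta> (Y g) = g"
  by (rule C_map_generator[OF is_group S_sub])

lemma Y_mult:
  assumes "g \<in> S" "h \<in> S"
  shows Y_mult_conj_right: "Y g \<otimes>\<^bsub>C\<^esub> Y h = Y h \<otimes>\<^bsub>C\<^esub> Y (inv h \<otimes> g \<otimes> h)"
    and Y_mult_conj_left: "Y g \<otimes>\<^bsub>C\<^esub> Y h = Y (g \<otimes> h \<otimes> inv g) \<otimes>\<^bsub>C\<^esub> Y g"
proof -
  have w: "gen x \<in> words S" if "x \<in> S" for x using that by (simp add: gen_def)
  have S: "inv h \<otimes> g \<otimes> h \<in> S" "g \<otimes> h \<otimes> inv g \<in> S"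
    using assms S_conj S_conj' by simp_all
  have rel: "pres_eq S (C_relations G S) (gen g @ gen h) (gen h @ gen (inv h \<otimes> g \<otimes> h))"
    "pres_eq S (C_relations G S) (gen g @ gen h) (gen (g \<otimes> h \<otimes> inv g) @ gen g)"
    using assms S w by (auto intro!: pres_eq.relation simp: C_relations_def)
  show "Y g \<otimes>\<^bsub>C\<^esub> Y h = Y h \<otimes>\<^bsub>C\<^esub> Y (inv h \<otimes> g \<otimes> h)"
    using assms S w rel(1)
    by (simp add: C_generator_def C_group_def presented_group_mult pres_class_eq_iff)
  show "Y g \<otimes>\<^bsub>C\<^esub> Y h = Y (g \<otimes> h \<otimes> inv g) \<otimes>\<^bsub>C\<^esub> Y g"
    using assms S w rel(2)
    by (simp add: C_generator_def C_group_def presented_group_mult pres_class_eq_iff)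
qed

lemma carrier_C: "carrier C = generate C (Y ` S)"
proof
  show "generate C (Y ` S) \<subseteq> carrier C"
    by (rule C.generate_incl) auto
  show "carrier C \<subseteq> generate C (Y ` S)"
  proof
    fix u assume "u \<in> carrier C"
    then obtain w where w: "w \<in> words S" "u = pres_class S (C_relations G S) w"
      by (auto simp: C_group_def carrier_presented_group)
    have "pres_class S (C_relations G S) w \<in> generate C (Y ` S)"
      using w(1)
    proof (induction w)
      case Nil
      then show ?case
        using generate.one[of C] by (simp add: C_group_def one_presented_group)
    next
      case (Cons a w)
      obtain b x where a: "a = (b, x)" by (cases a)
      with Cons have x: "x \<in> S" and w: "w \<in> words S" by auto
      let ?cl = "pres_class S (C_relations G S)"
      have "?cl [(b, x)] \<in> generate C (Y ` S)"
      proof (cases b)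
        case True
        then show ?thesis
          using x generate.incl[of "Y x" "Y ` S" C] by (simp add: C_generator_def gen_def)
      next
        case False
        have cl: "?cl [(False, x)] \<in> carrier C"
          using x by (simp add: C_group_def carrier_presented_group)
        have "pres_eq S (C_relations G S) [(False, x), (True, x)] []"
          using pres_eq.cancel[OF x, of _ False] by simp
        then have "?cl [(False, x)] \<otimes>\<^bsub>C\<^esub> Y x = \<one>\<^bsub>C\<^esub>"
          using x by (simp add: C_generator_def gen_def C_group_def presented_group_mult
              one_presented_group pres_class_eq_iff)
        then have "inv\<^bsub>C\<^esub> Y x = ?cl [(False, x)]"
          using cl x by (intro C.inv_equality) simp_all
        then show ?thesis
          using False x generate.inv[of "Y x" "Y ` S" C] by simp
      qed
      moreover have "?cl (a # w) = ?cl [(b, x)] \<otimes>\<^bsub>C\<^esub> ?cl w"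
        using x w by (simp add: a C_group_def presented_group_mult)
      ultimately show ?case
        using Cons w by (simp add: generate.eng)
    qed
    with w(2) show "u \<in> generate C (Y ` S)" by simp
  qed
qed

text \<open>
  Conjugation of a generator by a word is determined by the image of the word in \<open>G\<close>. For inverses of
  generators this uses the first family of relations, for generators the second.
\<close>

lemma conj_Y:
  assumes "u \<in> carrier C" "g \<in> S"
  shows "u \<otimes>\<^bsub>C\<^esub> Y g = Y (\<beta> u \<otimes> g \<otimes> inv \<beta> u) \<otimes>\<^bsub>C\<^esub> u"
  using assms(1)[unfolded carrier_C] assms(2)
proof (induction arbitrary: g rule: generate.induct)
  case one
  then show ?case by simp
next
  case (incl u)
  then show ?case using Y_mult_conj_left by auto
next
  case (inv u)
  then obtain h where h: "h \<in> S" "u = Y h" by blast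
  have S: "inv h \<otimes> g \<otimes> h \<in> S" using h inv.prems S_conj' by simp
  have "inv\<^bsub>C\<^esub> Y h \<otimes>\<^bsub>C\<^esub> Y g = inv\<^bsub>C\<^esub> Y h \<otimes>\<^bsub>C\<^esub> (Y g \<otimes>\<^bsub>C\<^esub> Y h) \<otimes>\<^bsub>C\<^esub> inv\<^bsub>C\<^esub> Y h"
    using h inv.prems by (simp add: C.m_assoc)
  also have "\<dots> = Y (inv h \<otimes> g \<otimes> h) \<otimes>\<^bsub>C\<^esub> inv\<^bsub>C\<^esub> Y h"
  proof -
    have "Y g \<otimes>\<^bsub>C\<^esub> Y h = Y h \<otimes>\<^bsub>C\<^esub> Y (inv h \<otimes> g \<otimes> h)"
      using h inv.prems by (intro Y_mult_conj_right)
    then show ?thesis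
      using h S by (simp flip: C.m_assoc)
  qed
  finally show ?case
    using h by simp
next
  case (eng u v)
  have uv: "u \<in> carrier C" "v \<in> carrier C"
    using eng.hyps by (simp_all add: carrier_C)
  let ?g = "\<beta> v \<otimes> g \<otimes> inv \<beta> v"
  have g': "?g \<in> S" using eng.prems uv S_conj by simp
  have g'': "\<beta> u \<otimes> ?g \<otimes> inv \<beta> u \<in> S" using g' uv S_conj by simp
  have "u \<otimes>\<^bsub>C\<^esub> v \<otimes>\<^bsub>C\<^esub> Y g = u \<otimes>\<^bsub>C\<^esub> (Y ?g \<otimes>\<^bsub>C\<^esub> v)"
    using uv eng.prems eng.IH(2)[OF eng.prems] by (simp add: C.m_assoc)
  also have "\<dots> = Y (\<beta> u \<otimes> ?g \<otimes> inv \<beta> u) \<otimes>\<^bsub>C\<^esub> u \<otimes>\<^bsub>C\<^esub> v"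
    using uv g' eng.IH(1)[OF g'] by (simp flip: C.m_assoc)
  also have "\<dots> = Y (\<beta> u \<otimes> ?g \<otimes> inv \<beta> u) \<otimes>\<^bsub>C\<^esub> (u \<otimes>\<^bsub>C\<^esub> v)"
    using uv g'' by (simp add: C.m_assoc)
  also have "\<beta> u \<otimes> ?g \<otimes> inv \<beta> u = \<beta> (u \<otimes>\<^bsub>C\<^esub> v) \<otimes> g \<otimes> inv \<beta> (u \<otimes>\<^bsub>C\<^esub> v)"
    using uv eng.prems by (simp add: inv_mult_group m_assoc)
  finally show ?case .
qed

lemma kernel_central:
  assumes "k \<in> kernel C G \<beta>" "u \<in> carrier C"
  shows "k \<otimes>\<^bsub>C\<^esub> u = u \<otimes>\<^bsub>C\<^esub> k"
proof -
  have k: "k \<in> carrier C" "\<beta> k = \<one>" using assms(1) by (simp_all add: kernel_def)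
  have "subgroup {u \<in> carrier C. k \<otimes>\<^bsub>C\<^esub> u = u \<otimes>\<^bsub>C\<^esub> k} C"
    by (rule C.subgroup_commuting[OF k(1)])
  moreover have "Y ` S \<subseteq> {u \<in> carrier C. k \<otimes>\<^bsub>C\<^esub> u = u \<otimes>\<^bsub>C\<^esub> k}"
    using conj_Y[OF k(1)] k(2) by auto
  ultimately show ?thesis
    using C.generate_subgroup_incl[of "Y ` S"] assms(2) carrier_C by blast
qed

lemma C_map_surj:
  assumes "g \<in> carrier G"
  obtains u where "u \<in> carrier C" "\<beta> u = g"
proof -
  have "S \<subseteq> \<beta> ` carrier C"
  proof
    fix g assume "g \<in> S"
    then have "g = \<beta> (Y g)" "Y g \<in> carrier C" by simp_all
    then show "g \<in> \<beta> ` carrier C" by blast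
  qed
  then have "carrier G \<subseteq> \<beta> ` carrier C"
    using generate_subgroup_incl[OF _ C_map.img_is_subgroup, of S] S_gen by simp
  with assms that show thesis by blast
qed

lemma central_extension_C:
  assumes "\<And>g. g \<in> carrier G \<Longrightarrow> s g \<in> carrier C" "\<And>g. g \<in> carrier G \<Longrightarrow> \<beta> (s g) = g"
  shows "central_extension C G \<beta> s"
  using assms kernel_central C_map.homh
  by (intro central_extension.intro central_extension_axioms.intro C.group_axioms group_axioms) simp_all

text \<open>
  The conjugation property of \<open>e\<close> yields both families of relations, the second one being the first for
  the pair \<open>(g h g\<^sup>-\<^sup>1, g)\<close>.
\<close>

lemma hom_C_lift:
  assumes "group E" "\<And>g. g \<in> S \<Longrightarrow> e g \<in> carrier E"
    and e_conj: "\<And>g h. g \<in> S \<Longrightarrow> h \<in> S \<Longrightarrow> e (inv h \<otimes> g \<otimes> h) = inv\<^bsub>E\<^esub> e h \<otimes>\<^bsub>E\<^esub> e g \<otimes>\<^bsub>E\<^esub> e h"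
  obtains \<psi> where "\<psi> \<in> hom C E" "\<And>g. g \<in> S \<Longrightarrow> \<psi> (Y g) = e g"
proof -
  interpret E: group E by fact
  have R: "word_eval E e u = word_eval E e v"
    if "(u, v) \<in> C_relations G S" "u \<in> words S" "v \<in> words S" for u v
  proof -
    have right: "e g \<otimes>\<^bsub>E\<^esub> e h = e h \<otimes>\<^bsub>E\<^esub> e (inv h \<otimes> g \<otimes> h)" if "g \<in> S" "h \<in> S" for g h
      using that assms(2) by (simp add: e_conj) (simp flip: E.m_assoc)
    have left: "e g \<otimes>\<^bsub>E\<^esub> e h = e (g \<otimes> h \<otimes> inv g) \<otimes>\<^bsub>E\<^esub> e g" if "g \<in> S" "h \<in> S" for g h
    proof -
      have "inv g \<otimes> (g \<otimes> h \<otimes> inv g) \<otimes> g = (inv g \<otimes> g) \<otimes> h \<otimes> (inv g \<otimes> g)"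
        using that by (simp add: m_assoc del: l_inv Units_l_inv)
      also have "\<dots> = h"
        using that by simp
      finally have "inv g \<otimes> (g \<otimes> h \<otimes> inv g) \<otimes> g = h" .
      then show ?thesis
        using right[of "g \<otimes> h \<otimes> inv g" g] that S_conj by simp
    qed
    have S: "g \<otimes> h \<otimes> inv g \<in> S" "inv h \<otimes> g \<otimes> h \<in> S" if "g \<in> S" "h \<in> S" for g h
      using that S_conj S_conj' by simp_all
    from \<open>(u, v) \<in> C_relations G S\<close> consider
        g h where "g \<in> S" "h \<in> S" "u = gen g @ gen h" "v = gen h @ gen (inv h \<otimes> g \<otimes> h)"
      | g h where "g \<in> S" "h \<in> S" "u = gen g @ gen h" "v = gen (g \<otimes> h \<otimes> inv g) @ gen g"
      unfolding C_relations_def by blast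
    then show ?thesis
    proof cases
      case 1
      then show ?thesis using right[of g h] S[of g h] assms(2) by (simp add: gen_def)
    next
      case 2
      then show ?thesis using left[of g h] S[of g h] assms(2) by (simp add: gen_def)
    qed
  qed
  show thesis
  proof
    show "presented_map E e \<in> hom C E"
      unfolding C_group_def using assms(1,2) R by (intro presented_map_class(2)[where u = "[]"]) auto
    fix g assume g: "g \<in> S"
    then show "presented_map E e (Y g) = e g"
      unfolding C_generator_def using assms(1,2) R by (subst presented_map_class(1)) (auto simp: gen_def)
  qed
qed

lemma hom_C_over:
  assumes "group E" "\<psi> \<in> hom C E" "\<beta>' \<in> hom E G" "\<And>g. g \<in> S \<Longrightarrow> \<beta>' (\<psi> (Y g)) = g" "u \<in> carrier C"
  shows "\<beta>' (\<psi> u) = \<beta> u"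
proof -
  interpret c: group_hom C G "\<beta>' \<circ> \<psi>"
    using Group.hom_compose[OF assms(2,3)] by unfold_locales
  have "(\<beta>' \<circ> \<psi>) u = \<beta> u"
    using assms(5)[unfolded carrier_C]
  proof (induction rule: generate.induct)
    case (incl u)
    then show ?case using assms(4) by auto
  next
    case (inv u)
    then obtain g where g: "g \<in> S" "u = Y g" by blast
    then have "(\<beta>' \<circ> \<psi>) (Y g) = g" using assms(4) by simp
    with g show ?case by (simp del: comp_apply)
  next
    case (eng u v)
    then show ?case by (simp del: comp_apply flip: carrier_C)
  qed (simp del: comp_apply)
  then show ?thesis by simp
qed

end

section \<open>Comparison of the three orders\<close>

text \<open>
  The tautological cocycle \<open>[g|h]\<close> modulo \<open>M\<close> is normalised by subtracting \<open>[1|1]\<close>. This does not affect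
  cycles, because the constant cochain \<open>[1|1]\<close> is a coboundary. The last statement makes elements over
  commuting elements commute in the extension.
\<close>

lemma (in group) abelian_cycles_cocycle:
  defines "Q \<equiv> free_Abelian_group (carrier G \<times> carrier G) Mod abelian_cycles2 G"
    and "c \<equiv> \<lambda>p. abelian_cycles2 G #>\<^bsub>free_Abelian_group (carrier G \<times> carrier G)\<^esub>
      (frag_of p - frag_of (\<one>, \<one>))"
  shows "normalised_cocycle G Q c"
    and "z \<in> cycles2 G \<Longrightarrow>
      frag_eval Q c z = abelian_cycles2 G #>\<^bsub>free_Abelian_group (carrier G \<times> carrier G)\<^esub> z"
    and "g \<in> carrier G \<Longrightarrow> h \<in> carrier G \<Longrightarrow> g \<otimes> h = h \<otimes> g \<Longrightarrow> c (g, h) = c (h, g)"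
proof -
  let ?F = "free_Abelian_group (carrier G \<times> carrier G)" and ?M = "abelian_cycles2 G"
  let ?cl = "\<lambda>z. ?M #>\<^bsub>?F\<^esub> z"
  interpret F: comm_group ?F by (rule abelian_free_Abelian_group)
  interpret M: normal ?M ?F
    using subgroup_abelian_cycles2 F.normal_iff_subgroup by simp
  interpret Q: comm_group Q
    unfolding Q_def by (rule F.abelian_FactGroup[OF subgroup_abelian_cycles2])
  interpret cl: group_hom ?F Q ?cl
    using M.r_coset_hom_Mod by unfold_locales (simp add: Q_def)
  have gens: "boundaries2 G \<union> (\<Union>A\<in>abelian_subgroups G. cycles2 (G\<lparr>carrier := A\<rparr>)) \<subseteq> ?M"
    unfolding abelian_cycles2_def by (auto intro: generate.incl)
  have cl_one: "?cl z = \<one>\<^bsub>Q\<^esub>" if "z \<in> ?M" for z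
    using that F.coset_join2[OF _ subgroup_abelian_cycles2] M.mem_carrier by (simp add: Q_def)
  let ?e = "inv\<^bsub>Q\<^esub> ?cl (frag_of (\<one>, \<one>))" and ?d = "\<lambda>p. ?cl (frag_of p)"
  have e: "?e \<in> carrier Q"
    using cl.hom_closed[of "frag_of (\<one>, \<one>)"] by simp
  have d: "?d \<in> carrier G \<times> carrier G \<rightarrow> carrier Q"
    using cl.hom_closed by (intro funcsetI) simp
  have c_eq: "c p = ?e \<otimes>\<^bsub>Q\<^esub> ?d p" if "p \<in> carrier G \<times> carrier G" for p
  proof -
    have p: "frag_of p \<in> carrier ?F" and 1: "frag_of (\<one>, \<one>) \<in> carrier ?F"
      using that by simp_all
    have "frag_of p - frag_of (\<one>, \<one>) = inv\<^bsub>?F\<^esub> frag_of (\<one>, \<one>) \<otimes>\<^bsub>?F\<^esub> frag_of p"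
      by simp
    then show ?thesis
      unfolding c_def using cl.hom_mult[OF F.inv_closed[OF 1] p] cl.hom_inv[OF 1] by metis
  qed
  have c_fun: "c \<in> carrier G \<times> carrier G \<rightarrow> carrier Q"
  proof
    fix p assume p: "p \<in> carrier G \<times> carrier G"
    then have "?d p \<in> carrier Q" using d by blast
    then show "c p \<in> carrier Q" unfolding c_eq[OF p] by (rule Q.m_closed[OF e])
  qed
  have eval_d: "frag_eval Q ?d z = ?cl z" if "Poly_Mapping.keys z \<subseteq> carrier G \<times> carrier G" for z
    using d by (intro hom_free_Abelian_group_eqI[OF Q.is_group Q.frag_eval_hom[OF d] cl.homh _ that])
      (simp add: Pi_iff)
  show eval: "frag_eval Q c z = ?cl z" if z: "z \<in> cycles2 G" for z
  proof -
    have keys: "Poly_Mapping.keys z \<subseteq> carrier G \<times> carrier G"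
      using z by (simp add: cycles2_iff)
    have "frag_eval Q c z = frag_eval Q (\<lambda>p. ?e \<otimes>\<^bsub>Q\<^esub> ?d p) z"
    proof (rule frag_eval_cong[OF _ Q.comm_monoid_axioms _ Q.is_group])
      fix p assume "p \<in> Poly_Mapping.keys z"
      then have p: "p \<in> carrier G \<times> carrier G" using keys by blast
      then show "c p = ?e \<otimes>\<^bsub>Q\<^esub> ?d p" by (rule c_eq)
      with p c_fun show "?e \<otimes>\<^bsub>Q\<^esub> ?d p \<in> carrier Q" by fastforce
    qed
    also have "\<dots> = frag_eval Q (\<lambda>_. ?e) z \<otimes>\<^bsub>Q\<^esub> frag_eval Q ?d z"
      using e by (intro Q.frag_eval_mult_left[OF _ d keys]) simp
    also have "frag_eval Q (\<lambda>_. ?e) z = frag_eval Q (\<lambda>_. ?e) (bar_boundary2 G z)"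
      using e by (intro frag_eval_coboundary1[OF Q.comm_group_axioms _ keys]) simp_all
    also have "\<dots> = \<one>\<^bsub>Q\<^esub>"
      using z by (simp add: cycles2_iff) (simp add: frag_eval_def)
    finally show ?thesis
      using keys cl.hom_closed[of z] by (simp add: eval_d)
  qed
  have c_one: "c (\<one>, g) = \<one>\<^bsub>Q\<^esub>" if g: "g \<in> carrier G" for g
  proof -
    have "bar_boundary3 G (frag_of (\<one>, \<one>, g)) \<in> boundaries2 G"
      unfolding boundaries2_def using g by (intro imageI) simp
    then have "frag_of (\<one>, g) - frag_of (\<one>, \<one>) \<in> ?M"
      using gens g by (auto simp: bar_boundary3_def)
    then show ?thesis by (simp add: c_def cl_one)
  qed
  show "normalised_cocycle G Q c"
  proof
    fix z assume "z \<in> boundaries2 G"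
    then show "frag_eval Q c z = \<one>\<^bsub>Q\<^esub>"
      using eval cl_one gens boundaries2_subset_cycles2[OF is_group] by blast
  qed (use c_fun c_one in simp_all)
  show "c (g, h) = c (h, g)" if gh: "g \<in> carrier G" "h \<in> carrier G" "g \<otimes> h = h \<otimes> g"
  proof -
    obtain A where A: "A \<in> abelian_subgroups G" "g \<in> A" "h \<in> A"
      using gh by (rule commuting_pair_in_abelian_subgroup)
    have "frag_of (h, g) - frag_of (g, h) \<in> cycles2 (G\<lparr>carrier := A\<rparr>)"
      using A keys_diff[of "frag_of (h, g)" "frag_of (g, h)"] gh
      by (auto simp: cycles2_iff) (simp add: bar_boundary2_def frag_extend_diff)
    then have "frag_of (h, g) - frag_of (g, h) \<in> ?M"
      using gens A by blast
    then show ?thesis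
      using gh F.r_coset_eq_iff[OF subgroup_abelian_cycles2, of "frag_of (g, h) - frag_of (\<one>, \<one>)"
          "frag_of (h, g) - frag_of (\<one>, \<one>)"]
        keys_diff[of "frag_of (g, h)" "frag_of (\<one>, \<one>)"] keys_diff[of "frag_of (h, g)" "frag_of (\<one>, \<one>)"]
      by (auto simp: c_def)
  qed
qed

context conjugation_closed_generators
begin

lemma ambiguity_index_eq:
  assumes "central_extension C G \<beta> s"
  shows "ambiguity_index G S = card (central_extension.connecting C G \<beta> s ` cycles2 G)"
  using central_extension.connecting_image_cycles2[OF assms] by (simp add: ambiguity_index_def)

text \<open>
  A cycle killed by the connecting map of \<open>C\<close> lies in \<open>M\<close>. The homomorphism \<open>\<psi>\<close> from \<open>C\<close> to the extension
  with the tautological cocycle sends the value of the connecting map at \<open>z\<close> to the class of \<open>z\<close> modulo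
  \<open>M\<close>.
\<close>

lemma connecting_eq_imp_same_class:
  assumes "central_extension C G \<beta> s" "y \<in> cycles2 G" "z \<in> cycles2 G"
    and eq: "central_extension.connecting C G \<beta> s y = central_extension.connecting C G \<beta> s z"
  shows "abelian_cycles2 G #>\<^bsub>free_Abelian_group (carrier G \<times> carrier G)\<^esub> y =
    abelian_cycles2 G #>\<^bsub>free_Abelian_group (carrier G \<times> carrier G)\<^esub> z"
proof -
  interpret ce: central_extension C G \<beta> s by fact
  define Q where "Q = free_Abelian_group (carrier G \<times> carrier G) Mod abelian_cycles2 G"
  define c where "c = (\<lambda>p. abelian_cycles2 G #>\<^bsub>free_Abelian_group (carrier G \<times> carrier G)\<^esub>
    (frag_of p - frag_of (\<one>, \<one>)))"
  interpret E: normalised_cocycle G Q c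
    unfolding Q_def c_def by (rule abelian_cycles_cocycle(1))
  have comm: "x \<otimes>\<^bsub>E.E\<^esub> y = y \<otimes>\<^bsub>E.E\<^esub> x"
    if xyE: "x \<in> carrier E.E" "y \<in> carrier E.E" "fst x \<otimes> fst y = fst y \<otimes> fst x" for x y
  proof -
    obtain g a h b where xy: "x = (g, a)" "y = (h, b)"
      and [simp]: "g \<in> carrier G" "a \<in> carrier Q" "h \<in> carrier G" "b \<in> carrier Q"
      using xyE(1,2) by auto
    have gh: "g \<otimes> h = h \<otimes> g" using xyE(3) by (simp add: xy)
    then have "c (g, h) = c (h, g)"
      unfolding c_def by (intro abelian_cycles_cocycle(3)) simp_all
    then show ?thesis
      by (simp add: xy gh E.Q.m_comm[of a b])
  qed
  obtain e where e: "\<And>g. g \<in> carrier G \<Longrightarrow> e g \<in> carrier E.E" "\<And>g. g \<in> carrier G \<Longrightarrow> fst (e g) = g"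
    "\<And>x g. x \<in> carrier E.E \<Longrightarrow> g \<in> carrier G \<Longrightarrow>
      e (inv fst x \<otimes> g \<otimes> fst x) = inv\<^bsub>E.E\<^esub> x \<otimes>\<^bsub>E.E\<^esub> e g \<otimes>\<^bsub>E.E\<^esub> x"
    using E.E.equivariant_section[OF comm] by blast
  obtain \<psi> where \<psi>: "\<psi> \<in> hom C E.E" "\<And>g. g \<in> S \<Longrightarrow> \<psi> (Y g) = e g"
  proof (rule hom_C_lift[OF E.group_extension, of e])
    fix g h assume gh: "g \<in> S" "h \<in> S"
    then show "e (inv h \<otimes> g \<otimes> h) = inv\<^bsub>E.E\<^esub> e h \<otimes>\<^bsub>E.E\<^esub> e g \<otimes>\<^bsub>E.E\<^esub> e h"
      using e(3)[of "e h" g] e(1,2)[of h] by simp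
  qed (use e(1) in simp_all)
  have over: "fst (\<psi> u) = \<beta> u" if "u \<in> carrier C" for u
    by (rule hom_C_over[OF E.group_extension \<psi>(1) E.E.hom _ that]) (simp add: \<psi>(2) e(2))
  have "\<psi> (ce.connecting z) = (\<one>, abelian_cycles2 G #>\<^bsub>free_Abelian_group (carrier G \<times> carrier G)\<^esub> z)"
    if "z \<in> cycles2 G" for z
  proof -
    have keys: "Poly_Mapping.keys z \<subseteq> carrier G \<times> carrier G" using that by (simp add: cycles2_iff)
    show ?thesis
      using ce.connecting_natural[OF E.E.central_extension_axioms \<psi>(1) over that] E.connecting_eq_frag_eval[OF keys]
        abelian_cycles_cocycle(2)[OF that, folded Q_def c_def] by simp
  qed
  with assms(2,3) eq show ?thesis by (metis Pair_inject)
qed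

lemma b0_le_ambiguity_index_le_h2:
  assumes "finite (carrier G)"
  shows "b0 G \<le> ambiguity_index G S" "ambiguity_index G S \<le> h2 G"
proof -
  let ?F = "free_Abelian_group (carrier G \<times> carrier G)"
  let ?clB = "\<lambda>z. boundaries2 G #>\<^bsub>?F\<^esub> z" and ?clM = "\<lambda>z. abelian_cycles2 G #>\<^bsub>?F\<^esub> z"
  interpret F: comm_group ?F by (rule abelian_free_Abelian_group)
  have "\<forall>g\<in>carrier G. \<exists>u. u \<in> carrier C \<and> \<beta> u = g"
    by (auto elim: C_map_surj)
  from bchoice[OF this] obtain s where "\<forall>g\<in>carrier G. s g \<in> carrier C \<and> \<beta> (s g) = g" ..
  then have ce: "central_extension C G \<beta> s"
    by (intro central_extension_C) blast+
  interpret ce: central_extension C G \<beta> s by (rule ce)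
  have fin: "finite (?clB ` cycles2 G)"
    using finite_homology2[OF assms] by (simp add: homology2_def carrier_FactGroup r_coset_def)
  have factor: "ce.connecting y = ce.connecting z" if yz: "y \<in> cycles2 G" "z \<in> cycles2 G" "?clB y = ?clB z" for y z
  proof -
    have keys: "Poly_Mapping.keys y \<subseteq> carrier G \<times> carrier G" "Poly_Mapping.keys z \<subseteq> carrier G \<times> carrier G"
      using yz by (simp_all add: cycles2_iff)
    then have "z - y \<in> boundaries2 G"
      using yz F.r_coset_eq_iff[OF subgroup_boundaries2, of y z] by simp
    then have "ce.connecting z \<otimes>\<^bsub>C\<^esub> inv\<^bsub>C\<^esub> ce.connecting y = \<one>\<^bsub>C\<^esub>"
      using ce.connecting_boundaries2 ce.connecting_diff[OF keys(2,1)] by simp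
    then show ?thesis
      using ce.connecting_closed keys by (subst (asm) C.mult_inv_eq_one_iff) simp_all
  qed
  show "ambiguity_index G S \<le> h2 G"
    using card_image_le_if_factors[OF fin factor]
    by (simp add: ambiguity_index_eq[OF ce] h2_def order_def homology2_def carrier_FactGroup r_coset_def)
  have "card (?clM ` cycles2 G) \<le> card (ce.connecting ` cycles2 G)"
  proof (rule card_image_le_if_factors)
    show "finite (ce.connecting ` cycles2 G)"
      by (rule finite_image_if_factors[OF fin factor])
  qed (rule connecting_eq_imp_same_class[OF ce])
  then show "b0 G \<le> ambiguity_index G S"
    by (simp add: ambiguity_index_eq[OF ce] b0_eq_card_classes[OF assms])
qed

text \<open>
  With all nontrivial elements as generators, a section can be chosen with values \<open>y\<^sub>g\<close> for \<open>g \<noteq> 1\<close>.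
  Generators over commuting elements commute by the defining relations.
\<close>

lemma ambiguity_index_le_b0:
  assumes "finite (carrier G)" and S_all: "carrier G - {\<one>} \<subseteq> S"
  shows "ambiguity_index G S \<le> b0 G"
proof -
  let ?F = "free_Abelian_group (carrier G \<times> carrier G)"
  let ?Z = "?F\<lparr>carrier := cycles2 G\<rparr>"
  let ?clM = "\<lambda>z. abelian_cycles2 G #>\<^bsub>?F\<^esub> z"
  interpret F: comm_group ?F by (rule abelian_free_Abelian_group)
  define s where "s g = (if g = \<one> then \<one>\<^bsub>C\<^esub> else Y g)" for g
  have "central_extension C G \<beta> s"
    using S_all by (intro central_extension_C) (auto simp: s_def)
  then interpret ce: central_extension C G \<beta> s .
  have s_comm: "s g \<otimes>\<^bsub>C\<^esub> s h = s h \<otimes>\<^bsub>C\<^esub> s g"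
    if "g \<in> carrier G" "h \<in> carrier G" "g \<otimes> h = h \<otimes> g" for g h
  proof (cases "g = \<one> \<or> h = \<one>")
    case True
    have "s g \<in> carrier C" "s h \<in> carrier C" "s \<one> = \<one>\<^bsub>C\<^esub>"
      using that ce.s_closed by (simp_all add: s_def)
    with True show ?thesis by auto
  next
    case False
    then have S: "g \<in> S" "h \<in> S" using S_all that by auto
    have "inv h \<otimes> g \<otimes> h = g"
      using that by (simp add: m_assoc) (simp flip: m_assoc)
    then show ?thesis
      using False Y_mult_conj_right[OF S] by (simp add: s_def)
  qed
  have "ce.connecting \<in> hom ?Z C"
    using ce.connecting_closed ce.connecting_add by (intro homI) (auto simp: cycles2_iff)
  moreover have "ce.connecting z = \<one>\<^bsub>C\<^esub>" if "A \<in> abelian_subgroups G" "z \<in> cycles2 (G\<lparr>carrier := A\<rparr>)" for A z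
  proof (rule ce.connecting_abelian_cycles2[OF that(1) _ that(2)])
    fix g h assume gh: "g \<in> A" "h \<in> A"
    have A: "subgroup A G" "comm_group (G\<lparr>carrier := A\<rparr>)"
      using that(1) by (simp_all add: abelian_subgroups_def)
    have "g \<otimes> h = h \<otimes> g"
      using comm_groupE(4)[OF A(2), of g h] gh by simp
    then show "s g \<otimes>\<^bsub>C\<^esub> s h = s h \<otimes>\<^bsub>C\<^esub> s g"
      using gh subgroup.mem_carrier[OF A(1)] by (intro s_comm) simp_all
  qed
  ultimately have connecting_M: "ce.connecting z = \<one>\<^bsub>C\<^esub>" if "z \<in> abelian_cycles2 G" for z
    using hom_trivial_on_abelian_cycles2_iff[OF C.group_axioms, of ce.connecting] ce.connecting_boundaries2 that by blast
  have "ce.connecting y = ce.connecting z" if yz: "y \<in> cycles2 G" "z \<in> cycles2 G" "?clM y = ?clM z" for y z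
  proof -
    have keys: "Poly_Mapping.keys y \<subseteq> carrier G \<times> carrier G" "Poly_Mapping.keys z \<subseteq> carrier G \<times> carrier G"
      using yz by (simp_all add: cycles2_iff)
    then have "z - y \<in> abelian_cycles2 G"
      using yz F.r_coset_eq_iff[OF subgroup_abelian_cycles2, of y z] by simp
    then have "ce.connecting z \<otimes>\<^bsub>C\<^esub> inv\<^bsub>C\<^esub> ce.connecting y = \<one>\<^bsub>C\<^esub>"
      using connecting_M ce.connecting_diff[OF keys(2,1)] by simp
    then show ?thesis
      using ce.connecting_closed keys by (subst (asm) C.mult_inv_eq_one_iff) simp_all
  qed
  then have "card (ce.connecting ` cycles2 G) \<le> card (?clM ` cycles2 G)"
    by (rule card_image_le_if_factors[OF finite_classes[OF assms(1)]])
  then show ?thesis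
    by (simp add: ambiguity_index_eq[OF ce.central_extension_axioms] b0_eq_card_classes[OF assms(1)])
qed

end

theorem theorem1:
  fixes G :: "('a, 'm) monoid_scheme" and S :: "'a set"
  assumes "equipped_finite_group G S"
  shows "b0 G \<le> ambiguity_index G S \<and> ambiguity_index G S \<le> h2 G \<and>
         ambiguity_index G (carrier G - {\<one>\<^bsub>G\<^esub>}) = b0 G"
proof -
  interpret group G
    using assms by (simp add: equipped_finite_group_def)
  have fin: "finite (carrier G)" and gen: "generate G S = carrier G"
    using assms by (simp_all add: equipped_finite_group_def)
  obtain D where D: "D \<subseteq> carrier G" "S = (\<Union>x\<in>D. conjugacy_class G x)"
    using assms by (auto simp: equipped_finite_group_def)
  interpret S: conjugation_closed_generators G S
  proof
    show "S \<subseteq> carrier G"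
      using D by (auto simp: conjugacy_class_def)
    show "k \<otimes>\<^bsub>G\<^esub> g \<otimes>\<^bsub>G\<^esub> inv\<^bsub>G\<^esub> k \<in> S" if "g \<in> S" "k \<in> carrier G" for g k
      using that D conjugate_in_conjugacy_class by blast
  qed (rule gen)
  let ?T = "carrier G - {\<one>\<^bsub>G\<^esub>}"
  interpret T: conjugation_closed_generators G ?T
  proof
    fix g k assume gk: "g \<in> ?T" "k \<in> carrier G"
    have "k \<otimes>\<^bsub>G\<^esub> g \<otimes>\<^bsub>G\<^esub> inv\<^bsub>G\<^esub> k = \<one>\<^bsub>G\<^esub> \<Longrightarrow> g = \<one>\<^bsub>G\<^esub>"
    proof -
      assume "k \<otimes>\<^bsub>G\<^esub> g \<otimes>\<^bsub>G\<^esub> inv\<^bsub>G\<^esub> k = \<one>\<^bsub>G\<^esub>"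
      then have "k \<otimes>\<^bsub>G\<^esub> g = k"
        using gk by (simp add: mult_inv_eq_one_iff)
      then show "g = \<one>\<^bsub>G\<^esub>"
        using gk by simp
    qed
    then show "k \<otimes>\<^bsub>G\<^esub> g \<otimes>\<^bsub>G\<^esub> inv\<^bsub>G\<^esub> k \<in> ?T"
      using gk by auto
  next
    show "generate G ?T = carrier G"
    proof
      show "generate G ?T \<subseteq> carrier G" by (rule generate_incl) auto
      show "carrier G \<subseteq> generate G ?T"
      proof
        fix g assume "g \<in> carrier G"
        then show "g \<in> generate G ?T"
          by (cases "g = \<one>\<^bsub>G\<^esub>") (auto intro: generate.one generate.incl)
      qed
    qed
  qed auto
  show ?thesis
    using S.b0_le_ambiguity_index_le_h2[OF fin] T.b0_le_ambiguity_index_le_h2(1)[OF fin]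
      T.ambiguity_index_le_b0[OF fin] by (auto intro: antisym)
qed

end
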